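(* In the setting described in the context, let $e=\{v,w\}$ be a diagonal edge of $G$ with $v\in V(H^\perp)$. Then the number of dimer coverings of $G$ containing the impurity $e$ equals $|\det A|\,p_v$. Consequently the total number of dimer coverings of $G$ is $$|\mathcal M(G)|=|\det A|\Big(4\sum_{v\in V(H^\perp)}p_v+d^*-3\Big)=|\det A|\big(4\langle\mathbf 1,A^{-1}\mathbf b\rangle+d^*+1\big),$$ where $\mathbf 1=(1,\dots,1)^t$.
   Context: Let $\Gamma$ be the graph with vertex set $\mathbb Z^2$, divided into white vertices $W=\{(x,y): x+y \text{ even}\}$ and black vertices $B=\mathbb Z^2\setminus W$; $v,v'$ are adjacent iff $v-v'\in\{\pm(1,0),\pm(0,1)\}$, or $v,v'\in W$ and $v-v'\in\{\pm(1,1),\pm(1,-1)\}$ (the latter are diagonal edges). A subgraph of $\Gamma$ is normal if it is induced by a finite vertex set and both it and the subgraph induced by the complementary vertex set are connected. A dimer covering of a graph is a set of its edges covering every vertex exactly once; a dimer covering of $G$ contains the impurity $e$ if the diagonal edge $e$ belongs to it. $\mathcal M(G)$ is the set of dimer coverings of $G$. Let $W_0=2\mathbb Z\times 2\mathbb Z$, $W_1=W_0+(1,1)$; $\Lambda$ is the graph on $W_0$ with edges $\{v,v'\}$, $v-v'\in\{\pm(2,0),\pm(0,2)\}$, and $\Lambda^\perp$ the analogous graph on $W_1$. Setting: $H$ is a finite subgraph of $\Lambda$ formed by the boundaries of a finite set $\mathcal F$ of faces of $\Lambda$ (squares of side $2$ with corners in $W_0$), with simply connected union; the centres of these faces lie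 in $W_1$. $f^*\in W_1$ is a point which is not a centre of a face in $\mathcal F$, chosen so that the subgraph of $\Lambda^\perp$ induced by the face-centres together with $f^*$ is simply connected. $H^\perp$ is the planar dual of $H$ whose outer-face vertex is $f^*$: $V(H^\perp)$ consists of the face centres and $f^*$, and for every edge $e$ of $H$ there is one edge $e^\perp$ of $H^\perp$ joining the vertices representing the two faces on either side of $e$. $d^*$ is the number of edges of $\Lambda^\perp$ joining $f^*$ to face centres. $v^*$ is a vertex of $H$ on the boundary of the outer face with $v^*-f^*\in\{\pm(1,1),\pm(1,-1)\}$. $G$ is the subgraph of $\Gamma$ induced by $V(H)\cup V(H^\perp)\cup\{\text{midpoints of edges of }H\}$, assumed normal. $A$ is the square matrix indexed by $V(H^\perp)\setminus\{f^*\}$ (the face centres) with entries $a_{u,u}=4$, $a_{u,u'}=-1$ if the faces with centres $u\neq u'$ share an edge of $H$, and $a_{u,u'}=0$ otherwise (the negative Laplacian of $H^\perp$ with the row and column of $f^*$ removed). $\mathbf b=(b_u)$ is indexed by the face centres with $b_u=1$ if $u$ is adjacent to $f^*$ in $\Lambda^\perp$ and $b_u=0$ otherwise. $A$ is invertible, and $\mathbf p=(p_u)_{u\ne f^*}=A^{-1}\mathbf b$; also $p_{f^*}=1$. (Equivalently, $p_u$ is the probability that simple random walk on $H^\perp$ started at $u$ first reaches $f^*$ through one of the edges of $\Lambda^\perp$ joining $f^*$ to a face centre.) *)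

theory Defs
  imports "HOL-Analysis.Analysis"
begin

type_synonym pt = "int \<times> int"

definition white :: "pt \<Rightarrow> bool" where
  "white v \<longleftrightarrow> even (fst v + snd v)"

definition diag_adj :: "pt \<Rightarrow> pt \<Rightarrow> bool" where
  "diag_adj v w \<longleftrightarrow> white v \<and> white w \<and>
     \<bar>fst v - fst w\<bar> = 1 \<and> \<bar>snd v - snd w\<bar> = 1"

definition gamma_adj :: "pt \<Rightarrow> pt \<Rightarrow> bool" where
  "gamma_adj v w \<longleftrightarrow>
     (\<bar>fst v - fst w\<bar> + \<bar>snd v - snd w\<bar> = 1) \<or> diag_adj v w"

definition connected_on :: "(pt \<Rightarrow> pt \<Rightarrow> bool) \<Rightarrow> pt set \<Rightarrow> bool" where
  "connected_on adj S \<longleftrightarrow>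
     (\<forall>x\<in>S. \<forall>y\<in>S. (\<lambda>a b. a \<in> S \<and> b \<in> S \<and> adj a b)\<^sup>*\<^sup>* x y)"

definition normal :: "pt set \<Rightarrow> bool" where
  "normal S \<longleftrightarrow> finite S \<and> connected_on gamma_adj S \<and> connected_on gamma_adj (- S)"

definition induced_edges :: "pt set \<Rightarrow> pt set set" where
  "induced_edges S = {{v, w} | v w. v \<in> S \<and> w \<in> S \<and> gamma_adj v w}"

definition dimer_coverings :: "pt set \<Rightarrow> pt set set set" where
  "dimer_coverings S =
     {M. M \<subseteq> induced_edges S \<and> (\<forall>x\<in>S. \<exists>!e. e \<in> M \<and> x \<in> e)}"

definition W0 :: "pt set" where "W0 = {v. even (fst v) \<and> even (snd v)}"
definition W1 :: "pt set" where "W1 = {v. odd (fst v) \<and> odd (snd v)}"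

text \<open>adjacency in Lambda and in Lambda-perp (difference in +-(2,0), +-(0,2))\<close>
definition lat2_adj :: "pt \<Rightarrow> pt \<Rightarrow> bool" where
  "lat2_adj u w \<longleftrightarrow>
     (\<bar>fst u - fst w\<bar> = 2 \<and> snd u = snd w) \<or> (fst u = fst w \<and> \<bar>snd u - snd w\<bar> = 2)"

text \<open>the face of Lambda with centre c (c in W1) as a closed square in the plane\<close>
definition face_square :: "pt \<Rightarrow> (real \<times> real) set" where
  "face_square c = cbox (of_int (fst c) - 1, of_int (snd c) - 1)
                        (of_int (fst c) + 1, of_int (snd c) + 1)"

definition to_plane :: "pt \<Rightarrow> real \<times> real" where
  "to_plane v = (of_int (fst v), of_int (snd v))"

text \<open>vertices of H: corners of the faces with centres in F\<close>
definition corners :: "pt set \<Rightarrow> pt set" where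
  "corners F = {(fst c + i, snd c + j) | c i j. c \<in> F \<and> i \<in> {-1, 1} \<and> j \<in> {-1, 1}}"

definition midpoints :: "pt set \<Rightarrow> pt set" where
  "midpoints F = {(fst c + i, snd c + j) | c i j. c \<in> F \<and>
       (i, j) \<in> {(1, 0), (-1, 0), (0, 1), (0, -1)}}"

text \<open>geometric realisation of the subgraph of Lambda-perp induced by a vertex set S:
  its vertices, its edges (closed segments), and the closed squares of Lambda-perp
  all four corners of which lie in S\<close>
definition perp_complex :: "pt set \<Rightarrow> (real \<times> real) set" where
  "perp_complex S =
     to_plane ` S
     \<union> (\<Union>{closed_segment (to_plane u) (to_plane w) | u w. u \<in> S \<and> w \<in> S \<and> lat2_adj u w})
     \<union> (\<Union>{cbox (to_plane a) (to_plane (fst a + 2, snd a + 2)) | a.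
            a \<in> S \<and> (fst a + 2, snd a) \<in> S \<and> (fst a, snd a + 2) \<in> S \<and> (fst a + 2, snd a + 2) \<in> S})"

definition Amat :: "pt \<Rightarrow> pt \<Rightarrow> real" where
  "Amat u u' = (if u = u' then 4 else if lat2_adj u u' then -1 else 0)"

definition bvec :: "pt \<Rightarrow> pt \<Rightarrow> real" where
  "bvec fstar u = (if lat2_adj fstar u then 1 else 0)"

definition dstar :: "pt set \<Rightarrow> pt \<Rightarrow> nat" where
  "dstar F fstar = card {u \<in> F. lat2_adj fstar u}"

definition det_on :: "pt set \<Rightarrow> (pt \<Rightarrow> pt \<Rightarrow> real) \<Rightarrow> real" where
  "det_on I M = (\<Sum>\<pi> \<in> {\<pi>. \<pi> permutes I}. of_int (sign \<pi>) * (\<Prod>u\<in>I. M u (\<pi> u)))"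

end

theory Submission
  imports Defs "HOL-Complex_Analysis.Cauchy_Integral_Formula"
begin

text \<open>The proof is a Temperley bijection. In a covering with impurity \<open>{v, w}\<close>, every other white vertex is matched
  with a midpoint, which gives it a direction. The directions of the faces form a configuration, the directions
  of the corners a spanning tree rooted at \<open>w\<close>. There are no cycles: the region enclosed by a cycle on one
  sublattice is matched within itself, apart from \<open>v\<close> and \<open>w\<close>, and therefore contains a cycle on the other
  sublattice, which encloses a smaller region. Hence the configuration determines the covering, and the
  configurations that occur are those without cycles in which the path starting at \<open>fstar\<close> ends at \<open>v\<close>.
  Expanding the rows of \<open>A\<close>, with row \<open>v\<close> replaced by \<open>b\<close>, as sums over directions shows that the determinant
  counts exactly these configurations, and by Cramer's rule it equals \<open>det A * p v\<close>. Normality of \<open>G\<close> says that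
  every region bounded by a cycle of \<open>G\<close> lies in \<open>G\<close>. The existence of a bijection also shows that there are two
  more white than black vertices, so that each covering contains exactly one impurity.\<close>

section \<open>The lattice and winding numbers modulo 2\<close>

text \<open>The two sublattices have the same black points as midpoints of their edges, so a set of
  black points is a set of primal and of dual edges at once. With the sublattice as a boolean
  parameter one argument serves both. On the lattice, topology is done modulo 2: a region is a
  finite set of dual vertices whose membership changes exactly across the given edges, and it exists
  as soon as every vertex meets an even number of them. Simple closed curves and the Jordan curve
  theorem are thus avoided. A configuration has one direction per row of the determinant: row
  \<open>v\<close> is replaced by \<open>b\<close>, a sum of unit vectors at the neighbours of
  \<open>fs\<close>, so the direction of \<open>fs\<close> takes the place of the one that
  \<open>v\<close> lacks. A step that leaves \<open>F\<close> needs no sink, since its column is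
  absent from the determinant. The number \<open>dstar F fs + 1\<close> counts the corners of the
  square around \<open>fs\<close> that belong to \<open>H\<close>: together with the
  \<open>dstar F fs\<close> sides in \<open>H\<close> they form a path, because of simple
  connectedness and normality.\<close>

definition lat :: "bool \<Rightarrow> pt \<Rightarrow> bool" where
  "lat a z \<longleftrightarrow> odd (fst z) = a \<and> odd (snd z) = a"

definition black :: "pt \<Rightarrow> bool" where
  "black z \<longleftrightarrow> odd (fst z + snd z)"

definition dirs :: "pt set" where
  "dirs = {(1, 0), (-1, 0), (0, 1), (0, -1)}"

definition near :: "pt \<Rightarrow> pt \<Rightarrow> bool" where
  "near p q \<longleftrightarrow> \<bar>fst p - fst q\<bar> \<le> 1 \<and> \<bar>snd p - snd q\<bar> \<le> 1"

text \<open>Inequality of booleans is addition modulo 2, so this is the parity of the number of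
  edges of \<open>C\<close> at \<open>q\<close>.\<close>

definition odd_at :: "pt set \<Rightarrow> pt \<Rightarrow> bool" where
  "odd_at C q \<longleftrightarrow>
     ((q + (1, 0) \<in> C) \<noteq> (q + (-1, 0) \<in> C)) \<noteq> ((q + (0, 1) \<in> C) \<noteq> (q + (0, -1) \<in> C))"

text \<open>In the language of chains modulo 2, \<open>C\<close> is the boundary of
  \<open>D\<close>. Finiteness selects the bounded region rather than its complement.\<close>

definition fills :: "bool \<Rightarrow> pt set \<Rightarrow> pt set \<Rightarrow> bool" where
  "fills a C D \<longleftrightarrow> finite D \<and> (\<forall>f\<in>D. lat (\<not> a) f) \<and>
     (\<forall>f d. lat (\<not> a) f \<longrightarrow> d \<in> dirs \<longrightarrow> ((f \<in> D) \<noteq> (f + d + d \<in> D)) = (f + d \<in> C))"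

lemma dirs_cases:
  assumes "d \<in> dirs"
  obtains "d = (1, 0)" | "d = (-1, 0)" | "d = (0, 1)" | "d = (0, -1)"
  using assms by (auto simp: dirs_def)

lemma axis_dirs [simp]: "(1, 0) \<in> dirs" "(-1, 0) \<in> dirs" "(0, 1) \<in> dirs" "(0, -1) \<in> dirs"
  by (auto simp: dirs_def)

lemma finite_dirs [simp]: "finite dirs"
  by (simp add: dirs_def)

lemma lat_step [simp]: "lat a (z + d + d) = lat a z"
  by (cases z, cases d) (auto simp: lat_def)

lemma step_ne:
  assumes "d \<in> dirs"
  shows "z + d + d \<noteq> z"
proof
  assume eq: "z + d + d = z"
  have "fst (z + d + d) = fst z" "snd (z + d + d) = snd z" by (simp_all only: eq)
  then have "fst d = 0" "snd d = 0" unfolding fst_add snd_add by linarith+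
  then show False using assms unfolding dirs_def by fastforce
qed

lemma black_step: "lat a z \<Longrightarrow> d \<in> dirs \<Longrightarrow> black (z + d)"
  by (cases z) (auto simp: lat_def black_def dirs_def)

lemma lat_not_black: "lat a z \<Longrightarrow> \<not> black z"
  by (cases z) (auto simp: lat_def black_def)

lemma lat_disj: "lat a z \<Longrightarrow> lat b z \<Longrightarrow> a = b"
  by (auto simp: lat_def)

lemma lat_or_black: "black z \<or> lat True z \<or> lat False z"
  by (auto simp: lat_def black_def)

lemma uminus_dirs: "d \<in> dirs \<Longrightarrow> - d \<in> dirs"
  by (auto simp: dirs_def)

lemma int_near_same: "\<bar>x - y\<bar> \<le> 1 \<Longrightarrow> odd x = odd y \<Longrightarrow> x = y" for x y :: int
  by presburger

lemma int_near_diff: "\<bar>x - y\<bar> \<le> 1 \<Longrightarrow> odd x \<noteq> odd y \<Longrightarrow> x = y + 1 \<or> x = y - 1" for x y :: int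
  by presburger

lemma near_sym: "near p q \<Longrightarrow> near q p"
  by (auto simp: near_def)

lemma near_lat_diff:
  assumes "near p q" "lat a p" "lat (\<not> a) q"
  shows "q \<in> {p + (1, 1), p + (1, -1), p + (-1, 1), p + (-1, -1)}"
proof -
  obtain x y x' y' where [simp]: "p = (x, y)" "q = (x', y')" by fastforce
  have "\<bar>x' - x\<bar> \<le> 1" "odd x' \<noteq> odd x" "\<bar>y' - y\<bar> \<le> 1" "odd y' \<noteq> odd y"
    using assms by (auto simp: near_def lat_def)
  then have "x' = x + 1 \<or> x' = x - 1" "y' = y + 1 \<or> y' = y - 1"
    by (auto dest!: int_near_diff)
  then show ?thesis by auto
qed

lemma near_lat_diffD:
  assumes "lat a p" "q \<in> {p + (1, 1), p + (1, -1), p + (-1, 1), p + (-1, -1)}"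
  shows "near p q" "lat (\<not> a) q"
  using assms by (cases p, auto simp: near_def lat_def)+

text \<open>A black point has exactly one odd coordinate, so on a given sublattice its position
  decides whether the edge with this midpoint is horizontal or vertical.\<close>

lemma black_ends:
  assumes "lat a z" "d \<in> dirs" "lat a q" "e \<in> dirs" "z + d = q + e"
  shows "q = z \<and> e = d \<or> q = z + d + d \<and> e = - d"
proof -
  obtain x y x' y' i j k l where [simp]: "z = (x, y)" "q = (x', y')" "d = (i, j)" "e = (k, l)"
    by fastforce
  have "odd x = odd x'" "odd y = odd y'" "x + i = x' + k" "y + j = y' + l"
    using assms(1,3,5) by (simp_all add: lat_def)
  moreover have "(i = 1 \<or> i = -1) \<and> j = 0 \<or> i = 0 \<and> (j = 1 \<or> j = -1)"
    "(k = 1 \<or> k = -1) \<and> l = 0 \<or> k = 0 \<and> (l = 1 \<or> l = -1)"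
    using assms(2,4) by (auto simp: dirs_def)
  ultimately have "x' = x \<and> y' = y \<and> k = i \<and> l = j \<or> x' = x + i + i \<and> y' = y + j + j \<and> k = - i \<and> l = - j"
    by (elim disjE conjE; presburger)
  then show ?thesis by simp
qed

text \<open>The two edges with a common midpoint, one on each sublattice, are perpendicular; every
  end of one is diagonally next to every end of the other.\<close>

lemma black_sides:
  assumes "lat a z" "d \<in> dirs" "lat (\<not> a) q" "e \<in> dirs" "z + d = q + e"
  shows "near q z"
proof -
  obtain x y x' y' i j k l where [simp]: "z = (x, y)" "q = (x', y')" "d = (i, j)" "e = (k, l)"
    by fastforce
  have *: "\<bar>q - p\<bar> \<le> 1" if "odd p \<noteq> odd q" "p + r = q + s" "\<bar>r\<bar> \<le> 1" "\<bar>s\<bar> \<le> 1" for p q r s :: int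
    using that by presburger
  have "odd x \<noteq> odd x'" "odd y \<noteq> odd y'" "x + i = x' + k" "y + j = y' + l"
    using assms(1,3,5) by (auto simp add: lat_def)
  moreover have "\<bar>i\<bar> \<le> 1" "\<bar>j\<bar> \<le> 1" "\<bar>k\<bar> \<le> 1" "\<bar>l\<bar> \<le> 1"
    using assms(2,4) by (auto simp: dirs_def)
  ultimately have "\<bar>x' - x\<bar> \<le> 1" "\<bar>y' - y\<bar> \<le> 1"
    using * by blast+
  then show ?thesis by (simp add: near_def)
qed

lemma odd_at_two:
  assumes "d1 \<in> dirs" "d2 \<in> dirs" "d1 \<noteq> d2"
    and "\<And>d. d \<in> dirs \<Longrightarrow> q + d \<in> C \<longleftrightarrow> d = d1 \<or> d = d2"
  shows "\<not> odd_at C q"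
proof -
  show ?thesis
    unfolding odd_at_def assms(4)[OF axis_dirs(1)] assms(4)[OF axis_dirs(2)] assms(4)[OF axis_dirs(3)] assms(4)[OF axis_dirs(4)]
    using assms(1-3) by (elim dirs_cases) simp_all
qed

lemma odd_at_none: "(\<And>d. d \<in> dirs \<Longrightarrow> q + d \<notin> C) \<Longrightarrow> \<not> odd_at C q"
  unfolding odd_at_def using axis_dirs by metis

lemma even_at_another:
  assumes "\<not> odd_at C q" "d \<in> dirs" "q + d \<in> C"
  obtains e where "e \<in> dirs" "e \<noteq> d" "q + e \<in> C"
proof -
  have "\<exists>e\<in>dirs. e \<noteq> d \<and> q + e \<in> C"
  proof (rule ccontr)
    assume "\<not> (\<exists>e\<in>dirs. e \<noteq> d \<and> q + e \<in> C)"
    then have *: "q + e \<in> C \<longleftrightarrow> e = d" if "e \<in> dirs" for e using that assms(3) by blast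
    show False
      using assms(1,2) unfolding odd_at_def *[OF axis_dirs(1)] *[OF axis_dirs(2)] *[OF axis_dirs(3)] *[OF axis_dirs(4)]
      by (elim dirs_cases) simp_all
  qed
  then show ?thesis using that by blast
qed

lemma odd_at_sym_diff: "odd_at (sym_diff A B) q \<longleftrightarrow> odd_at A q \<noteq> odd_at B q"
  unfolding odd_at_def Un_iff Diff_iff by argo

lemma odd_at_single:
  assumes "lat a x" "d \<in> dirs" "lat a q"
  shows "odd_at {x + d} q \<longleftrightarrow> (q = x) \<noteq> (q = x + d + d)"
proof -
  have *: "q + e \<in> {x + d} \<longleftrightarrow> q = x \<and> e = d \<or> q = x + d + d \<and> e = - d" if "e \<in> dirs" for e
  proof
    assume "q + e \<in> {x + d}"
    then show "q = x \<and> e = d \<or> q = x + d + d \<and> e = - d"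
      using black_ends[OF assms(1,2,3) that] by simp
  next
    assume "q = x \<and> e = d \<or> q = x + d + d \<and> e = - d"
    then show "q + e \<in> {x + d}" by (elim disjE conjE) simp_all
  qed
  have "x \<noteq> x + d + d" using assms(2) by (auto simp: dirs_def prod_eq_iff)
  then have ne: "\<not> (q = x \<and> q = x + d + d)" by metis
  show ?thesis
  proof -
    define P where "P \<longleftrightarrow> q = x"
    define Q where "Q \<longleftrightarrow> q = x + d + d"
    have PQ: "\<not> (P \<and> Q)" using ne unfolding P_def Q_def .
    have "odd_at {x + d} q \<longleftrightarrow> P \<or> Q"
      unfolding odd_at_def *[OF axis_dirs(1)] *[OF axis_dirs(2)] *[OF axis_dirs(3)] *[OF axis_dirs(4)] P_def[symmetric] Q_def[symmetric]
      using assms(2) PQ by (elim dirs_cases; simp; argo)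
    then show ?thesis using PQ unfolding P_def Q_def by blast
  qed
qed

text \<open>The parity of the number of crossings of the horizontal ray going left from a face is its
  winding number modulo 2.\<close>

lemma fills_exists:
  assumes fin: "finite C" and ev: "\<And>q. lat a q \<Longrightarrow> \<not> odd_at C q"
  shows "\<exists>D. fills a C D"
proof -
  define R where "R f = {m \<in> C. snd m = snd f \<and> fst m < fst f \<and> odd (fst m) = a}" for f :: pt
  define D where "D = {f. lat (\<not> a) f \<and> odd (card (R f))}"
  have finR [simp]: "finite (R f)" for f unfolding R_def using fin by auto
  have right: "(f \<in> D) \<noteq> (f + (2, 0) \<in> D) \<longleftrightarrow> f + (1, 0) \<in> C" if f: "lat (\<not> a) f" for f
  proof -
    obtain x y where [simp]: "f = (x, y)" by fastforce
    have x: "odd x \<noteq> a" and l: "lat (\<not> a) (x + 2, y)" using f by (auto simp: lat_def)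
    \<comment> \<open>Moving one face to the right lengthens the ray by a single edge, the one at
      \<open>x + 1\<close>.\<close>
    have *: "i < x + 2 \<and> odd i = a \<longleftrightarrow> i < x \<and> odd i = a \<or> i = x + 1" for i
      using x by (cases a; simp; presburger)
    have "R (x + 2, y) = R (x, y) \<union> ({(x + 1, y)} \<inter> C)"
    proof (rule set_eqI)
      fix m
      show "m \<in> R (x + 2, y) \<longleftrightarrow> m \<in> R (x, y) \<union> ({(x + 1, y)} \<inter> C)"
        using *[of "fst m"] x unfolding R_def by (cases m) auto
    qed
    moreover have "(x + 1, y) \<notin> R (x, y)" unfolding R_def by auto
    ultimately have "card (R (x + 2, y)) = card (R (x, y)) + (if (x + 1, y) \<in> C then 1 else 0)"
      by (cases "(x + 1, y) \<in> C") auto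
    then show ?thesis using f l unfolding D_def by auto
  qed
  \<comment> \<open>All of \<open>C\<close> lies strictly inside the square of radius
    \<open>L\<close> about the origin.\<close>
  define L where "L = Max ((\<lambda>m. max \<bar>fst m\<bar> \<bar>snd m\<bar>) ` C) + 1"
  have L: "\<bar>fst m\<bar> < L \<and> \<bar>snd m\<bar> < L" if m: "m \<in> C" for m
  proof -
    have "max \<bar>fst m\<bar> \<bar>snd m\<bar> \<le> L - 1"
      using Max_ge[OF finite_imageI[OF fin] imageI[OF m], of "\<lambda>m. max \<bar>fst m\<bar> \<bar>snd m\<bar>"]
      unfolding L_def by simp
    then show ?thesis by linarith
  qed
  have Rleft: "R f = {}" if "fst f \<le> - L" for f using L that unfolding R_def by fastforce
  have Rrow: "R f = {}" if "\<bar>snd f\<bar> \<ge> L" for f using L that unfolding R_def by fastforce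
  \<comment> \<open>To the left of \<open>C\<close> both faces have an empty ray. The even number of
    edges of \<open>C\<close> at the lattice point \<open>(x - 1, y + 1)\<close>, together with
    \<open>right\<close> in the two rows, carries the claim on to the next column of faces.\<close>
  have up: "(f \<in> D) \<noteq> (f + (0, 2) \<in> D) \<longleftrightarrow> f + (0, 1) \<in> C" if f: "lat (\<not> a) f" for f
  proof -
    obtain x y where fxy: "f = (x, y)" by fastforce
    have "lat (\<not> a) (x, y) \<Longrightarrow> ((x, y) \<in> D) \<noteq> ((x, y + 2) \<in> D) \<longleftrightarrow> (x, y + 1) \<in> C" for x
    proof (induction "nat (x + L)" arbitrary: x rule: less_induct)
      case less
      show ?case
      proof (cases "x \<le> - L")
        case True
        have "R (x, y) = {}" "R (x, y + 2) = {}" using Rleft True by auto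
        then have "(x, y) \<notin> D" "(x, y + 2) \<notin> D" unfolding D_def by auto
        moreover have "(x, y + 1) \<notin> C" using L[of "(x, y + 1)"] True by auto
        ultimately show ?thesis by simp
      next
        case False
        have l1: "lat (\<not> a) (x - 2, y)" "lat (\<not> a) (x - 2, y + 2)" "lat a (x - 1, y + 1)"
          using less.prems by (auto simp: lat_def)
        have "((x - 2, y) \<in> D) \<noteq> ((x - 2, y + 2) \<in> D) \<longleftrightarrow> (x - 2, y + 1) \<in> C"
          using less.hyps[of "x - 2"] False l1 by auto
        moreover have "((x - 2, y) \<in> D) \<noteq> ((x, y) \<in> D) \<longleftrightarrow> (x - 1, y) \<in> C"
          using right[OF l1(1)] by simp
        moreover have "((x - 2, y + 2) \<in> D) \<noteq> ((x, y + 2) \<in> D) \<longleftrightarrow> (x - 1, y + 2) \<in> C"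
          using right[OF l1(2)] by simp
        moreover have "(((x, y + 1) \<in> C) \<noteq> ((x - 2, y + 1) \<in> C)) = (((x - 1, y + 2) \<in> C) \<noteq> ((x - 1, y) \<in> C))"
          using ev[OF l1(3)] unfolding odd_at_def by (simp add: add.commute)
        ultimately show ?thesis by argo
      qed
    qed
    then show ?thesis using f by (simp add: fxy)
  qed
  \<comment> \<open>Right of \<open>C\<close> no edge of \<open>C\<close> is crossed by moving up,
    and the start below \<open>C\<close> has an empty ray. This is what makes \<open>D\<close>
    bounded.\<close>
  have Dright: "(x, y) \<notin> D" if "x \<ge> L" for x y
  proof (cases "lat (\<not> a) (x, y)")
    case True
    have "lat (\<not> a) (x, y) \<Longrightarrow> (x, y) \<notin> D" for y
    proof (induction "nat (y + L)" arbitrary: y rule: less_induct)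
      case less
      show ?case
      proof (cases "y \<le> - L")
        case True
        then have "R (x, y) = {}" using Rrow[of "(x, y)"] by auto
        then show ?thesis unfolding D_def by simp
      next
        case False
        have l1: "lat (\<not> a) (x, y - 2)" using less.prems by (auto simp: lat_def)
        have "(x, y - 2) \<notin> D" using less.hyps[of "y - 2"] False l1 by auto
        moreover have "(x, y - 1) \<notin> C" using L[of "(x, y - 1)"] that by auto
        ultimately show ?thesis using up[OF l1] by simp
      qed
    qed
    then show ?thesis using True .
  qed (auto simp: D_def)
  have "D \<subseteq> {-L..L} \<times> {-L..L}"
  proof
    fix f assume f: "f \<in> D"
    then have "R f \<noteq> {}" unfolding D_def by auto
    then have "fst f > - L" "\<bar>snd f\<bar> < L" using Rleft[of f] Rrow[of f] by force+
    moreover have "fst f < L" using Dright[of "fst f" "snd f"] f by force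
    ultimately show "f \<in> {-L..L} \<times> {-L..L}" by (cases f) auto
  qed
  then have "finite D" by (rule finite_subset) auto
  moreover have "((f \<in> D) \<noteq> (f + d + d \<in> D)) = (f + d \<in> C)" if "lat (\<not> a) f" "d \<in> dirs" for f d
  proof -
    obtain x y where f: "f = (x, y)" by fastforce
    have l: "lat (\<not> a) (x - 2, y)" "lat (\<not> a) (x, y - 2)" using that by (auto simp: lat_def f)
    from that(2) show ?thesis
      using right[OF that(1)] up[OF that(1)] right[OF l(1)] up[OF l(2)]
      by (cases rule: dirs_cases; simp add: f add.commute; argo)
  qed
  ultimately have "fills a C D" unfolding fills_def D_def by blast
  then show ?thesis by blast
qed

section \<open>Regions bounded by chains\<close>

lemma int_two_steps:
  fixes x y q :: int
  assumes "\<bar>q - x\<bar> \<le> 1" "\<bar>q - y\<bar> \<le> 1" "odd x = odd y"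
  shows "y = x \<or> y = x + 2 \<or> y = x - 2"
  using assms by presburger

text \<open>Two faces near the same point are equal, neighbours, or opposite in a block of four. In
  the last case there are two ways round through different faces, so a single forbidden face can be
  avoided.\<close>

lemma near_chain:
  assumes n: "near q f" "near q g" and l: "lat b f" "lat b g"
  shows "g = f \<or> (\<exists>d\<in>dirs. g = f + d + d) \<or>
    (\<exists>d\<in>dirs. \<exists>e\<in>dirs. g = f + d + d + e + e \<and> g = f + e + e + d + d \<and>
      near q (f + d + d) \<and> near q (f + e + e) \<and> f + d + d \<noteq> f + e + e)"
proof -
  obtain x y x' y' where [simp]: "f = (x, y)" "g = (x', y')" by fastforce
  have x: "x' = x \<or> x' = x + 2 \<or> x' = x - 2" and y: "y' = y \<or> y' = y + 2 \<or> y' = y - 2"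
    using n l int_two_steps[of "fst q" x x'] int_two_steps[of "snd q" y y']
    by (auto simp: near_def lat_def)
  have q: "\<bar>fst q - x\<bar> \<le> 1" "\<bar>snd q - y\<bar> \<le> 1" "\<bar>fst q - x'\<bar> \<le> 1" "\<bar>snd q - y'\<bar> \<le> 1"
    using n by (auto simp: near_def)
  define i where "i = (x' - x) div 2"
  define j where "j = (y' - y) div 2"
  have ij: "x' = x + i + i" "y' = y + j + j" "i = 0 \<or> i = 1 \<or> i = -1" "j = 0 \<or> j = 1 \<or> j = -1"
    using x y unfolding i_def j_def by auto
  show ?thesis
  proof (cases "i = 0 \<or> j = 0")
    case True
    show ?thesis
    proof (cases "i = 0 \<and> j = 0")
      case False
      then have "(i, j) \<in> dirs" using ij True by (auto simp: dirs_def)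
      moreover have "g = f + (i, j) + (i, j)" using ij by simp
      ultimately show ?thesis by blast
    qed (use ij in simp)
  next
    case False
    then have "(i, 0) \<in> dirs" "(0, j) \<in> dirs" using ij by (auto simp: dirs_def)
    moreover have "g = f + (i, 0) + (i, 0) + (0, j) + (0, j)" "g = f + (0, j) + (0, j) + (i, 0) + (i, 0)"
      using ij by simp_all
    moreover have "near q (f + (i, 0) + (i, 0))" "near q (f + (0, j) + (0, j))"
      using q ij by (auto simp: near_def)
    moreover have "f + (i, 0) + (i, 0) \<noteq> f + (0, j) + (0, j)" using False by simp
    ultimately show ?thesis by blast
  qed
qed

lemma near_refl [simp]: "near q q"
  by (simp add: near_def)

lemma near_step: "d \<in> dirs \<Longrightarrow> near (z + d) z" "d \<in> dirs \<Longrightarrow> near z (z + d)"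
  "d \<in> dirs \<Longrightarrow> near (z + d) (z + d + d)"  "d \<in> dirs \<Longrightarrow> near (z + d + d) (z + d)"
  by (auto simp: near_def dirs_def)

text \<open>The dual edge with the same midpoint: if \<open>d = (i, j)\<close>, its direction is
  \<open>(j, i)\<close>, and its two ends are the faces on both sides of the given edge.\<close>

lemma edge_two_sides:
  assumes "lat a z" "d \<in> dirs"
  obtains f e where "lat (\<not> a) f" "e \<in> dirs" "near z f" "near (z + d) f" "near (z + d + d) f" 
    "near z (f + e + e)" "near (z + d) (f + e + e)" "near (z + d + d) (f + e + e)" "z + d = f + e" "f \<noteq> f + e + e"
proof -
  obtain i j where d: "d = (i, j)" by fastforce
  have e: "(j, i) \<in> dirs" using assms(2) by (auto simp: dirs_def d)
  have ij: "(i = 1 \<or> i = -1) \<and> j = 0 \<or> i = 0 \<and> (j = 1 \<or> j = -1)"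
    using assms(2) by (auto simp: dirs_def d)
  obtain x y where z: "z = (x, y)" by fastforce
  let ?f = "(x + i - j, y + j - i)"
  have "odd (x + i - j) = (\<not> odd x)" "odd (y + j - i) = (\<not> odd y)" using ij by auto
  then have "lat (\<not> a) ?f" using assms(1) unfolding lat_def z fst_conv snd_conv by blast
  moreover have "near z ?f" "near (z + d) ?f" "near (z + d + d) ?f"
    "near z (?f + (j, i) + (j, i))" "near (z + d) (?f + (j, i) + (j, i))" "near (z + d + d) (?f + (j, i) + (j, i))"
    using ij by (auto simp: near_def z d)
  moreover have "z + d = ?f + (j, i)" by (simp add: z d)
  moreover have "?f \<noteq> ?f + (j, i) + (j, i)" using ij by auto
  ultimately show ?thesis using e that by blast
qed

text \<open>The blocks of nine points around two neighbouring faces meet in three points, namely the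
  ends and the midpoint of the edge between the faces.\<close>

lemma near_edge:
  assumes "lat a z" "e \<in> dirs" "lat (\<not> a) f" "d \<in> dirs" "z + e = f + d" "near q f" "near q (f + d + d)"
  shows "q = z \<or> q = z + e \<or> q = z + e + e"
proof -
  obtain x y i j where [simp]: "f = (x, y)" "d = (i, j)" by fastforce
  have ij: "(i = 1 \<or> i = -1) \<and> j = 0 \<or> i = 0 \<and> (j = 1 \<or> j = -1)"
    using assms(4) by (auto simp: dirs_def)
  obtain x' y' k l where [simp]: "z = (x', y')" "e = (k, l)" by fastforce
  have kl: "(k = 1 \<or> k = -1) \<and> l = 0 \<or> k = 0 \<and> (l = 1 \<or> l = -1)"
    using assms(2) by (auto simp: dirs_def)
  have eq: "x' = x + i - k" "y' = y + j - l" using assms(5) by auto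
  have par: "odd x' \<noteq> odd x" "odd y' \<noteq> odd y" using assms(1,3) by (auto simp: lat_def)
  have perp: "i = 0 \<longleftrightarrow> l = 0"
    using ij kl eq par by (elim disjE conjE) simp_all
  obtain q1 q2 where q: "q = (q1, q2)" by fastforce
  have n: "\<bar>q1 - x\<bar> \<le> 1" "\<bar>q1 - (x + i + i)\<bar> \<le> 1" "\<bar>q2 - y\<bar> \<le> 1" "\<bar>q2 - (y + j + j)\<bar> \<le> 1"
    using assms(6,7) by (auto simp: near_def q)
  show ?thesis using ij
  proof
    assume ij: "(i = 1 \<or> i = -1) \<and> j = 0"
    then have "l = 1 \<or> l = -1" "k = 0" using perp kl by auto
    moreover have "q1 = x + i" using n(1,2) ij by auto
    moreover have "q2 = y \<or> q2 = y + 1 \<or> q2 = y - 1" using n(3) by linarith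
    ultimately show ?thesis using ij eq by (auto simp: q)
  next
    assume ij: "i = 0 \<and> (j = 1 \<or> j = -1)"
    then have "k = 1 \<or> k = -1" "l = 0" using perp kl by auto
    moreover have "q2 = y + j" using n(3,4) ij by auto
    moreover have "q1 = x \<or> q1 = x + 1 \<or> q1 = x - 1" using n(1) by linarith
    ultimately show ?thesis using ij eq by (auto simp: q)
  qed
qed

lemma near_both:
  assumes "lat a x" "lat (\<not> a) f" "d \<in> dirs" "near x f" "near x (f + d + d)"
  shows "\<exists>e\<in>dirs. f + d = x + e"
proof -
  obtain z e where z: "lat a z" "e \<in> dirs" "f + d = z + e"
    using edge_two_sides[OF assms(2,3)] by (metis (full_types))
  have "x = z \<or> x = z + e \<or> x = z + e + e"
    using near_edge[OF z(1,2) assms(2,3) _ assms(4,5)] z(3) by simp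
  moreover have "x \<noteq> z + e" using black_step[OF z(1,2)] lat_not_black[OF assms(1)] by blast
  ultimately consider "x = z" | "x = z + e + e" by blast
  then show ?thesis
  proof cases
    case 2
    then have "f + d = x + (- e)" using z(3) by simp
    then show ?thesis using uminus_dirs[OF z(2)] by blast
  qed (use z in blast)
qed

lemma gamma_cases:
  assumes "gamma_adj q r"
  obtains d where "d \<in> dirs" "r = q + d" | b where "lat b q" "lat (\<not> b) r" "near q r"
proof (cases "diag_adj q r")
  case True
  define b where "b = odd (fst q)"
  have "odd (fst q) = odd (snd q)" "odd (fst r) = odd (snd r)" "\<bar>fst q - fst r\<bar> = 1" "\<bar>snd q - snd r\<bar> = 1"
    using True by (auto simp: diag_adj_def white_def)
  moreover have "odd j \<noteq> odd i" if "\<bar>i - j\<bar> = 1" for i j :: int using that by presburger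
  ultimately have "odd (fst r) \<noteq> odd (fst q)" "odd (fst q) = odd (snd q)" "odd (fst r) = odd (snd r)" "near q r"
    unfolding near_def by simp_all
  then have "lat b q" "lat (\<not> b) r" "near q r" by (auto simp: lat_def b_def)
  then show ?thesis using that(2) by blast
next
  case False
  obtain x y x' y' where [simp]: "q = (x, y)" "r = (x', y')" by fastforce
  have "\<bar>x - x'\<bar> + \<bar>y - y'\<bar> = 1" using assms False by (simp add: gamma_adj_def)
  moreover have "(i = 1 \<or> i = -1) \<and> j = 0 \<or> i = 0 \<and> (j = 1 \<or> j = -1)" if "\<bar>i\<bar> + \<bar>j\<bar> = 1" for i j :: int
    using that by linarith
  ultimately have "(x' - x, y' - y) \<in> dirs" unfolding dirs_def by (metis abs_minus_commute insertCI)
  then show ?thesis using that(1)[of "(x' - x, y' - y)"] by simp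
qed

lemma common_near_aux:
  assumes "lat (\<not> b) q" "d \<in> dirs"
  shows "\<exists>f. lat b f \<and> near q f \<and> near (q + d) f \<and> f \<noteq> z"
proof -
  from edge_two_sides[OF assms] obtain f e where "lat b f" "near q f" "near (q + d) f"
    "near q (f + e + e)" "near (q + d) (f + e + e)" "f \<noteq> f + e + e"
    by simp metis
  then show ?thesis using lat_step by metis
qed

text \<open>This is what lets information about faces pass along an edge of the graph outside
  \<open>G\<close>. If \<open>q\<close> or \<open>r\<close> is itself on sublattice \<open>b\<close>
  it can be taken as \<open>f\<close>; otherwise the edge has two sides, and one of them is not
  \<open>z\<close>.\<close>

lemma common_near:
  assumes "gamma_adj q r" "q \<notin> G" "r \<notin> G" and z: "z \<in> G \<or> lat (\<not> b) z"
  shows "\<exists>f. lat b f \<and> near q f \<and> near r f \<and> f \<noteq> z"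
  using assms(1)
proof (cases rule: gamma_cases)
  case (1 d)
  consider "lat b q" | "lat b r" | "lat (\<not> b) q" | "lat (\<not> b) r"
  proof -
    have "black q \<longleftrightarrow> \<not> black r" using 1 by (auto simp: black_def dirs_def)
    then show ?thesis using lat_or_black[of q] lat_or_black[of r] that by (cases b) auto
  qed
  then show ?thesis
  proof cases
    case 3
    then show ?thesis using common_near_aux[of b q d z] 1 by simp
  next
    case 4
    then show ?thesis using common_near_aux[of b r "- d" z] 1 uminus_dirs by fastforce
  qed (use assms z 1 near_step near_refl near_sym lat_disj in metis)+
next
  case (2 c)
  show ?thesis
  proof (cases "b = c")
    case True
    then have "lat b q" "q \<noteq> z" using 2 z assms(2) lat_disj by blast+
    then show ?thesis using near_sym[OF 2(3)] by (intro exI[of _ q]) simp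
  next
    case False
    then have "lat b r" using 2 by (cases b) auto
    moreover have "r \<noteq> z" using calculation z assms(3) lat_disj by blast
    ultimately show ?thesis using 2(3) by (intro exI[of _ r]) simp
  qed
qed

text \<open>The exceptional face \<open>z\<close> accounts for chains that run along sides of a face \<open>z\<close> of \<open>G\<close>
  which are not themselves in \<open>G\<close>.\<close>

lemma outside:
  assumes finG: "finite G" and conn: "connected_on gamma_adj (- G)"
    and D: "fills a C D" and z: "z \<in> G \<or> lat a z"
    and C: "\<And>q f d. q \<notin> G \<Longrightarrow> lat (\<not> a) f \<Longrightarrow> d \<in> dirs \<Longrightarrow> near q f \<Longrightarrow> near q (f + d + d) \<Longrightarrow>
          f \<noteq> z \<Longrightarrow> f + d + d \<noteq> z \<Longrightarrow> f + d \<notin> C"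
    and q: "q \<notin> G" and f: "lat (\<not> a) f" "near q f" "f \<noteq> z"
  shows "f \<notin> D"
proof -
  have step: "f \<in> D \<longleftrightarrow> f + d + d \<in> D" if "q \<notin> G" "lat (\<not> a) f" "d \<in> dirs" "near q f" "near q (f + d + d)"
      "f \<noteq> z" "f + d + d \<noteq> z" for q f d
    using C[OF that] D that(2,3) unfolding fills_def by blast
  have const: "f \<in> D \<longleftrightarrow> g \<in> D" if "q \<notin> G" "lat (\<not> a) f" "lat (\<not> a) g" "near q f" "near q g"
      "f \<noteq> z" "g \<noteq> z" for q f g
    using near_chain[OF that(4,5,2,3)]
  proof (elim disjE bexE conjE)
    fix d e assume de: "d \<in> dirs" "e \<in> dirs" and g: "g = f + d + d + e + e" "g = f + e + e + d + d"
      and n: "near q (f + d + d)" "near q (f + e + e)" and ne: "f + d + d \<noteq> f + e + e"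
    show ?thesis
    proof (cases "f + d + d = z")
      case False
      then show ?thesis
        using step[OF that(1,2) de(1) that(4) n(1) that(6)] step[OF that(1) _ de(2) n(1)] that g(1) by simp
    next
      case True
      then have "f + e + e \<noteq> z" using ne by simp
      then show ?thesis
        using step[OF that(1,2) de(2) that(4) n(2) that(6)] step[OF that(1) _ de(1) n(2)] that g(2) by simp
    qed
  qed (use step that in blast)+
  \<comment> \<open>\<open>A\<close> holds at a point to the right of all of \<open>G\<close> and
    \<open>D\<close>, and it passes along a path outside \<open>G\<close>: adjacent points share a
    near face other than \<open>z\<close>, and by \<open>const\<close> one such face decides for
    all.\<close>
  define A where "A q \<longleftrightarrow> (\<forall>f. lat (\<not> a) f \<longrightarrow> near q f \<longrightarrow> f \<noteq> z \<longrightarrow> f \<notin> D)" for q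
  have "finite (fst ` (G \<union> D))" using finG D unfolding fills_def by simp
  then obtain N where N: "\<And>i. i \<in> fst ` (G \<union> D) \<Longrightarrow> i < N"
    by (meson bdd_above.E bdd_above_finite le_less_trans less_add_one)
  define q0 where "q0 = (N + 1, 0 :: int)"
  have q0: "q0 \<notin> G" using N[of "N + 1"] unfolding q0_def by force
  have A0: "A q0" unfolding A_def
  proof (intro allI impI notI)
    fix f assume "near q0 f" "f \<in> D"
    then show False using N[of "fst f"] unfolding q0_def near_def by force
  qed
  have "(\<lambda>a b. a \<in> - G \<and> b \<in> - G \<and> gamma_adj a b)\<^sup>*\<^sup>* q0 q"
    using conn q0 q unfolding connected_on_def by blast
  then have "A q"
  proof (induction rule: rtranclp_induct)
    case base
    then show ?case by (rule A0)
  next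
    case (step q r)
    have zz: "z \<in> G \<or> lat (\<not> (\<not> a)) z" using z by simp
    have ad: "gamma_adj q r" "q \<notin> G" "r \<notin> G" using step.hyps by auto
    from common_near[OF ad zz]
    obtain f where f: "lat (\<not> a) f" "near q f" "near r f" "f \<noteq> z" by blast
    then have "f \<notin> D" using step.IH unfolding A_def by blast
    then show ?case unfolding A_def using const[OF ad(3) f(1) _ f(3)] f(4) by blast
  qed
  then show ?thesis using f unfolding A_def by blast
qed

section \<open>Matchings have no closed orbits\<close>

text \<open>This describes the vertex set of a single directed cycle of \<open>S\<close> without
  enumerating the cycle.\<close>

definition min_closed :: "('a \<Rightarrow> 'a) \<Rightarrow> 'a set \<Rightarrow> bool" where
  "min_closed S Y \<longleftrightarrow> Y \<noteq> {} \<and> finite Y \<and> S ` Y \<subseteq> Y \<and> (\<forall>Z\<subseteq>Y. Z \<noteq> {} \<longrightarrow> S ` Z \<subseteq> Z \<longrightarrow> Z = Y)"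

lemma min_closed_exists:
  assumes "finite Y" "Y \<noteq> {}" "S ` Y \<subseteq> Y"
  shows "\<exists>P\<subseteq>Y. min_closed S P"
  using assms
proof (induction Y rule: finite_psubset_induct)
  case (psubset Y)
  show ?case
  proof (cases "min_closed S Y")
    case False
    then obtain Z where Z: "Z \<subseteq> Y" "Z \<noteq> {}" "S ` Z \<subseteq> Z" "Z \<noteq> Y"
      using psubset unfolding min_closed_def by blast
    then have "\<exists>P\<subseteq>Z. min_closed S P" using psubset.IH[of Z] by blast
    then show ?thesis using Z(1) by blast
  qed blast
qed

lemma min_closed_image: "min_closed S Y \<Longrightarrow> S ` Y = Y"
  unfolding min_closed_def by (metis image_is_empty image_mono)

lemma surj_image_eq:
  assumes "finite Y" "Y \<subseteq> S ` Y"
  shows "S ` Y = Y"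
  using card_seteq[OF finite_imageI[OF assms(1)] assms(2) card_image_le[OF assms(1)]] by simp

section \<open>Edges between a set of vertices and its complement\<close>

definition cut :: "pt set \<Rightarrow> pt set" where
  "cut X = {m. \<exists>z\<in>X. \<exists>d\<in>dirs. m = z + d \<and> z + d + d \<notin> X}"

lemma cut_iff:
  assumes X: "\<And>z. z \<in> X \<Longrightarrow> lat a z" and u: "lat a u" "e \<in> dirs"
  shows "u + e \<in> cut X \<longleftrightarrow> (u \<in> X) \<noteq> (u + e + e \<in> X)"
proof
  assume "u + e \<in> cut X"
  then obtain z d where z: "z \<in> X" "d \<in> dirs" "u + e = z + d" "z + d + d \<notin> X" unfolding cut_def by auto
  have "u = z \<and> e = d \<or> u = z + d + d \<and> e = - d"
    using black_ends[OF X[OF z(1)] z(2) u] z(3) by simp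
  then show "(u \<in> X) \<noteq> (u + e + e \<in> X)" using z by auto
next
  assume ue: "(u \<in> X) \<noteq> (u + e + e \<in> X)"
  show "u + e \<in> cut X"
  proof (cases "u \<in> X")
    case True
    then show ?thesis using ue u unfolding cut_def by blast
  next
    case False
    then have "u + e + e \<in> X" "u + e = (u + e + e) + (- e)" "u + e + e + (- e) + (- e) \<notin> X"
      using ue by simp_all
    then show ?thesis using uminus_dirs[OF u(2)] unfolding cut_def by blast
  qed
qed

text \<open>Going once round the square with centre \<open>f\<close>, membership of the corners in
  \<open>X\<close> changes an even number of times.\<close>

lemma cut_even:
  assumes X: "\<And>z. z \<in> X \<Longrightarrow> lat a z" and f: "lat (\<not> a) f"
  shows "\<not> odd_at (cut X) f"
proof -
  obtain x y where fxy: "f = (x, y)" by fastforce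
  have l: "lat a (x + 1, y + 1)" "lat a (x - 1, y - 1)" using f by (auto simp: lat_def fxy)
  have "(x + 1, y) \<in> cut X \<longleftrightarrow> ((x + 1, y + 1) \<in> X) \<noteq> ((x + 1, y - 1) \<in> X)"
    using cut_iff[OF X l(1) axis_dirs(4)] by simp
  moreover have "(x, y + 1) \<in> cut X \<longleftrightarrow> ((x + 1, y + 1) \<in> X) \<noteq> ((x - 1, y + 1) \<in> X)"
    using cut_iff[OF X l(1) axis_dirs(2)] by simp
  moreover have "(x - 1, y) \<in> cut X \<longleftrightarrow> ((x - 1, y - 1) \<in> X) \<noteq> ((x - 1, y + 1) \<in> X)"
    using cut_iff[OF X l(2) axis_dirs(3)] by simp
  moreover have "(x, y - 1) \<in> cut X \<longleftrightarrow> ((x - 1, y - 1) \<in> X) \<noteq> ((x + 1, y - 1) \<in> X)"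
    using cut_iff[OF X l(2) axis_dirs(1)] by simp
  ultimately show ?thesis unfolding odd_at_def fxy by simp argo
qed

lemma step_back: "z + d + d + (- d) + (- d) = (z :: pt)"
  by simp

lemma topmost:
  fixes X :: "pt set"
  assumes "finite X" "x \<in> X"
  obtains y where "y \<in> X" "\<And>x. x \<in> X \<Longrightarrow> snd x \<le> snd y"
proof -
  have "Max (snd ` X) \<in> snd ` X" by (rule Max_in) (use assms in auto)
  then obtain y where y: "y \<in> X" "Max (snd ` X) = snd y" by (rule imageE)
  have "snd x \<le> snd y" if "x \<in> X" for x
    unfolding y(2)[symmetric] using that assms by (intro Max_ge) auto
  then show ?thesis using y that by blast
qed

lemma cut_nonempty:
  assumes "finite X" "x \<in> X"
  shows "cut X \<noteq> {}"
proof -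
  obtain y where y: "y \<in> X" "\<And>x. x \<in> X \<Longrightarrow> snd x \<le> snd y"
    using topmost[OF assms] by blast
  have "\<not> snd (y + (0, 1) + (0, 1)) \<le> snd y" by simp
  then have "y + (0, 1) + (0, 1) \<notin> X" using y(2) by blast
  then have "y + (0, 1) \<in> cut X" using y(1) axis_dirs(3) unfolding cut_def by blast
  then show ?thesis by blast
qed

text \<open>\<open>r True\<close> and \<open>r False\<close> are the ends of the impurity, and
  \<open>\<mu>\<close> gives the black partner of every other white vertex. The hypotheses are
  symmetric in the two sublattices because the descent on cycles exchanges them.\<close>

locale impurity_matching =
  fixes G :: "pt set" and \<mu> :: "pt \<Rightarrow> pt" and r :: "bool \<Rightarrow> pt"
  assumes finG: "finite G" and conn: "connected_on gamma_adj (- G)"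
    and r_lat: "lat a (r a)" and r_near: "near (r True) (r False)"
    and mate_dir: "z \<in> G \<Longrightarrow> lat a z \<Longrightarrow> z \<noteq> r a \<Longrightarrow> \<mu> z - z \<in> dirs"
    and mate_in: "z \<in> G \<Longrightarrow> lat a z \<Longrightarrow> z \<noteq> r a \<Longrightarrow> \<mu> z \<in> G"
    and mate_inj: "z \<in> G \<Longrightarrow> lat a z \<Longrightarrow> z \<noteq> r a \<Longrightarrow> z' \<in> G \<Longrightarrow> lat b z' \<Longrightarrow> z' \<noteq> r b \<Longrightarrow>
        \<mu> z = \<mu> z' \<Longrightarrow> z = z'"
    and mate_surj: "m \<in> G \<Longrightarrow> black m \<Longrightarrow> \<exists>z a. z \<in> G \<and> lat a z \<and> z \<noteq> r a \<and> \<mu> z = m"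
begin

definition nxt :: "pt \<Rightarrow> pt" where
  "nxt z = \<mu> z + (\<mu> z - z)"

definition wh :: "bool \<Rightarrow> pt set" where
  "wh a = {z \<in> G. lat a z \<and> z \<noteq> r a}"

lemma wh_dir:
  assumes "z \<in> wh a"
  obtains d where "d \<in> dirs" "\<mu> z = z + d" "nxt z = z + d + d"
proof
  show "\<mu> z - z \<in> dirs" using assms mate_dir unfolding wh_def by blast
  show "\<mu> z = z + (\<mu> z - z)" by simp
  show "nxt z = z + (\<mu> z - z) + (\<mu> z - z)" by (simp add: nxt_def)
qed

lemma wh_inj: "z \<in> wh a \<Longrightarrow> z' \<in> wh b \<Longrightarrow> \<mu> z = \<mu> z' \<Longrightarrow> z = z'"
  unfolding wh_def using mate_inj by blast

lemma wh_lat: "z \<in> wh a \<Longrightarrow> lat a z"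
  by (simp add: wh_def)

lemma wh_owner:
  assumes "m \<in> G" "lat a f" "e \<in> dirs" "m = f + e"
  obtains z where "z \<in> wh a" "\<mu> z = m" "z = f \<or> z = f + e + e"
    | z where "z \<in> wh (\<not> a)" "\<mu> z = m" "near z f"
proof -
  have "black m" using assms black_step by blast
  then obtain z b where z: "z \<in> wh b" "\<mu> z = m" using mate_surj[OF assms(1)] unfolding wh_def by blast
  obtain d where d: "d \<in> dirs" "\<mu> z = z + d" "nxt z = z + d + d"
      by (rule wh_dir[OF z(1)])
  have eq: "f + e = z + d" using d z assms by simp
  show ?thesis
  proof (cases "b = a")
    case True
    then show ?thesis
      using that(1)[of z] z black_ends[OF assms(2,3) _ d(1) eq] wh_lat by blast
  next
    case False
    then have "b = (\<not> a)" by auto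
    then show ?thesis using that(2)[of z] z black_sides[OF assms(2,3) _ d(1) eq] wh_lat by blast
  qed
qed

text \<open>\<open>nxt\<close> permutes \<open>P\<close>, so a vertex of \<open>P\<close> meets two
  edges of the orbit: the one it points along and the one through which it is reached. They differ
  because partners are distinct. Other vertices meet no edge of the orbit.\<close>

lemma closed_orbit_even:
  assumes P: "P \<subseteq> wh a" "min_closed nxt P" and q: "lat a q"
  shows "\<not> odd_at (\<mu> ` P) q"
proof (cases "q \<in> P")
  case True
  have im: "nxt ` P = P" using P(2) by (rule min_closed_image)
  have "q \<in> nxt ` P" unfolding im by (rule True)
  then obtain y where y: "y \<in> P" "nxt y = q" by blast
  have inj: "inj_on nxt P" using P(2) im unfolding min_closed_def by (metis eq_card_imp_inj_on)
  have yw: "y \<in> wh a" "q \<in> wh a" using y(1) True P(1) by blast+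
  obtain d where d: "d \<in> dirs" "\<mu> y = y + d" "nxt y = y + d + d"
      by (rule wh_dir[OF yw(1)])
  obtain e where e: "e \<in> dirs" "\<mu> q = q + e" "nxt q = q + e + e"
      by (rule wh_dir[OF yw(2)])
  have ny: "\<mu> y = q + (- d)" unfolding y(2)[symmetric] d(2,3) by simp
  have "y \<noteq> q" using step_ne[OF d(1), of y] y(2) d(3) by metis
  then have "e \<noteq> - d" using wh_inj[OF yw] e ny by metis
  moreover have "q + c \<in> \<mu> ` P \<longleftrightarrow> c = e \<or> c = - d" if c: "c \<in> dirs" for c
  proof
    assume "q + c \<in> \<mu> ` P"
    then obtain z where z: "z \<in> P" "\<mu> z = q + c" by auto
    then have zw: "z \<in> wh a" using P by blast
    obtain b where b: "b \<in> dirs" "\<mu> z = z + b" "nxt z = z + b + b"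
      by (rule wh_dir[OF zw])
    have "q = z \<and> c = b \<or> q = z + b + b \<and> c = - b"
      using black_ends[OF wh_lat[OF zw] b(1) q c] z b by simp
    then consider "q = z" "c = b" | "q = nxt z" using b(3) by metis
    then show "c = e \<or> c = - d"
    proof cases
      case 1
      then show ?thesis using b e by simp
    next
      case 2
      then have "z = y" using inj z(1) y unfolding inj_on_def by blast
      then show ?thesis using z(2) ny by simp
    qed
  next
    assume "c = e \<or> c = - d"
    then show "q + c \<in> \<mu> ` P" using True y(1) e ny by (metis imageI)
  qed
  ultimately show ?thesis using odd_at_two[OF e(1) uminus_dirs[OF d(1)]] by blast
next
  case False
  show ?thesis
  proof (rule odd_at_none)
    fix c assume c: "c \<in> dirs"
    show "q + c \<notin> \<mu> ` P"
    proof
      assume "q + c \<in> \<mu> ` P"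
      then obtain z where z: "z \<in> P" "\<mu> z = q + c" by auto
      then have zw: "z \<in> wh a" using P by blast
      obtain b where b: "b \<in> dirs" "\<mu> z = z + b" "nxt z = z + b + b"
      by (rule wh_dir[OF zw])
      have "q = z \<or> q = nxt z"
        using black_ends[OF wh_lat[OF zw] b(1) q c] z b by metis
      then show False using False z(1) min_closed_image[OF P(2)] by blast
    qed
  qed
qed

end

section \<open>A closed orbit and the region enclosed by it\<close>

locale matching_cycle = impurity_matching +
  fixes a :: bool and P C D :: "pt set"
  assumes P_wh: "P \<subseteq> wh a" and P_min: "min_closed nxt P"
    and C_def: "C = \<mu> ` P" and D_fills: "fills a C D"
begin

definition inner :: "pt set" where
  "inner = {x. lat a x \<and> x \<notin> P \<and> (\<forall>f. lat (\<not> a) f \<longrightarrow> near x f \<longrightarrow> f \<in> D)}"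

lemma P_image: "nxt ` P = P"
  using P_min by (rule min_closed_image)

lemma D_lat: "f \<in> D \<Longrightarrow> lat (\<not> a) f"
  using D_fills unfolding fills_def by blast

lemma D_finite: "finite D"
  using D_fills unfolding fills_def by blast

lemma D_step: "lat (\<not> a) f \<Longrightarrow> d \<in> dirs \<Longrightarrow> f + d \<notin> C \<Longrightarrow> f \<in> D \<longleftrightarrow> f + d + d \<in> D"
  using D_fills unfolding fills_def by blast

lemma C_at: "lat a q \<Longrightarrow> e \<in> dirs \<Longrightarrow> q + e \<in> C \<Longrightarrow> q \<in> P"
proof -
  assume q: "lat a q" "e \<in> dirs" "q + e \<in> C"
  then obtain z where z: "z \<in> P" "\<mu> z = q + e" unfolding C_def by auto
  then have zw: "z \<in> wh a" using P_wh by blast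
  obtain d where d: "d \<in> dirs" "\<mu> z = z + d" "nxt z = z + d + d"
      by (rule wh_dir[OF zw])
  have "z + d = q + e" using d z by simp
  then have "q = z \<or> q = nxt z" using black_ends[OF wh_lat[OF zw] d(1) q(1,2)] d by metis
  then show "q \<in> P" using z(1) P_image by blast
qed

lemma P_G: "P \<subseteq> G"
  using P_wh unfolding wh_def by blast

lemma P_lat: "z \<in> P \<Longrightarrow> lat a z"
  using P_wh wh_lat by blast

lemma C_in_G: "C \<subseteq> G"
  unfolding C_def using P_wh mate_in unfolding wh_def by blast

text \<open>The edges of \<open>C\<close> lie in \<open>G\<close> with their ends, so by
  \<open>near_edge\<close> a point outside \<open>G\<close> is never near both sides of one of them,
  and \<open>outside\<close> applies. Its exceptional face is taken to be \<open>r a\<close>, which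
  is on the other sublattice and hence excludes no face.\<close>

lemma D_near_G:
  assumes "f \<in> D" "near q f"
  shows "q \<in> G"
proof (rule ccontr)
  assume q: "q \<notin> G"
  have "f \<notin> D"
  proof (rule outside[OF finG conn D_fills _ _ q _ assms(2)])
    show "r a \<in> G \<or> lat a (r a)" using r_lat by blast
    show "lat (\<not> a) f" using D_lat assms by blast
    then show "f \<noteq> r a" using r_lat[of a] lat_disj by blast
  next
    fix q f d assume q: "q \<notin> G" and f: "lat (\<not> a) f" "d \<in> dirs" "near q f" "near q (f + d + d)"
    show "f + d \<notin> C"
    proof
      assume "f + d \<in> C"
      then obtain z where z: "z \<in> P" "\<mu> z = f + d" unfolding C_def by auto
      then have zw: "z \<in> wh a" using P_wh by blast
      obtain e where e: "e \<in> dirs" "\<mu> z = z + e" "nxt z = z + e + e"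
      by (rule wh_dir[OF zw])
      have "nxt z \<in> P" using z(1) P_image by blast
      then have G: "z \<in> G" "z + e \<in> G" "z + e + e \<in> G"
        using P_G z(1) C_in_G e unfolding C_def by auto
      have "q = z \<or> q = z + e \<or> q = z + e + e"
        using near_edge[OF wh_lat[OF zw] e(1) f(1,2) _ f(3,4)] z e by simp
      then show False using G q by blast
    qed
  qed
  then show False using assms by blast
qed

text \<open>No edge of \<open>C\<close> meets a vertex off \<open>P\<close>, so membership in
  \<open>D\<close> is the same for all four faces around the vertex.\<close>

lemma inner_or:
  assumes "lat a x" "x \<notin> P" "lat (\<not> a) f" "near x f" "f \<in> D"
  shows "x \<in> inner"
proof -
  have no: "f + d \<notin> C" if f: "lat (\<not> a) f" "d \<in> dirs" "near x f" "near x (f + d + d)" for f d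
  proof -
    obtain e where e: "e \<in> dirs" "f + d = x + e"
      using near_both[OF assms(1) f] by blast
    then show ?thesis using C_at[OF assms(1) e(1)] assms(2) by metis
  qed
  have *: "g \<in> D" if "lat (\<not> a) g" "near x g" for g
    using near_chain[OF assms(4) that(2) assms(3) that(1)]
  proof (elim disjE bexE conjE)
    fix d e assume de: "d \<in> dirs" "e \<in> dirs" "g = f + d + d + e + e" "near x (f + d + d)"
    have "f + d + d \<in> D" using D_step[OF assms(3) de(1) no[OF assms(3) de(1) assms(4) de(4)]] assms(5) by simp
    moreover have "lat (\<not> a) (f + d + d)" using assms(3) by simp
    ultimately show ?thesis using D_step[OF _ de(2) no[OF _ de(2) de(4)]] that(2) de(3) by metis
  next
    fix d assume "d \<in> dirs" "g = f + d + d"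
    then show ?thesis using D_step[OF assms(3) _ no[OF assms(3) _ assms(4)]] that(2) assms(5) by metis
  qed (use assms in simp)
  then show ?thesis using assms(1,2) unfolding inner_def by blast
qed

lemma inner_finite: "finite inner"
proof -
  have "inner \<subseteq> G"
  proof
    fix x assume x: "x \<in> inner"
    then have l: "lat a x" unfolding inner_def by blast
    have "lat (\<not> a) (x + (1, 1))" "near x (x + (1, 1))" using near_lat_diffD[OF l, of "x + (1, 1)"] by simp_all
    then have "x + (1, 1) \<in> D" using x unfolding inner_def by blast
    then show "x \<in> G" using D_near_G[OF _ \<open>near x (x + (1, 1))\<close>] by blast
  qed
  then show ?thesis using finG finite_subset by blast
qed

lemma D_nonempty: "D \<noteq> {}"
proof -
  obtain z where z: "z \<in> P" using P_min unfolding min_closed_def by blast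
  then have zw: "z \<in> wh a" using P_wh by blast
  obtain e where e: "e \<in> dirs" "\<mu> z = z + e" "nxt z = z + e + e"
      by (rule wh_dir[OF zw])
  obtain f d where f: "lat (\<not> a) f" "d \<in> dirs" "z + e = f + d"
    using edge_two_sides[OF wh_lat[OF zw] e(1)] by metis
  have "f + d \<in> C" using z e f unfolding C_def by (metis imageI)
  then show ?thesis using D_fills f unfolding fills_def by blast
qed

lemma not_C: "f \<in> wh (\<not> a) \<Longrightarrow> \<mu> f \<notin> C"
proof
  assume f: "f \<in> wh (\<not> a)" "\<mu> f \<in> C"
  then obtain z where "z \<in> P" "\<mu> z = \<mu> f" unfolding C_def by auto
  then have "z = f" "z \<in> wh a" using wh_inj[OF _ f(1), of z a] P_wh by auto
  then show False using f wh_lat lat_disj by blast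
qed

lemma nxt_D: "f \<in> D \<Longrightarrow> f \<in> wh (\<not> a) \<Longrightarrow> nxt f \<in> D"
  using D_step[OF D_lat] not_C by (metis wh_dir)

lemma D_wh: "f \<in> D \<Longrightarrow> f \<noteq> r (\<not> a) \<Longrightarrow> f \<in> wh (\<not> a)"
  using D_near_G[of f f] D_lat unfolding wh_def by auto

text \<open>If the region contains the unmatched vertex \<open>r (\<not> a)\<close>, it also contains \<open>r a\<close>. No matching edge
  of the sublattice \<open>a\<close> leaves the basin of attraction of \<open>r a\<close>, so the dual edges crossing the boundary of this
  basin carry a flow without sources, hence a closed orbit.\<close>

lemma dual_cycle: "\<exists>Q\<subseteq>D. Q \<subseteq> wh (\<not> a) \<and> min_closed nxt Q"
proof (cases "r (\<not> a) \<in> D")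
  case False
  then have "D \<subseteq> wh (\<not> a)" using D_wh by blast
  then have "nxt ` D \<subseteq> D" using nxt_D by blast
  from min_closed_exists[OF D_finite D_nonempty this] obtain Q where "Q \<subseteq> D" "min_closed nxt Q" by blast
  then show ?thesis using \<open>D \<subseteq> wh (\<not> a)\<close> by blast
next
  case True
  define R where "R x y \<longleftrightarrow> x \<in> wh a \<and> y = nxt x" for x y
  define X where "X = {x. R\<^sup>*\<^sup>* x (r a)}"
  have near: "near (r a) (r (\<not> a))" using r_near near_sym[OF r_near] by (cases a) simp_all
  have raP: "r a \<notin> P" using P_wh unfolding wh_def by blast
  have ra: "r a \<in> inner" by (rule inner_or[OF r_lat[of a] raP r_lat[of "\<not> a"] near True])
  have X_inner: "x \<in> inner" if "x \<in> X" for x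
    using that unfolding X_def mem_Collect_eq
  proof (induction rule: converse_rtranclp_induct)
    case base
    show ?case by (rule ra)
  next
    case (step x y)
    then have x: "x \<in> wh a" and y: "nxt x \<in> inner" unfolding R_def by simp_all
    from y have "nxt x \<notin> P" unfolding inner_def by simp
    then have "x \<notin> P" using P_image by (metis imageI)
    obtain d where d: "d \<in> dirs" "nxt x = x + d + d" using wh_dir[OF x] by metis
    obtain f where f: "lat (\<not> a) f" "near x f" "near (x + d + d) f"
      using edge_two_sides[OF wh_lat[OF x] d(1)] by metis
    then have "f \<in> D" using y unfolding inner_def d(2) by blast
    then show ?case using inner_or[OF wh_lat[OF x] \<open>x \<notin> P\<close> f(1,2)] by blast
  qed
  have X_lat: "\<And>z. z \<in> X \<Longrightarrow> lat a z" using X_inner unfolding inner_def by blast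
  have X_step: "nxt x \<in> X \<longleftrightarrow> x \<in> X" if "x \<in> wh a" for x
  proof
    assume "nxt x \<in> X"
    then have "R\<^sup>*\<^sup>* (nxt x) (r a)" unfolding X_def by simp
    moreover have "R x (nxt x)" using that unfolding R_def by simp
    ultimately have "R\<^sup>*\<^sup>* x (r a)" by (rule converse_rtranclp_into_rtranclp[rotated])
    then show "x \<in> X" unfolding X_def by simp
  next
    assume "x \<in> X"
    then have "R\<^sup>*\<^sup>* x (r a)" unfolding X_def by simp
    then show "nxt x \<in> X"
    proof (cases rule: converse_rtranclpE)
      case base
      then show ?thesis using that unfolding wh_def by blast
    next
      case (step y)
      then show ?thesis unfolding X_def R_def by simp
    qed
  qed
  have owner: "\<exists>f\<in>D. f \<in> wh (\<not> a) \<and> \<mu> f = m" if m: "m \<in> cut X" for m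
  proof -
    obtain z d where z: "z \<in> X" "d \<in> dirs" "m = z + d" "z + d + d \<notin> X"
      using m unfolding cut_def by blast
    have zl: "lat a z" using X_lat z by blast
    have zi: "g \<in> D" if "lat (\<not> a) g" "near z g" for g
      using X_inner[OF z(1)] that unfolding inner_def by blast
    obtain f where f: "lat (\<not> a) f" "near z f" "near (z + d) f"
      using edge_two_sides[OF zl z(2)] by metis
    have mG: "m \<in> G" using D_near_G[OF zi[OF f(1,2)] f(3)] z(3) by simp
    show ?thesis
    proof (cases rule: wh_owner[OF mG zl z(2,3)])
      case (1 y)
      obtain e where e: "e \<in> dirs" "\<mu> y = y + e" "nxt y = y + e + e"
      by (rule wh_dir[OF 1(1)])
      have eq: "z + d = y + e" using 1(2) e(2) z(3) by simp
      have "y = z \<and> e = d \<or> y = z + d + d \<and> e = - d"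
        using black_ends[OF zl z(2) wh_lat[OF 1(1)] e(1) eq] .
      then have "y = z \<and> nxt y = z + d + d \<or> y = z + d + d \<and> nxt y = z" using e(3) step_back by metis
      then show ?thesis using X_step[OF 1(1)] z(1,4) by metis
    next
      case (2 y)
      have "y \<in> D" by (rule zi[OF wh_lat[OF 2(1)] near_sym[OF 2(3)]])
      then show ?thesis using 2(1,2) by blast
    qed
  qed
  define Y where "Y = {f \<in> D \<inter> wh (\<not> a). \<mu> f \<in> cut X}"
  have finY: "finite Y" using D_finite unfolding Y_def by simp
  have "finite X" by (rule finite_subset[OF subsetI[OF X_inner] inner_finite])
  moreover have "r a \<in> X" unfolding X_def by simp
  ultimately have "cut X \<noteq> {}" using cut_nonempty by blast
  then have Yne: "Y \<noteq> {}" using owner unfolding Y_def by blast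
  \<comment> \<open>Since \<open>f\<close> meets an even number of cut edges, there is one besides
    its own. Its owner is not \<open>f\<close> and therefore steps to \<open>f\<close>.\<close>
  have "Y \<subseteq> nxt ` Y"
  proof
    fix f assume f: "f \<in> Y"
    then have fw: "f \<in> wh (\<not> a)" unfolding Y_def by blast
    obtain d where d: "d \<in> dirs" "\<mu> f = f + d" "nxt f = f + d + d"
      by (rule wh_dir[OF fw])
    have "f + d \<in> cut X" using f d unfolding Y_def by auto
    moreover have "\<not> odd_at (cut X) f" by (rule cut_even) (use X_lat wh_lat[OF fw] in auto)
    ultimately obtain e where e: "e \<in> dirs" "e \<noteq> d" "f + e \<in> cut X"
      using even_at_another d(1) by metis
    obtain y where y: "y \<in> D" "y \<in> wh (\<not> a)" "\<mu> y = f + e" using owner[OF e(3)] by blast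
    obtain c where c: "c \<in> dirs" "\<mu> y = y + c" "nxt y = y + c + c"
      by (rule wh_dir[OF y(2)])
    have "f = y \<and> e = c \<or> f = y + c + c \<and> e = - c"
      using black_ends[OF wh_lat[OF y(2)] c(1) wh_lat[OF fw] e(1)] y(3) c(2) by simp
    moreover have "f \<noteq> y" using y(3) d(2) e(2) by (metis add_left_cancel)
    ultimately have "f = nxt y" unfolding c(3) by blast
    moreover have "y \<in> Y" unfolding Y_def using y e(3) by simp
    ultimately show "f \<in> nxt ` Y" by (rule image_eqI)
  qed
  then have "nxt ` Y = Y" by (rule surj_image_eq[OF finY])
  then have "nxt ` Y \<subseteq> Y" by simp
  from min_closed_exists[OF finY Yne this] obtain Q where Q: "Q \<subseteq> Y" "min_closed nxt Q" by blast
  then have "Q \<subseteq> D" "Q \<subseteq> wh (\<not> a)" unfolding Y_def by auto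
  then show ?thesis using Q(2) by blast
qed

text \<open>A topmost vertex of the dual region outside \<open>inner\<close> would have its upper neighbour there, too.\<close>

lemma dual_region_inner:
  assumes Q: "Q \<subseteq> D" "Q \<subseteq> wh (\<not> a)" "min_closed nxt Q" and E: "fills (\<not> a) (\<mu> ` Q) E"
  shows "E \<subseteq> inner"
proof (rule ccontr)
  assume "\<not> E \<subseteq> inner"
  have E_step: "x \<in> E \<longleftrightarrow> x + d + d \<in> E" if "lat a x" "d \<in> dirs" "x + d \<notin> \<mu> ` Q" for x d
    using E that unfolding fills_def not_not by blast
  have E_lat: "x \<in> E \<Longrightarrow> lat a x" for x using E unfolding fills_def by auto
  have sides: "g \<in> D" if g: "lat (\<not> a) g" "e \<in> dirs" "g + e \<in> \<mu> ` Q" for g e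
  proof -
    obtain f where f: "f \<in> Q" "\<mu> f = g + e" using g by auto
    then have fw: "f \<in> wh (\<not> a)" using Q by blast
    obtain d where d: "d \<in> dirs" "\<mu> f = f + d" "nxt f = f + d + d"
      by (rule wh_dir[OF fw])
    have "f + d = g + e" using f(2) d(2) by simp
    from black_ends[OF wh_lat[OF fw] d(1) g(1,2) this] have "g = f \<or> g = nxt f" unfolding d(3) by argo
    moreover have "nxt f \<in> Q" using f(1) min_closed_image[OF Q(3)] by (metis imageI)
    ultimately show ?thesis using f(1) Q(1) by (metis subsetD)
  qed
  \<comment> \<open>Both ends of every edge of the orbit \<open>Q\<close> are in \<open>D\<close>,
    whereas \<open>y + (1, 1)\<close> is not. So the edge above \<open>y\<close>, which ends there
    as a dual edge, is not in the orbit and does not separate \<open>y\<close> from its upper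
    neighbour.\<close>
  have up: "y + (0, 1) + (0, 1) \<in> E - inner" if y: "y \<in> E" and n: "y + (1, 1) \<notin> D" for y
  proof -
    have l: "lat a y" using E_lat y by blast
    have g: "lat (\<not> a) (y + (1, 1))" using near_lat_diffD(2)[OF l] by simp
    have "y + (0, 1) = y + (1, 1) + (-1, 0)" by (cases y) simp
    then have "y + (0, 1) \<notin> \<mu> ` Q" using sides[OF g axis_dirs(2)] n by metis
    then have "y + (0, 1) + (0, 1) \<in> E" using E_step[OF l axis_dirs(3)] y by blast
    moreover have "near (y + (0, 1) + (0, 1)) (y + (1, 1))" by (simp add: near_def)
    ultimately show ?thesis using g n unfolding inner_def by blast
  qed
  have "finite (E - inner)" using E unfolding fills_def by simp
  moreover obtain x0 where "x0 \<in> E - inner" using \<open>\<not> E \<subseteq> inner\<close> by blast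
  ultimately obtain y where y: "y \<in> E - inner" "\<And>x. x \<in> E - inner \<Longrightarrow> snd x \<le> snd y"
    using topmost by blast
  have l: "lat a y" using E_lat y by blast
  have top: "y + (1, 1) \<notin> D"
  proof (cases "y \<in> P")
    case False
    have "near y (y + (1, 1))" "lat (\<not> a) (y + (1, 1))" using near_lat_diffD[OF l, of "y + (1, 1)"] by simp_all
    then show ?thesis using inner_or[OF l False] y(1) by blast
  next
    case True
    \<comment> \<open>No step of \<open>P\<close> crosses an edge of \<open>Q\<close>, since
      distinct vertices have distinct partners. By minimality of \<open>P\<close>, one point of
      \<open>P\<close> in \<open>E\<close> forces all of \<open>P\<close> into
      \<open>E\<close>.\<close>
    have "nxt ` {x \<in> P. x \<in> E} \<subseteq> {x \<in> P. x \<in> E}"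
    proof
      fix x assume "x \<in> nxt ` {x \<in> P. x \<in> E}"
      then obtain z where z: "z \<in> P" "z \<in> E" "x = nxt z" by blast
      then have zw: "z \<in> wh a" using P_wh by blast
      obtain d where d: "d \<in> dirs" "\<mu> z = z + d" "nxt z = z + d + d"
      by (rule wh_dir[OF zw])
      have "z + d \<notin> \<mu> ` Q"
      proof
        assume "z + d \<in> \<mu> ` Q"
        then obtain f where f: "f \<in> Q" "\<mu> f = z + d" by auto
        then have "\<mu> f = \<mu> z" using d(2) by simp
        then have "\<mu> f \<in> C" using z(1) unfolding C_def by (metis imageI)
        then show False using not_C Q(2) f(1) by blast
      qed
      then have "nxt z \<in> E" using E_step[OF wh_lat[OF zw] d(1)] z(2) unfolding d(3) by blast
      moreover have "nxt z \<in> P" using z(1) P_image by (metis imageI)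
      ultimately show "x \<in> {x \<in> P. x \<in> E}" unfolding z(3) by simp
    qed
    moreover have "{x \<in> P. x \<in> E} \<noteq> {}" using True y by blast
    ultimately have PE: "{x \<in> P. x \<in> E} = P"
      using P_min unfolding min_closed_def by (metis (no_types, lifting) mem_Collect_eq subsetI)
    show ?thesis
    proof
      assume f0: "y + (1, 1) \<in> D"
      \<comment> \<open>Above a topmost face of \<open>D\<close> there is an edge of
        \<open>C\<close>, so the upper right corner of this face is a point of \<open>P\<close>. It
        lies higher than \<open>y\<close>, which was topmost.\<close>
      obtain f where f: "f \<in> D" "\<And>g. g \<in> D \<Longrightarrow> snd g \<le> snd f"
        using topmost[OF D_finite f0] by blast
      have fl: "lat (\<not> a) f" using D_lat f by blast
      have "\<not> snd (f + (0, 1) + (0, 1)) \<le> snd f" by simp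
      then have "f + (0, 1) + (0, 1) \<notin> D" using f(2) by blast
      then have fC: "f + (0, 1) \<in> C" using D_step[OF fl axis_dirs(3)] f(1) by blast
      have ql: "lat a (f + (1, 1))" using near_lat_diffD(2)[OF fl, of "f + (1, 1)"] by simp
      have "f + (0, 1) = f + (1, 1) + (-1, 0)" by (cases f) simp
      then have "f + (1, 1) + (-1, 0) \<in> C" using fC by metis
      then have "f + (1, 1) \<in> P" by (rule C_at[OF ql axis_dirs(2)])
      then have "f + (1, 1) \<in> E - inner" using PE unfolding inner_def by blast
      then have "snd (f + (1, 1)) \<le> snd y" by (rule y(2))
      moreover have "snd (y + (1, 1)) \<le> snd f" by (rule f(2)[OF f0])
      ultimately show False by simp
    qed
  qed
  have "snd (y + (0, 1) + (0, 1)) \<le> snd y" using y(2) up[OF _ top] y(1) by blast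
  then show False by simp
qed

end

text \<open>Infinite descent. The measure counts enclosed points of both sublattices, since their
  roles are exchanged at each step: \<open>E\<close> lies in the old \<open>inner\<close> and the
  new \<open>inner\<close> in \<open>D\<close>. The decrease is strict because a point of
  \<open>Q\<close> is in \<open>D\<close> but, being on the new cycle, not inside it.\<close>

lemma (in impurity_matching) no_matching_cycle: "\<not> matching_cycle G \<mu> r a P C D"
proof
  assume "matching_cycle G \<mu> r a P C D"
  then show False
  proof (induction "card (D \<union> matching_cycle.inner a P D)" arbitrary: a P C D rule: less_induct)
    case less
    interpret c: matching_cycle G \<mu> r a P C D by (rule less.prems)
    obtain Q where Q: "Q \<subseteq> D" "Q \<subseteq> wh (\<not> a)" "min_closed nxt Q" using c.dual_cycle by blast
    have ev: "\<not> odd_at (\<mu> ` Q) q" if "lat (\<not> a) q" for q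
      by (rule closed_orbit_even[OF Q(2,3) that])
    have "finite (\<mu> ` Q)" using Q(3) unfolding min_closed_def by blast
    from fills_exists[OF this, of "\<not> a"] ev obtain E where E: "fills (\<not> a) (\<mu> ` Q) E" by blast
    have m: "matching_cycle G \<mu> r (\<not> a) Q (\<mu> ` Q) E"
      by unfold_locales (use Q E in auto)
    interpret e: matching_cycle G \<mu> r "\<not> a" Q "\<mu> ` Q" E by (rule m)
    have E1: "E \<subseteq> c.inner" by (rule c.dual_region_inner[OF Q E])
    have E2: "e.inner \<subseteq> D"
    proof
      fix f assume f: "f \<in> e.inner"
      then have l: "lat (\<not> a) f" unfolding e.inner_def by blast
      have n: "near f (f + (1, 1))" "lat (\<not> \<not> a) (f + (1, 1))"
        using near_lat_diffD[OF l, of "f + (1, 1)"] by auto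
      then have "f + (1, 1) \<in> c.inner" using f E1 unfolding e.inner_def by blast
      then show "f \<in> D" using l near_sym[OF n(1)] unfolding c.inner_def by blast
    qed
    obtain f where f: "f \<in> Q" using Q(3) unfolding min_closed_def by blast
    have "f \<notin> E" using f e.P_lat e.D_lat lat_disj by (metis (full_types))
    moreover have "f \<notin> e.inner" using f unfolding e.inner_def by blast
    ultimately have less: "E \<union> e.inner \<subset> D \<union> c.inner" using E1 E2 f Q(1) by blast
    have "finite (D \<union> c.inner)" using c.D_finite c.inner_finite by (rule finite_UnI)
    then have "card (E \<union> e.inner) < card (D \<union> c.inner)" using less by (rule psubset_card_mono)
    then show False using m by (rule less.hyps)
  qed
qed

lemma (in impurity_matching) no_closed_orbit:
  assumes "Y \<subseteq> wh a" "nxt ` Y \<subseteq> Y"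
  shows "Y = {}"
proof (rule ccontr)
  assume ne: "Y \<noteq> {}"
  have "finite Y" using assms(1) finG finite_subset unfolding wh_def by fastforce
  then obtain P where P: "P \<subseteq> Y" "min_closed nxt P" using min_closed_exists ne assms(2) by metis
  have Pw: "P \<subseteq> wh a" using P assms by blast
  have "finite (\<mu> ` P)" using P(2) unfolding min_closed_def by blast
  from fills_exists[OF this, of a] closed_orbit_even[OF Pw P(2)]
  obtain D where "fills a (\<mu> ` P) D" by blast
  then have "matching_cycle G \<mu> r a P (\<mu> ` P) D"
    by unfold_locales (use P Pw in auto)
  then show False using no_matching_cycle by blast
qed

section \<open>Determinants as numbers of configurations\<close>

lemma det_on_cong:
  assumes "\<And>u x. u \<in> I \<Longrightarrow> x \<in> I \<Longrightarrow> M u x = N u x"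
  shows "det_on I M = det_on I N"
  unfolding det_on_def
proof (rule sum.cong[OF refl])
  fix \<pi> assume "\<pi> \<in> {\<pi>. \<pi> permutes I}"
  then have "(\<Prod>u\<in>I. M u (\<pi> u)) = (\<Prod>u\<in>I. N u (\<pi> u))"
    by (intro prod.cong refl assms) (simp_all add: permutes_in_image)
  then show "of_int (sign \<pi>) * (\<Prod>u\<in>I. M u (\<pi> u)) = of_int (sign \<pi>) * (\<Prod>u\<in>I. N u (\<pi> u))" by simp
qed

text \<open>Multilinearity in the rows. The choice of a summand in each row is a function, and these
  functions become the configurations.\<close>

lemma det_on_expand_rows:
  assumes I: "finite I" and J: "finite J"
  shows "det_on I (\<lambda>u x. \<Sum>d\<in>J. M d u x) = (\<Sum>g\<in>I \<rightarrow>\<^sub>E J. det_on I (\<lambda>u. M (g u) u))"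
proof -
  have "(\<Prod>u\<in>I. \<Sum>d\<in>J. M d u (\<pi> u)) = (\<Sum>g\<in>I \<rightarrow>\<^sub>E J. \<Prod>u\<in>I. M (g u) u (\<pi> u))" for \<pi>
    using prod_sum_PiE[OF I, of "\<lambda>_. J" "\<lambda>u d. M d u (\<pi> u)"] J by simp
  then have "det_on I (\<lambda>u x. \<Sum>d\<in>J. M d u x)
      = (\<Sum>\<pi> | \<pi> permutes I. \<Sum>g\<in>I \<rightarrow>\<^sub>E J. of_int (sign \<pi>) * (\<Prod>u\<in>I. M (g u) u (\<pi> u)))"
    unfolding det_on_def by (simp add: sum_distrib_left)
  also have "\<dots> = (\<Sum>g\<in>I \<rightarrow>\<^sub>E J. \<Sum>\<pi> | \<pi> permutes I. of_int (sign \<pi>) * (\<Prod>u\<in>I. M (g u) u (\<pi> u)))"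
    by (rule sum.swap)
  finally show ?thesis unfolding det_on_def .
qed

lemma prod_row_split:
  fixes P :: "'b \<Rightarrow> real"
  assumes "finite I" "a \<in> I"
  shows "(\<Prod>u\<in>I. (M(a := P)) u (\<pi> u)) = P (\<pi> a) * (\<Prod>u\<in>I - {a}. M u (\<pi> u))"
proof -
  have "(\<Prod>u\<in>I - {a}. (M(a := P)) u (\<pi> u)) = (\<Prod>u\<in>I - {a}. M u (\<pi> u))"
    by (intro prod.cong) auto
  then show ?thesis using prod.remove[OF assms, of "\<lambda>u. (M(a := P)) u (\<pi> u)"] by simp
qed

lemma det_on_row_sum:
  assumes "finite I" "a \<in> I"
  shows "det_on I (M(a := \<lambda>x. \<Sum>j\<in>J. c j * R j x)) = (\<Sum>j\<in>J. c j * det_on I (M(a := R j)))"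
proof -
  have "det_on I (M(a := \<lambda>x. \<Sum>j\<in>J. c j * R j x))
    = (\<Sum>\<pi> | \<pi> permutes I. \<Sum>j\<in>J. c j * (of_int (sign \<pi>) * (R j (\<pi> a) * (\<Prod>u\<in>I - {a}. M u (\<pi> u)))))"
    unfolding det_on_def prod_row_split[OF assms]
    by (intro sum.cong refl) (simp add: sum_distrib_left sum_distrib_right mult_ac)
  also have "\<dots> = (\<Sum>j\<in>J. \<Sum>\<pi> | \<pi> permutes I. c j * (of_int (sign \<pi>) * (R j (\<pi> a) * (\<Prod>u\<in>I - {a}. M u (\<pi> u)))))"
    by (rule sum.swap)
  finally show ?thesis
    unfolding det_on_def prod_row_split[OF assms] by (simp add: sum_distrib_left)
qed

text \<open>Composition with the transposition of the two rows keeps each product and reverses its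
  sign.\<close>

lemma det_on_equal_rows:
  assumes I: "finite I" and ab: "a \<in> I" "b \<in> I" "a \<noteq> b" and eq: "M a = M b"
  shows "det_on I M = 0"
proof -
  let ?t = "Transposition.transpose a b"
  have t: "?t permutes I" using ab by (intro permutes_swap_id)
  have eqt: "M (?t u) = M u" for u using eq by (cases "u = a"; cases "u = b") (auto simp: Transposition.transpose_def)
  have "det_on I M = (\<Sum>\<pi> | \<pi> permutes I. of_int (sign (\<pi> \<circ> ?t)) * (\<Prod>u\<in>I. M u ((\<pi> \<circ> ?t) u)))"
    unfolding det_on_def
    by (rule sum.reindex_bij_witness[of _ "\<lambda>\<pi>. \<pi> \<circ> ?t" "\<lambda>\<pi>. \<pi> \<circ> ?t"])
      (auto simp: comp_assoc permutes_compose t)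
  also have "\<dots> = (\<Sum>\<pi> | \<pi> permutes I. - (of_int (sign \<pi>) * (\<Prod>u\<in>I. M u (\<pi> u))))"
  proof (rule sum.cong[OF refl])
    fix \<pi> assume "\<pi> \<in> {\<pi>. \<pi> permutes I}"
    then have "permutation \<pi>" using I permutes_imp_permutation by blast
    then have s: "sign (\<pi> \<circ> ?t) = - sign \<pi>"
      using sign_compose[OF _ permutes_imp_permutation[OF I t], of \<pi>] ab(3) by (simp add: sign_swap_id)
    have "(\<Prod>u\<in>I. M u ((\<pi> \<circ> ?t) u)) = (\<Prod>u\<in>I. M (?t u) (\<pi> (?t u)))" unfolding eqt by simp
    also have "\<dots> = (\<Prod>u\<in>I. M u (\<pi> u))" using prod.permute[OF t, of "\<lambda>u. M u (\<pi> u)"] by (simp add: comp_def)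
    finally show "of_int (sign (\<pi> \<circ> ?t)) * (\<Prod>u\<in>I. M u ((\<pi> \<circ> ?t) u)) = - (of_int (sign \<pi>) * (\<Prod>u\<in>I. M u (\<pi> u)))"
      unfolding s by simp
  qed
  also have "\<dots> = - det_on I M" unfolding det_on_def by (rule sum_negf)
  finally show ?thesis by simp
qed

text \<open>A summand with \<open>j \<noteq> a\<close> produces two equal rows. For
  \<open>J = I\<close> this is Cramer's rule, for two rows an elementary row operation, and for
  \<open>a \<notin> J\<close> the vanishing of a determinant with dependent rows.\<close>

lemma det_on_row_combination:
  assumes I: "finite I" and a: "a \<in> I" and J: "J \<subseteq> I"
  shows "det_on I (M(a := \<lambda>x. \<Sum>j\<in>J. c j * M j x)) = (if a \<in> J then c a * det_on I M else 0)"
proof -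
  have fJ: "finite J" using I J finite_subset by blast
  have "det_on I (M(a := M j)) = (if j = a then det_on I M else 0)" if "j \<in> J" for j
    using det_on_equal_rows[OF I a, of j "M(a := M j)"] J that by auto
  then have "(\<Sum>j\<in>J. c j * det_on I (M(a := M j))) = (\<Sum>j\<in>J. if j = a then c a * det_on I M else 0)"
    by (intro sum.cong) auto
  then show ?thesis unfolding det_on_row_sum[OF I a] using fJ by simp
qed

lemma det_on_zero_row:
  assumes I: "finite I" and a: "a \<in> I" and z: "\<And>x. x \<in> I \<Longrightarrow> M a x = 0"
  shows "det_on I M = 0"
proof -
  have "det_on I M = det_on I (M(a := \<lambda>x. \<Sum>j\<in>{}. 0 * M j x))"
    by (rule det_on_cong) (use z in auto)
  then show ?thesis using det_on_row_combination[OF I a, of "{}" M "\<lambda>_. 0"] by simp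
qed

text \<open>If the product of a permutation does not vanish, the points that it moves lie in
  \<open>R\<close> and are permuted by \<open>s\<close>. So only the identity contributes, and its
  diagonal entries are 1 because \<open>s\<close> has no fixed point in \<open>R\<close>.\<close>

lemma det_on_functional_acyclic:
  assumes I: "finite I" and R: "R \<subseteq> I"
    and M: "\<And>u x. u \<in> I \<Longrightarrow> x \<in> I \<Longrightarrow> M u x = of_bool (x = u) - of_bool (u \<in> R \<and> x = s u)"
    and acyc: "\<And>Y. Y \<subseteq> R \<Longrightarrow> s ` Y = Y \<Longrightarrow> Y = {}"
  shows "det_on I M = 1"
proof -
  have ne: "s u \<noteq> u" if "u \<in> R" for u using acyc[of "{u}"] that by auto
  have zero: "(\<Prod>u\<in>I. M u (\<pi> u)) = 0" if pi: "\<pi> permutes I" "\<pi> \<noteq> id" for \<pi>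
  proof (rule ccontr)
    assume "(\<Prod>u\<in>I. M u (\<pi> u)) \<noteq> 0"
    then have nz: "M u (\<pi> u) \<noteq> 0" if "u \<in> I" for u using that I by auto
    have cs: "\<pi> u = u \<or> u \<in> R \<and> \<pi> u = s u" if "u \<in> I" for u
      using nz[OF that] M[OF that, of "\<pi> u"] that permutes_in_image[OF pi(1)] by (auto split: if_splits)
    define Y where "Y = {u \<in> I. \<pi> u \<noteq> u}"
    have "Y \<subseteq> R" using cs unfolding Y_def by blast
    have "s u = \<pi> u" if "u \<in> Y" for u
      using cs[of u] that unfolding Y_def mem_Collect_eq by metis
    then have "s ` Y = \<pi> ` Y" by (rule image_cong[OF refl])
    also have "\<pi> ` Y = Y"
    proof
      have inj: "inj \<pi>" using pi(1) by (rule permutes_inj)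
      show "\<pi> ` Y \<subseteq> Y" unfolding Y_def using permutes_in_image[OF pi(1)] inj by (auto simp: inj_eq)
      show "Y \<subseteq> \<pi> ` Y"
      proof
        fix y assume y: "y \<in> Y"
        obtain x where x: "y = \<pi> x" using permutes_surj[OF pi(1)] by (metis surjD)
        then have "x \<in> Y" using y permutes_in_image[OF pi(1)] inj unfolding Y_def by (auto simp: inj_eq)
        then show "y \<in> \<pi> ` Y" using x by blast
      qed
    qed
    finally have "Y = {}" using acyc[OF \<open>Y \<subseteq> R\<close>] by blast
    then have "\<pi> u = u" for u using permutes_not_in[OF pi(1), of u] unfolding Y_def by blast
    then show False using pi(2) by auto
  qed
  have "det_on I M = (\<Sum>\<pi>\<in>{id}. of_int (sign \<pi>) * (\<Prod>u\<in>I. M u (\<pi> u)))"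
    unfolding det_on_def
    by (rule sum.mono_neutral_right) (use I zero permutes_id finite_permutations[OF I] in auto)
  also have "\<dots> = (\<Prod>u\<in>I. M u u)" by simp
  also have "\<dots> = 1" by (rule prod.neutral) (use M ne in fastforce)
  finally show ?thesis .
qed

text \<open>\<open>s\<close> permutes \<open>Y\<close>, so the rows belonging to \<open>Y\<close>
  add up to zero.\<close>

lemma det_on_functional_cyclic:
  assumes I: "finite I" and Y: "Y \<subseteq> I" "Y \<noteq> {}" "s ` Y = Y"
    and M: "\<And>u x. u \<in> Y \<Longrightarrow> x \<in> I \<Longrightarrow> M u x = of_bool (x = u) - of_bool (x = s u)"
  shows "det_on I M = 0"
proof -
  have fY: "finite Y" using I Y(1) finite_subset by blast
  then have inj: "inj_on s Y" using Y(3) eq_card_imp_inj_on[of Y s] by simp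
  obtain a where a: "a \<in> Y" using Y by blast
  have sum0: "(\<Sum>u\<in>Y. M u x) = 0" if x: "x \<in> I" for x
  proof -
    have "(\<Sum>u\<in>Y. of_bool (x = s u) :: real) = (\<Sum>u\<in>s ` Y. of_bool (x = u))"
      using sum.reindex[OF inj, of "\<lambda>u. of_bool (x = u) :: real"] by (simp add: comp_def)
    then show ?thesis using M x Y(3) by (simp add: sum_subtractf)
  qed
  have row: "M a x = (\<Sum>j\<in>Y - {a}. - 1 * M j x)" if "x \<in> I" for x
    using sum0[OF that] sum.remove[OF fY a, of "\<lambda>u. M u x"] by (simp add: sum_negf)
  have "det_on I M = det_on I (M(a := \<lambda>x. \<Sum>j\<in>Y - {a}. - 1 * M j x))"
    by (rule det_on_cong) (use row in auto)
  also have "\<dots> = 0"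
    using det_on_row_combination[OF I, of a "Y - {a}" M "\<lambda>_. - 1"] a Y(1) by auto
  finally show ?thesis .
qed

section \<open>Configurations and the determinants belonging to them\<close>

definition dir_step :: "pt \<Rightarrow> pt \<Rightarrow> (pt \<Rightarrow> pt) \<Rightarrow> pt \<Rightarrow> pt" where
  "dir_step fs v g z = z + g (if z = fs then v else z) + g (if z = fs then v else z)"

text \<open>A configuration assigns a direction to every face other than \<open>v\<close> and to \<open>fs\<close>; the direction of
  \<open>fs\<close> is stored at \<open>v\<close>.\<close>

definition acyclic_conf :: "pt set \<Rightarrow> pt \<Rightarrow> pt \<Rightarrow> (pt \<Rightarrow> pt) \<Rightarrow> bool" where
  "acyclic_conf F fs v g \<longleftrightarrow> (\<forall>Y\<subseteq>F - {v}. dir_step fs v g ` Y = Y \<longrightarrow> Y = {})"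

definition conf_path :: "pt set \<Rightarrow> pt \<Rightarrow> pt \<Rightarrow> (pt \<Rightarrow> pt) \<Rightarrow> pt \<Rightarrow> pt \<Rightarrow> bool" where
  "conf_path F fs v g = (\<lambda>x y. x \<in> F - {v} \<and> y = dir_step fs v g x)\<^sup>*\<^sup>*"

text \<open>If \<open>v = fs\<close>, then \<open>fs\<close> is the impurity vertex and has no
  direction, so only acyclicity remains.\<close>

definition good_confs :: "pt set \<Rightarrow> pt \<Rightarrow> pt \<Rightarrow> (pt \<Rightarrow> pt) set" where
  "good_confs F fs v = {g \<in> F \<rightarrow>\<^sub>E dirs. acyclic_conf F fs v g \<and>
     (v \<noteq> fs \<longrightarrow> conf_path F fs v g (dir_step fs v g fs) v)}"

lemma dirs_neighbours:
  shows "(\<Sum>d\<in>dirs. of_bool (x = u + d + d) :: real) = of_bool (lat2_adj u x)"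
proof -
  obtain x1 x2 u1 u2 where p: "x = (x1, x2)" "u = (u1, u2)" by fastforce
  have "(\<Sum>d\<in>dirs. of_bool (x = u + d + d) :: real)
     = of_bool (x1 = u1 + 2 \<and> x2 = u2) + of_bool (x1 = u1 - 2 \<and> x2 = u2)
     + of_bool (x1 = u1 \<and> x2 = u2 + 2) + of_bool (x1 = u1 \<and> x2 = u2 - 2)"
    unfolding dirs_def p by (simp add: add.commute)
  also have "\<dots> = of_bool (lat2_adj u x)"
    unfolding lat2_adj_def p fst_conv snd_conv by (cases "x1 = u1"; cases "x2 = u2") (auto simp: abs_if)
  finally show ?thesis .
qed

lemma card_dirs [simp]: "card dirs = 4"
  by (simp add: dirs_def)

lemma lat2_adj_irrefl: "\<not> lat2_adj u u"
  by (simp add: lat2_adj_def)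

lemma lat2_adj_sym: "lat2_adj u x = lat2_adj x u"
  by (auto simp: lat2_adj_def abs_minus_commute)

lemma Amat_sum: "Amat u x = (\<Sum>d\<in>dirs. of_bool (x = u) - of_bool (x = u + d + d))"
  unfolding sum_subtractf dirs_neighbours Amat_def
  using lat2_adj_irrefl[of u] by (cases "x = u") auto

text \<open>A cycle makes rows dependent. Otherwise row operations move the unit vector in row
  \<open>v\<close> along the path from \<open>fs\<close>. If the path arrives at \<open>v\<close>,
  an acyclic functional matrix with determinant 1 remains; if it leaves \<open>F\<close>, row
  \<open>v\<close> becomes zero.\<close>

lemma det_on_conf:
  assumes F: "finite F" and v: "v \<in> F" and fs: "fs \<notin> F"
    and M: "\<And>u x. u \<in> F \<Longrightarrow> x \<in> F \<Longrightarrow> M u x = (if u = v then of_bool (x = dir_step fs v g fs)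
       else of_bool (x = u) - of_bool (x = dir_step fs v g u))"
  shows "det_on F M = of_bool (acyclic_conf F fs v g \<and> conf_path F fs v g (dir_step fs v g fs) v)"
proof (cases "acyclic_conf F fs v g")
  case False
  then obtain Y where Y: "Y \<subseteq> F - {v}" "Y \<noteq> {}" "dir_step fs v g ` Y = Y" unfolding acyclic_conf_def by blast
  have "det_on F M = 0"
  proof (rule det_on_functional_cyclic[OF F _ Y(2,3)])
    fix u x assume u: "u \<in> Y" and x: "x \<in> F"
    have "u \<in> F" "u \<noteq> v" using u Y(1) by blast+
    then show "M u x = of_bool (x = u) - of_bool (x = dir_step fs v g u)" using M[OF _ x, of u] by simp
  qed (use Y(1) in blast)
  then show ?thesis using False by simp
next
  case True
  define s where "s = dir_step fs v g"
  define N where "N t = (\<lambda>u x. if u = v then of_bool (x = t) else of_bool (x = u) - of_bool (x = s u) :: real)" for t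
  have MN: "det_on F M = det_on F (N (s fs))"
    by (rule det_on_cong) (simp only: M N_def s_def)
  have stepN: "det_on F (N t) = det_on F (N (s t))" if t: "t \<in> F - {v}" for t
  proof -
    have tv: "t \<noteq> v" using t by blast
    \<comment> \<open>Row \<open>v\<close> of \<open>N t\<close> is the unit vector at
      \<open>t\<close>. It is the sum of row \<open>t\<close>, which is this vector minus the one at
      \<open>s t\<close>, and row \<open>v\<close> of \<open>N (s t)\<close>.\<close>
    have "det_on F (N t) = det_on F ((N (s t))(v := \<lambda>x. \<Sum>j\<in>{t, v}. 1 * N (s t) j x))"
    proof (rule det_on_cong)
      fix u x
      have "(\<Sum>j\<in>{t, v}. 1 * N (s t) j x) = N (s t) t x + N (s t) v x" using tv by simp
      also have "\<dots> = of_bool (x = t)" unfolding N_def using tv by simp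
      finally show "N t u x = ((N (s t))(v := \<lambda>x. \<Sum>j\<in>{t, v}. 1 * N (s t) j x)) u x"
        unfolding N_def by simp
    qed
    also have "\<dots> = det_on F (N (s t))"
      using det_on_row_combination[OF F v, of "{t, v}" "N (s t)" "\<lambda>_. 1"] t v by simp
    finally show ?thesis .
  qed
  have path: "det_on F (N t) = det_on F (N z)" if "conf_path F fs v g t z" for t z
    using that unfolding conf_path_def
  proof (induction rule: rtranclp_induct)
    case (step y z)
    then have "y \<in> F - {v}" "z = s y" unfolding s_def by blast+
    then show ?case using stepN[of y] step.IH by simp
  qed simp
  show ?thesis
  proof (cases "conf_path F fs v g (s fs) v")
    case reach: True
    have "det_on F (N v) = 1"
    proof (rule det_on_functional_acyclic[OF F, of "F - {v}" _ s])
      show "Y = {}" if "Y \<subseteq> F - {v}" "s ` Y = Y" for Y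
        using True that unfolding acyclic_conf_def s_def by blast
      show "N v u x = of_bool (x = u) - of_bool (u \<in> F - {v} \<and> x = s u)" if "u \<in> F" for u x
        unfolding N_def using that by simp
    qed blast
    then show ?thesis using MN path[OF reach] True reach unfolding s_def by simp
  next
    case noreach: False
    define Z where "Z = {z. conf_path F fs v g (s fs) z}"
    \<comment> \<open>A path that stayed in \<open>F - {v}\<close> for ever would have a finite set
      of vertices closed under \<open>s\<close>, and this would contain a cycle.\<close>
    have "\<exists>z\<in>Z. z \<notin> F - {v}"
    proof (rule ccontr)
      assume "\<not> (\<exists>z\<in>Z. z \<notin> F - {v})"
      then have Z: "Z \<subseteq> F - {v}" by blast
      have "s ` Z \<subseteq> Z"
      proof
        fix y assume "y \<in> s ` Z"
        then obtain z where z: "z \<in> Z" "y = s z" by blast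
        then have "conf_path F fs v g (s fs) z" "z \<in> F - {v}" using Z unfolding Z_def by auto
        then have "conf_path F fs v g (s fs) y" using z(2) unfolding conf_path_def s_def
          by (simp add: rtranclp.rtrancl_into_rtrancl)
        then show "y \<in> Z" unfolding Z_def by simp
      qed
      moreover have "s fs \<in> Z" unfolding Z_def conf_path_def by simp
      moreover have "finite Z" using Z F finite_subset by blast
      ultimately obtain P where P: "P \<subseteq> Z" "min_closed s P" using min_closed_exists[of Z s] by blast
      then have "P \<subseteq> F - {v}" "s ` P = P" "P \<noteq> {}"
        using Z min_closed_image[OF P(2)] unfolding min_closed_def by auto
      then show False using True unfolding acyclic_conf_def s_def by blast
    qed
    then obtain z where z: "conf_path F fs v g (s fs) z" "z \<notin> F - {v}" unfolding Z_def by blast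
    then have "z \<notin> F" using noreach by auto
    then have "det_on F (N z) = 0" by (intro det_on_zero_row[OF F v]) (auto simp: N_def)
    then show ?thesis using MN path[OF z(1)] noreach unfolding s_def by simp
  qed
qed

lemma sum_of_bool_filter:
  assumes "finite A"
  shows "(\<Sum>x\<in>A. of_bool (P x) :: real) = real (card {x \<in> A. P x})"
proof -
  have "(\<Sum>x\<in>A. of_bool (P x) :: real) = (\<Sum>x\<in>{x \<in> A. P x}. 1)"
    by (rule sum.mono_neutral_cong_right) (use assms in \<open>simp_all del: split_paired_All\<close>)
  then show ?thesis by simp
qed

lemma card_good_confs:
  assumes F: "finite F" and fs: "fs \<notin> F" and v: "v \<in> insert fs F"
    and p: "\<And>u. u \<in> F \<Longrightarrow> (\<Sum>u'\<in>F. Amat u u' * p u') = bvec fs u" and p1: "p fs = 1"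
  shows "real (card (good_confs F fs v)) = det_on F Amat * p v"
proof (cases "v = fs")
  case True
  have fin: "finite (F \<rightarrow>\<^sub>E dirs)" using F by (simp add: finite_PiE)
  have "det_on F Amat = det_on F (\<lambda>u x. \<Sum>d\<in>dirs. of_bool (x = u) - of_bool (x = u + d + d))"
    by (rule det_on_cong) (simp add: Amat_sum)
  also have "\<dots> = (\<Sum>g\<in>F \<rightarrow>\<^sub>E dirs. det_on F (\<lambda>u x. of_bool (x = u) - of_bool (x = u + g u + g u)))"
    by (rule det_on_expand_rows[OF F finite_dirs])
  also have "\<dots> = (\<Sum>g\<in>F \<rightarrow>\<^sub>E dirs. of_bool (acyclic_conf F fs v g))"
  proof (rule sum.cong[OF refl])
    fix g
    have ds: "dir_step fs v g u = u + g u + g u" for u using True unfolding dir_step_def by simp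
    have Fv: "F - {v} = F" using True fs by simp
    show "det_on F (\<lambda>u x. of_bool (x = u) - of_bool (x = u + g u + g u)) = of_bool (acyclic_conf F fs v g)"
    proof (cases "acyclic_conf F fs v g")
      case acyc: True
      have "det_on F (\<lambda>u x. of_bool (x = u) - of_bool (x = u + g u + g u)) = 1"
      proof (rule det_on_functional_acyclic[OF F subset_refl, of _ "dir_step fs v g"])
        show "Y = {}" if "Y \<subseteq> F" "dir_step fs v g ` Y = Y" for Y
          using acyc that unfolding acyclic_conf_def Fv by blast
      qed (simp add: ds)
      then show ?thesis using acyc by simp
    next
      case cyc: False
      then obtain Y where Y: "Y \<subseteq> F" "Y \<noteq> {}" "dir_step fs v g ` Y = Y"
        unfolding acyclic_conf_def Fv by blast
      have "det_on F (\<lambda>u x. of_bool (x = u) - of_bool (x = u + g u + g u)) = 0"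
        by (rule det_on_functional_cyclic[OF F Y]) (simp add: ds)
      then show ?thesis using cyc by simp
    qed
  qed
  also have "\<dots> = real (card (good_confs F fs v))"
    unfolding sum_of_bool_filter[OF fin] good_confs_def using True by simp
  finally show ?thesis using True p1 by simp
next
  case False
  then have vF: "v \<in> F" using v by simp
  have fin: "finite (F \<rightarrow>\<^sub>E dirs)" using F by (simp add: finite_PiE)
  have Asym: "Amat u x = Amat x u" for u x unfolding Amat_def using lat2_adj_sym[of u x] by auto
  \<comment> \<open>Cramer's rule for rows in place of columns: as \<open>A\<close> is symmetric,
    its rows combined with the coefficients \<open>p\<close> also give \<open>b\<close>.\<close>
  have "det_on F Amat * p v = det_on F (Amat(v := \<lambda>x. \<Sum>j\<in>F. p j * Amat j x))"
    using det_on_row_combination[OF F vF subset_refl, of Amat p] vF by simp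
  also have "\<dots> = det_on F (\<lambda>u x. \<Sum>d\<in>dirs. if u = v then of_bool (x = fs + d + d)
      else of_bool (x = u) - of_bool (x = u + d + d))"
  proof (rule det_on_cong)
    fix u x assume ux: "u \<in> F" "x \<in> F"
    have "(\<Sum>j\<in>F. p j * Amat j x) = bvec fs x"
      unfolding p[OF ux(2), symmetric] by (intro sum.cong) (simp_all add: Asym[of _ x])
    then show "(Amat(v := \<lambda>x. \<Sum>j\<in>F. p j * Amat j x)) u x = (\<Sum>d\<in>dirs. if u = v then of_bool (x = fs + d + d)
      else of_bool (x = u) - of_bool (x = u + d + d))"
      using dirs_neighbours[of x fs] Amat_sum[of u x] by (cases "u = v") (simp_all add: bvec_def)
  qed
  also have "\<dots> = (\<Sum>g\<in>F \<rightarrow>\<^sub>E dirs. det_on F (\<lambda>u x. if u = v then of_bool (x = fs + g u + g u)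
      else of_bool (x = u) - of_bool (x = u + g u + g u)))"
    by (rule det_on_expand_rows[OF F finite_dirs])
  also have "\<dots> = (\<Sum>g\<in>F \<rightarrow>\<^sub>E dirs. of_bool (acyclic_conf F fs v g \<and> conf_path F fs v g (dir_step fs v g fs) v))"
  proof (intro sum.cong[OF refl] det_on_conf[OF F vF fs])
    fix g u x assume "u \<in> F"
    then have "u \<noteq> fs" using fs by blast
    then show "(if u = v then of_bool (x = fs + g u + g u) else of_bool (x = u) - of_bool (x = u + g u + g u))
      = (if u = v then of_bool (x = dir_step fs v g fs) else of_bool (x = u) - of_bool (x = dir_step fs v g u) :: real)"
      unfolding dir_step_def by simp
  qed
  also have "\<dots> = real (card (good_confs F fs v))"
    unfolding sum_of_bool_filter[OF fin] good_confs_def using False by simp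
  finally show ?thesis by simp
qed

section \<open>Consequences of simple connectedness\<close>

text \<open>The boundary of a square of side 2 would run inside \<open>U\<close> around a point
  outside \<open>U\<close>. In the complex plane its winding number about this point is 1, but
  simple connectedness requires 0.\<close>

lemma simply_connected_no_ring:
  fixes U :: "(real \<times> real) set"
  assumes U: "simply_connected U" and z: "(x, y) \<notin> U"
    and ring: "\<And>s t. \<bar>s - x\<bar> \<le> 1 \<Longrightarrow> \<bar>t - y\<bar> \<le> 1 \<Longrightarrow> \<bar>s - x\<bar> = 1 \<or> \<bar>t - y\<bar> = 1 \<Longrightarrow> (s, t) \<in> U"
  shows False
proof -
  define f :: "real \<times> real \<Rightarrow> complex" where "f = (\<lambda>p. Complex (fst p) (snd p))"
  have "homeomorphism U (f ` U) f (\<lambda>z. (Re z, Im z))"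
    unfolding f_def by (intro homeomorphismI continuous_intros) auto
  then have "U homeomorphic f ` U" unfolding homeomorphic_def by blast
  then have sc: "simply_connected (f ` U)" using U homeomorphic_simply_connected_eq by blast
  define a where "a = Complex (x - 1) (y - 1)"
  define b where "b = Complex (x + 1) (y + 1)"
  have img: "path_image (rectpath a b) \<subseteq> f ` U"
  proof
    fix w assume "w \<in> path_image (rectpath a b)"
    then have "(Re w = x - 1 \<or> Re w = x + 1) \<and> y - 1 \<le> Im w \<and> Im w \<le> y + 1 \<or>
        (Im w = y - 1 \<or> Im w = y + 1) \<and> x - 1 \<le> Re w \<and> Re w \<le> x + 1"
      by (subst (asm) path_image_rectpath) (auto simp: a_def b_def)
    then have "(Re w, Im w) \<in> U" by (intro ring) auto
    moreover have "w = f (Re w, Im w)" by (simp add: f_def)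
    ultimately show "w \<in> f ` U" by blast
  qed
  have "Complex x y \<notin> f ` U" using z unfolding f_def by auto
  then have "winding_number (rectpath a b) (Complex x y) = 0"
    by (intro simply_connected_imp_winding_number_zero[OF sc _ img]) auto
  moreover have "winding_number (rectpath a b) (Complex x y) = 1"
    by (rule winding_number_rectpath) (auto simp: a_def b_def in_box_complex_iff)
  ultimately show False by simp
qed

lemma in_face_square:
  "(s, t) \<in> face_square c \<longleftrightarrow> \<bar>s - of_int (fst c)\<bar> \<le> 1 \<and> \<bar>t - of_int (snd c)\<bar> \<le> 1"
  unfolding face_square_def by (auto simp: cbox_Pair_iff abs_le_iff)

lemma real_in_outer_interval:
  fixes s :: real and i :: int
  assumes "\<bar>s - of_int i\<bar> = 1"
  shows "\<bar>s - of_int (i + 2)\<bar> \<le> 1 \<or> \<bar>s - of_int (i - 2)\<bar> \<le> 1"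
  using assms by (auto simp: abs_if split: if_splits)

text \<open>Otherwise the four neighbouring squares would cover the boundary of the square around
  \<open>fs\<close>, while no square of \<open>F\<close> contains its centre.\<close>

lemma not_all_sides:
  assumes F: "F \<subseteq> W1" and sc: "simply_connected (\<Union>c\<in>F. face_square c)"
    and fs: "fs \<in> W1" "fs \<notin> F"
  shows "\<exists>d\<in>dirs. fs + d + d \<notin> F"
proof (rule ccontr)
  assume all: "\<not> (\<exists>d\<in>dirs. fs + d + d \<notin> F)"
  obtain i j where ij: "fs = (i, j)" by fastforce
  have sides: "fs + d + d \<in> F" if "d \<in> dirs" for d using all that by blast
  have inF: "(i + 2, j) \<in> F" "(i - 2, j) \<in> F" "(i, j + 2) \<in> F" "(i, j - 2) \<in> F"
    using sides[OF axis_dirs(1)] sides[OF axis_dirs(2)] sides[OF axis_dirs(3)] sides[OF axis_dirs(4)]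
    unfolding ij by (simp_all add: add.commute)
  show False
  proof (rule simply_connected_no_ring[OF sc, of "of_int i" "of_int j"])
    show "(real_of_int i, real_of_int j) \<notin> (\<Union>c\<in>F. face_square c)"
    proof
      assume "(real_of_int i, real_of_int j) \<in> (\<Union>c\<in>F. face_square c)"
      then obtain c where c: "c \<in> F" "(real_of_int i, real_of_int j) \<in> face_square c" by blast
      then have "\<bar>real_of_int (i - fst c)\<bar> \<le> 1" "\<bar>real_of_int (j - snd c)\<bar> \<le> 1" unfolding in_face_square by auto
      then have "\<bar>i - fst c\<bar> \<le> 1" "\<bar>j - snd c\<bar> \<le> 1" by linarith+
      moreover have "odd (fst c)" "odd (snd c)" "odd i" "odd j"
        using F fs c(1) unfolding W1_def ij by auto
      ultimately have "i = fst c" "j = snd c" using int_near_same by blast+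
      then show False using c(1) fs(2) unfolding ij by simp
    qed
    fix s t :: real
    assume st: "\<bar>s - real_of_int i\<bar> \<le> 1" "\<bar>t - real_of_int j\<bar> \<le> 1"
      and "\<bar>s - real_of_int i\<bar> = 1 \<or> \<bar>t - real_of_int j\<bar> = 1"
    then consider "\<bar>s - real_of_int i\<bar> = 1" | "\<bar>t - real_of_int j\<bar> = 1" by blast
    then have "(s, t) \<in> face_square (i + 2, j) \<or> (s, t) \<in> face_square (i - 2, j) \<or>
        (s, t) \<in> face_square (i, j + 2) \<or> (s, t) \<in> face_square (i, j - 2)"
    proof cases
      case 1
      from real_in_outer_interval[OF 1] show ?thesis using st unfolding in_face_square fst_conv snd_conv by blast
    next
      case 2
      from real_in_outer_interval[OF 2] show ?thesis using st unfolding in_face_square fst_conv snd_conv by blast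
    qed
    then show "(s, t) \<in> (\<Union>c\<in>F. face_square c)" using inF by blast
  qed
qed

lemma corners_iff: "x \<in> corners F \<longleftrightarrow> (\<exists>c\<in>F. x \<in> {c + (1, 1), c + (1, -1), c + (-1, 1), c + (-1, -1)})"
proof
  assume "x \<in> corners F"
  then obtain c i j where c: "c \<in> F" "x = (fst c + i, snd c + j)" "i \<in> {-1, 1}" "j \<in> {-1, 1}"
    unfolding corners_def by blast
  then have "x = c + (i, j)" by (simp add: prod_eq_iff)
  then show "\<exists>c\<in>F. x \<in> {c + (1, 1), c + (1, -1), c + (-1, 1), c + (-1, -1)}"
    using c(1,3,4) by (intro bexI[of _ c]) fastforce+
next
  assume "\<exists>c\<in>F. x \<in> {c + (1, 1), c + (1, -1), c + (-1, 1), c + (-1, -1)}"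
  then obtain c where c: "c \<in> F" "x = c + (1, 1) \<or> x = c + (1, -1) \<or> x = c + (-1, 1) \<or> x = c + (-1, -1)" by blast
  have "c + (i, j) \<in> corners F" if "i \<in> {-1, 1}" "j \<in> {-1, 1}" for i j
    unfolding corners_def mem_Collect_eq
    by (intro exI[of _ c] exI[of _ i] exI[of _ j]) (use c that in \<open>simp add: prod_eq_iff\<close>)
  then show "x \<in> corners F" using c(2) by (elim disjE) simp_all
qed

lemma midpoints_iff: "m \<in> midpoints F \<longleftrightarrow> (\<exists>c\<in>F. \<exists>d\<in>dirs. m = c + d)"
proof
  assume "m \<in> midpoints F"
  then obtain c i j where c: "c \<in> F" "m = (fst c + i, snd c + j)" "(i, j) \<in> dirs"
    unfolding midpoints_def dirs_def by blast
  then have "m = c + (i, j)" by (simp add: prod_eq_iff)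
  then show "\<exists>c\<in>F. \<exists>d\<in>dirs. m = c + d" using c by blast
next
  assume "\<exists>c\<in>F. \<exists>d\<in>dirs. m = c + d"
  then obtain c d where c: "c \<in> F" "d \<in> dirs" "m = c + d" by blast
  have "m = (fst c + fst d, snd c + snd d)" using c(3) by (simp add: prod_eq_iff)
  moreover have "(fst d, snd d) \<in> dirs" using c by simp
  ultimately show "m \<in> midpoints F" using c(1) unfolding midpoints_def dirs_def by blast
qed

lemma corner_ring_closed:
  assumes c: "c \<in> F" and X: "\<And>x d. x \<in> X \<Longrightarrow> d \<in> dirs \<Longrightarrow> x + d \<in> midpoints F \<Longrightarrow> x + d + d \<in> X"
    and k: "k \<in> {c + (1, 1), c + (1, -1), c + (-1, 1), c + (-1, -1)}" "k \<in> X"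
    and l: "l \<in> {c + (1, 1), c + (1, -1), c + (-1, 1), c + (-1, -1)}"
  shows "l \<in> X"
proof -
  have mid: "c + d \<in> midpoints F" if "d \<in> dirs" for d using midpoints_iff c that by blast
  obtain i j where ij: "c = (i, j)" by fastforce
  have m: "(i + 1, j) \<in> midpoints F" "(i - 1, j) \<in> midpoints F" "(i, j + 1) \<in> midpoints F" "(i, j - 1) \<in> midpoints F"
    using mid[OF axis_dirs(1)] mid[OF axis_dirs(2)] mid[OF axis_dirs(3)] mid[OF axis_dirs(4)] unfolding ij by simp_all
  have a: "(i + 1, j - 1) \<in> X" if "(i + 1, j + 1) \<in> X" using X[OF that axis_dirs(4)] m by simp
  have b: "(i - 1, j - 1) \<in> X" if "(i + 1, j - 1) \<in> X" using X[OF that axis_dirs(2)] m by simp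
  have d: "(i - 1, j + 1) \<in> X" if "(i - 1, j - 1) \<in> X" using X[OF that axis_dirs(3)] m by simp
  have e: "(i + 1, j + 1) \<in> X" if "(i - 1, j + 1) \<in> X" using X[OF that axis_dirs(1)] m by simp
  have "k = (i + 1, j + 1) \<or> k = (i + 1, j - 1) \<or> k = (i - 1, j + 1) \<or> k = (i - 1, j - 1)"
    using k(1) unfolding ij by simp
  moreover have "l = (i + 1, j + 1) \<or> l = (i + 1, j - 1) \<or> l = (i - 1, j + 1) \<or> l = (i - 1, j - 1)"
    using l unfolding ij by simp
  ultimately show ?thesis using a b d e k(2) by metis
qed

text \<open>In each coordinate the centres are odd and differ by at most 2, so some integer has
  distance 1 from both.\<close>

lemma face_squares_share_corner:
  assumes "c \<in> W1" "c' \<in> W1" "q \<in> face_square c" "q \<in> face_square c'"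
  obtains k where "k \<in> {c + (1, 1), c + (1, -1), c + (-1, 1), c + (-1, -1)}"
    "k \<in> {c' + (1, 1), c' + (1, -1), c' + (-1, 1), c' + (-1, -1)}"
proof -
  obtain s t where q: "q = (s, t)" by fastforce
  obtain i j i' j' where ij: "c = (i, j)" "c' = (i', j')" by fastforce
  have r: "\<bar>s - of_int i\<bar> \<le> 1" "\<bar>t - of_int j\<bar> \<le> 1" "\<bar>s - of_int i'\<bar> \<le> 1" "\<bar>t - of_int j'\<bar> \<le> 1"
    using assms(3,4) unfolding q in_face_square ij by simp_all
  have *: "\<exists>k. \<bar>k - a\<bar> = 1 \<and> \<bar>k - b\<bar> = 1" if "\<bar>s - of_int a\<bar> \<le> 1" "\<bar>s - of_int b\<bar> \<le> 1" "odd a" "odd b" for s :: real and a b :: int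
  proof -
    have "real_of_int \<bar>a - b\<bar> \<le> 2" using that(1,2) by linarith
    then have "\<bar>a - b\<bar> \<le> 2" by linarith
    moreover have "even (a - b)" using that(3,4) by simp
    ultimately have "a = b \<or> a = b + 2 \<or> a = b - 2" by presburger
    then consider "a = b" | "a = b + 2" | "a = b - 2" by blast
    then show ?thesis
    proof cases
      case 1 then show ?thesis by (intro exI[of _ "a + 1"]) simp
    next
      case 2 then show ?thesis by (intro exI[of _ "b + 1"]) simp
    next
      case 3 then show ?thesis by (intro exI[of _ "b - 1"]) simp
    qed
  qed
  have odds: "odd i" "odd j" "odd i'" "odd j'" using assms(1,2) unfolding W1_def ij by simp_all
  obtain k where k: "\<bar>k - i\<bar> = 1" "\<bar>k - i'\<bar> = 1" using *[OF r(1,3) odds(1,3)] by blast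
  obtain l where l: "\<bar>l - j\<bar> = 1" "\<bar>l - j'\<bar> = 1" using *[OF r(2,4) odds(2,4)] by blast
  have **: "m = a + 1 \<or> m = a - 1" if "\<bar>m - a\<bar> = 1" for m a :: int using that by linarith
  have "(k, l) \<in> {c + (1, 1), c + (1, -1), c + (-1, 1), c + (-1, -1)}"
    using **[OF k(1)] **[OF l(1)] unfolding ij by auto
  moreover have "(k, l) \<in> {c' + (1, 1), c' + (1, -1), c' + (-1, 1), c' + (-1, -1)}"
    using **[OF k(2)] **[OF l(2)] unfolding ij by auto
  ultimately show ?thesis using that by blast
qed

text \<open>A face has all of its corners in \<open>X\<close> or none, since one can walk round it.
  Faces of the two kinds share no corner, so their unions are disjoint closed sets covering a
  connected set, and one of them is empty.\<close>

lemma corners_connected: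
  assumes F: "F \<subseteq> W1" "finite F" and conn: "connected (\<Union>c\<in>F. face_square c)"
    and X: "X \<subseteq> corners F" "X \<noteq> {}"
    and step: "\<And>x d. x \<in> X \<Longrightarrow> d \<in> dirs \<Longrightarrow> x + d \<in> midpoints F \<Longrightarrow> x + d + d \<in> X"
  shows "X = corners F"
proof -
  let ?K = "\<lambda>c :: pt. {c + (1, 1), c + (1, -1), c + (-1, 1), c + (-1, -1)}"
  define F1 where "F1 = {c \<in> F. c + (1, 1) \<in> X}"
  define F2 where "F2 = F - F1"
  define U1 where "U1 = (\<Union>c\<in>F1. face_square c)"
  define U2 where "U2 = (\<Union>c\<in>F2. face_square c)"
  have ring: "l \<in> X" if "c \<in> F" "k \<in> ?K c" "k \<in> X" "l \<in> ?K c" for c k l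
    using corner_ring_closed[OF that(1) step that(2-4)] by blast
  have fin: "finite F1" "finite F2" using F(2) unfolding F1_def F2_def by auto
  have closed: "closed U1" "closed U2" unfolding U1_def U2_def face_square_def
    by (intro closed_UN fin ballI closed_cbox)+
  have cover: "(\<Union>c\<in>F. face_square c) = U1 \<union> U2" unfolding U1_def U2_def F2_def F1_def by blast
  have disj: "U1 \<inter> U2 = {}"
  proof (rule ccontr)
    assume "U1 \<inter> U2 \<noteq> {}"
    then obtain q c c' where c: "c \<in> F1" "c' \<in> F2" "q \<in> face_square c" "q \<in> face_square c'"
      unfolding U1_def U2_def by blast
    have cF: "c \<in> F" "c' \<in> F" using c(1,2) unfolding F1_def F2_def by blast+
    then obtain k where k: "k \<in> ?K c" "k \<in> ?K c'"
      using face_squares_share_corner[OF _ _ c(3,4)] F(1) by blast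
    have "c + (1, 1) \<in> X" using c(1) unfolding F1_def by blast
    then have "k \<in> X" using ring[OF cF(1) _ _ k(1)] by blast
    then have "c' + (1, 1) \<in> X" using ring[OF cF(2) k(2)] by blast
    then show False using c(2) cF(2) unfolding F2_def F1_def by blast
  qed
  obtain x c where x: "x \<in> X" "c \<in> F" "x \<in> ?K c" using X corners_iff[of _ F] by blast
  then have cF1: "c \<in> F1" unfolding F1_def using ring[OF x(2,3,1)] by blast
  have center: "to_plane c \<in> face_square c" for c
    unfolding to_plane_def in_face_square by simp
  have "F2 = {}"
  proof (rule ccontr)
    assume "F2 \<noteq> {}"
    then obtain c' where "c' \<in> F2" by blast
    then have "U2 \<noteq> {}" "U1 \<noteq> {}" using center cF1 unfolding U1_def U2_def by blast+
    then show False using conn closed disj unfolding cover connected_closed by blast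
  qed
  then have all: "c + (1, 1) \<in> X" if "c \<in> F" for c using that unfolding F2_def F1_def by blast
  have "corners F \<subseteq> X"
  proof
    fix y assume "y \<in> corners F"
    then obtain c where c: "c \<in> F" "y \<in> ?K c" using corners_iff by blast
    then show "y \<in> X" using ring[OF c(1) _ all[OF c(1)] c(2)] by blast
  qed
  then show ?thesis using X(1) by blast
qed

section \<open>The graph around a face region\<close>

declare split_paired_All [simp del] split_paired_Ex [simp del]

section \<open>Paths on a sublattice and chains modulo 2\<close>

definition tconn :: "pt set \<Rightarrow> pt \<Rightarrow> pt \<Rightarrow> bool" where
  "tconn T x y \<longleftrightarrow> (\<exists>d\<in>dirs. x + d \<in> T \<and> y = x + d + d)"

lemma tconn_sym: "tconn T x y \<Longrightarrow> tconn T y x"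
proof -
  assume "tconn T x y"
  then obtain d where d: "d \<in> dirs" "x + d \<in> T" "y = x + d + d" unfolding tconn_def by blast
  have "y + (- d) = x + d" "y + (- d) + (- d) = x" unfolding d(3) by simp_all
  then show ?thesis using d uminus_dirs[OF d(1)] unfolding tconn_def by metis
qed

text \<open>Symmetric difference adds edges modulo 2: edges used twice by a walk cancel, and only
  its two ends can stay odd.\<close>

lemma chain_exists:
  assumes "(tconn T)\<^sup>*\<^sup>* x y" "lat a x"
  shows "\<exists>C\<subseteq>T. finite C \<and> (\<forall>q. lat a q \<longrightarrow> odd_at C q = ((q = x) \<noteq> (q = y)))"
proof -
  have "lat a y \<and> (\<exists>C\<subseteq>T. finite C \<and> (\<forall>q. lat a q \<longrightarrow> odd_at C q = ((q = x) \<noteq> (q = y))))"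
    using assms(1)
  proof (induction rule: rtranclp_induct)
    case base
    have "\<not> odd_at {} q" for q unfolding odd_at_def by simp
    then show ?case using assms(2) by (intro conjI exI[of _ "{}"]) simp_all
  next
    case (step y z)
    then obtain C where C: "C \<subseteq> T" "finite C" "\<And>q. lat a q \<Longrightarrow> odd_at C q = ((q = x) \<noteq> (q = y))"
      and ly: "lat a y" by blast
    obtain d where d: "d \<in> dirs" "y + d \<in> T" "z = y + d + d" using step.hyps unfolding tconn_def by blast
    have "odd_at (sym_diff C {y + d}) q = ((q = x) \<noteq> (q = z))" if "lat a q" for q
      unfolding odd_at_sym_diff C(3)[OF that] odd_at_single[OF ly d(1) that] d(3) by argo
    moreover have "sym_diff C {y + d} \<subseteq> T" "finite (sym_diff C {y + d})" using C d by auto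
    ultimately have "\<exists>C\<subseteq>T. finite C \<and> (\<forall>q. lat a q \<longrightarrow> odd_at C q = ((q = x) \<noteq> (q = z)))" by blast
    moreover have "lat a z" using ly unfolding d(3) by simp
    ultimately show ?case by blast
  qed
  then show ?thesis by blast
qed

text \<open>The chains from both ends to \<open>w\<close>, together with the edge itself, have no
  boundary. The edge does not cancel because it is not in \<open>T\<close>.\<close>

lemma cycle_through_edge:
  assumes c: "(tconn T)\<^sup>*\<^sup>* z w" "(tconn T)\<^sup>*\<^sup>* (z + e + e) w" and z: "lat a z" "e \<in> dirs" "z + e \<notin> T"
  obtains C D where "C \<subseteq> insert (z + e) T" "z + e \<in> C" "fills a C D"
proof -
  obtain A where A: "A \<subseteq> T" "finite A" "\<And>q. lat a q \<Longrightarrow> odd_at A q = ((q = z) \<noteq> (q = w))"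
    using chain_exists[OF c(1) z(1)] by blast
  have l: "lat a (z + e + e)" using z(1) by simp
  obtain B where B: "B \<subseteq> T" "finite B" "\<And>q. lat a q \<Longrightarrow> odd_at B q = ((q = z + e + e) \<noteq> (q = w))"
    using chain_exists[OF c(2) l] by blast
  define C where "C = sym_diff (sym_diff A B) {z + e}"
  have "\<not> odd_at C q" if "lat a q" for q
    unfolding C_def odd_at_sym_diff A(3)[OF that] B(3)[OF that] odd_at_single[OF z(1,2) that] by argo
  moreover have "finite C" unfolding C_def using A B by simp
  ultimately obtain D where "fills a C D" using fills_exists by blast
  moreover have "C \<subseteq> insert (z + e) T" "z + e \<in> C" unfolding C_def using A(1) B(1) z(3) by blast+
  ultimately show ?thesis using that by blast
qed

lemma gamma_adj_step: "d \<in> dirs \<Longrightarrow> gamma_adj z (z + d)"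
  by (elim dirs_cases) (simp_all add: gamma_adj_def)

lemma gamma_adj_sym: "gamma_adj x y \<Longrightarrow> gamma_adj y x"
  unfolding gamma_adj_def diag_adj_def by (auto simp: abs_minus_commute)

lemma gamma_adj_black: 
  assumes "gamma_adj x y" "black x \<or> black y"
  obtains d where "d \<in> dirs" "y = x + d"
  using assms(1)
proof (cases rule: gamma_cases)
  case (2 b)
  then show ?thesis using assms(2) lat_not_black by blast
qed (use that in blast)

section \<open>Regions of faces for which the graph is normal\<close>

locale face_region =
  fixes F :: "pt set" and fs :: pt
  assumes finF: "finite F" and FW1: "F \<subseteq> W1" and sc_faces: "simply_connected (\<Union>c\<in>F. face_square c)"
    and fsW1: "fs \<in> W1" and fs_notin: "fs \<notin> F"
    and G_normal: "normal (corners F \<union> insert fs F \<union> midpoints F)"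
begin

abbreviation "V \<equiv> corners F"
abbreviation "E \<equiv> midpoints F"
abbreviation "G \<equiv> corners F \<union> insert fs F \<union> midpoints F"

lemma finG: "finite G"
  using G_normal unfolding normal_def by (rule conjunct1)

lemma connG: "connected_on gamma_adj (- G)"
  using G_normal unfolding normal_def by (rule conjunct2[THEN conjunct2])

lemma finV: "finite V" and finE: "finite E"
  using finG by simp_all

lemma lat_W1: "z \<in> W1 \<longleftrightarrow> lat True z"
  unfolding W1_def lat_def by simp

lemma F_lat: "z \<in> insert fs F \<Longrightarrow> lat True z"
  using FW1 fsW1 lat_W1 by blast

lemma V_lat: "x \<in> V \<Longrightarrow> lat False x"
proof -
  assume "x \<in> V"
  then obtain c where c: "c \<in> F" "x \<in> {c + (1, 1), c + (1, -1), c + (-1, 1), c + (-1, -1)}"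
    using corners_iff by blast
  have "lat True c" using c F_lat by blast
  from near_lat_diffD(2)[OF this c(2)] show "lat False x" by simp
qed

lemma E_black: "m \<in> E \<Longrightarrow> black m"
  using midpoints_iff F_lat black_step by (metis insertCI)

lemma G_True: "z \<in> G \<Longrightarrow> lat True z \<Longrightarrow> z \<in> insert fs F"
  using V_lat E_black lat_disj[of True z False] lat_not_black by blast

lemma G_False: "z \<in> G \<Longrightarrow> lat False z \<Longrightarrow> z \<in> V"
  using F_lat E_black lat_disj[of True z False] lat_not_black by blast

lemma G_black: "z \<in> G \<Longrightarrow> black z \<Longrightarrow> z \<in> E"
  using F_lat V_lat lat_not_black by blast

lemma face_mid: "c \<in> F \<Longrightarrow> d \<in> dirs \<Longrightarrow> c + d \<in> E"
  using midpoints_iff by blast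

lemma mid_end:
  assumes "x + d \<in> E" "lat False x" "d \<in> dirs"
  shows "x \<in> V"
proof -
  obtain c e where c: "c \<in> F" "e \<in> dirs" "x + d = c + e" using assms(1) midpoints_iff by blast
  have l: "lat True c" using c F_lat by blast
  have "near c x" using black_sides[OF assms(2,3) _ c(2,3)] l by simp
  then have "x \<in> {c + (1, 1), c + (1, -1), c + (-1, 1), c + (-1, -1)}"
    using near_lat_diff[of c x True] l assms(2) by simp
  then show ?thesis using c(1) corners_iff by blast
qed

lemma mid_end2:
  assumes "x + d \<in> E" "lat False x" "d \<in> dirs"
  shows "x + d + d \<in> V"
proof (rule mid_end[OF _ _ uminus_dirs[OF assms(3)]])
  show "x + d + d + (- d) \<in> E" using assms(1) by simp
qed (use assms(2) in simp)

lemma mid_side: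
  assumes "f + d \<in> E" "lat True f" "d \<in> dirs"
  shows "f \<in> F \<or> f + d + d \<in> F"
proof -
  obtain c e where c: "c \<in> F" "e \<in> dirs" "f + d = c + e" using assms(1) midpoints_iff by blast
  have "lat True c" using c F_lat by blast
  from black_ends[OF assms(2,3) this c(2,3)] show ?thesis using c(1) by metis
qed

lemma fs_side: "d \<in> dirs \<Longrightarrow> fs + d \<in> E \<longleftrightarrow> fs + d + d \<in> F"
proof
  assume d: "d \<in> dirs" "fs + d \<in> E"
  then show "fs + d + d \<in> F" using mid_side[of fs d] F_lat fs_notin by blast
next
  assume d: "d \<in> dirs" "fs + d + d \<in> F"
  have "fs + d + d + (- d) \<in> E" using face_mid[OF d(2) uminus_dirs[OF d(1)]] .
  then show "fs + d \<in> E" by simp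
qed

text \<open>Here \<open>fs\<close> is the exceptional face of \<open>outside\<close>. A side of the
  square around \<open>fs\<close> may be missing from \<open>G\<close>, so that a point outside
  \<open>G\<close> can be near both faces beside it; all other edges of \<open>C\<close> belong to
  \<open>E\<close> and have their ends in \<open>G\<close>.\<close>

lemma outside_faces:
  assumes C: "C \<subseteq> E \<union> {fs + d |d. d \<in> dirs}" and D: "fills False C D" and f: "f \<in> D" "f \<noteq> fs"
  shows "f \<in> F"
proof (rule ccontr)
  assume nF: "f \<notin> F"
  have l: "lat (\<not> False) f" using D f(1) unfolding fills_def by blast
  then have "lat True f" by simp
  then have fG: "f \<notin> G" using G_True[of f] nF f(2) by blast
  have "f \<notin> D"
  proof (rule outside[OF finG connG D _ _ fG l near_refl f(2)])
    show "fs \<in> G \<or> lat False fs" by simp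
    fix q f d assume q: "q \<notin> G" and fd: "lat (\<not> False) f" "d \<in> dirs" "near q f" "near q (f + d + d)"
      "f \<noteq> fs" "f + d + d \<noteq> fs"
    show "f + d \<notin> C"
    proof
      assume "f + d \<in> C"
      then consider "f + d \<in> E" | e where "e \<in> dirs" "f + d = fs + e" using C by blast
      then show False
      proof cases
        case 1
        obtain z e where z: "lat (\<not> True) z" "e \<in> dirs" "f + d = z + e"
          using edge_two_sides[of True f d] fd(1,2) by (metis (full_types))
        have zl: "lat False z" using z(1) by simp
        have zE: "z + e \<in> E" using 1 z(3) by simp
        have "q = z \<or> q = z + e \<or> q = z + e + e"
          using near_edge[OF zl z(2) fd(1,2) z(3)[symmetric] fd(3,4)] .
        moreover have "z \<in> V" "z + e + e \<in> V" using mid_end[OF zE zl z(2)] mid_end2[OF zE zl z(2)] by blast+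
        ultimately show False using q zE by blast
      next
        case 2
        have "lat True fs" using F_lat by blast
        then have "fs = f \<and> e = d \<or> fs = f + d + d \<and> e = - d"
          using black_ends[of True f d fs e] fd(1,2) 2 by simp
        then show False using fd(5,6) by metis
      qed
    qed
  qed
  then show False using f(1) by blast
qed

text \<open>Only \<open>fs\<close> has to be excluded. One of its sides leads to a face outside
  \<open>F\<close> and is not in \<open>E\<close>, hence not crossed by \<open>C\<close>; if
  \<open>fs\<close> were enclosed, that face would be too.\<close>

lemma fills_in_F:
  assumes C: "C \<subseteq> E" and D: "fills False C D"
  shows "D \<subseteq> F"
proof
  fix f assume f: "f \<in> D"
  have of: "g \<in> F" if "g \<in> D" "g \<noteq> fs" for g
    using outside_faces[OF _ D that] C by blast
  show "f \<in> F"
  proof (cases "f = fs")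
    case True
    obtain d where d: "d \<in> dirs" "fs + d + d \<notin> F" using not_all_sides[OF FW1 sc_faces fsW1 fs_notin] by blast
    then have "fs + d \<notin> C" using C fs_side by blast
    moreover have "lat (\<not> False) fs" using F_lat by simp
    ultimately have "fs + d + d \<in> D" using D d(1) f True unfolding fills_def by blast
    then show ?thesis using of step_ne[OF d(1)] d(2) by metis
  qed (use of f in blast)
qed

lemma V_connected: "x \<in> V \<Longrightarrow> y \<in> V \<Longrightarrow> (tconn E)\<^sup>*\<^sup>* x y"
proof -
  assume x: "x \<in> V" and y: "y \<in> V"
  define X where "X = {y. (tconn E)\<^sup>*\<^sup>* x y}"
  have XV: "z \<in> V" if "(tconn E)\<^sup>*\<^sup>* x z" for z
    using that
  proof (induction rule: rtranclp_induct)
    case (step y z)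
    then obtain d where d: "d \<in> dirs" "y + d \<in> E" "z = y + d + d" unfolding tconn_def by blast
    show ?case using mid_end2[OF d(2) V_lat[OF step.IH] d(1)] d(3) by simp
  qed (rule x)
  have "X = V"
  proof (rule corners_connected[OF FW1 finF simply_connected_imp_connected[OF sc_faces]])
    show "X \<subseteq> V" using XV unfolding X_def by blast
    show "X \<noteq> {}" unfolding X_def by blast
    fix z d assume z: "z \<in> X" "d \<in> dirs" "z + d \<in> E"
    then have "tconn E z (z + d + d)" unfolding tconn_def by blast
    moreover have "(tconn E)\<^sup>*\<^sup>* x z" using z(1) unfolding X_def by simp
    ultimately have "(tconn E)\<^sup>*\<^sup>* x (z + d + d)" by (rule rtranclp.rtrancl_into_rtrancl[rotated])
    then show "z + d + d \<in> X" unfolding X_def by simp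
  qed
  then show ?thesis using y unfolding X_def by blast
qed

text \<open>A chain of edges of \<open>H\<close> from \<open>x\<close> to \<open>y\<close> closes
  \<open>B\<close> to a cycle. Behind a side of \<open>fs\<close> that is missing from
  \<open>E\<close> there is a face that is not enclosed, so such a side belongs to \<open>B\<close>
  iff \<open>fs\<close> is enclosed, and this does not depend on the side.\<close>

lemma ring_sides:
  assumes B: "B \<subseteq> {fs + d |d. d \<in> dirs}" "finite B"
    and xy: "x \<in> V" "y \<in> V" and odd: "\<And>q. lat False q \<Longrightarrow> odd_at B q = ((q = x) \<noteq> (q = y))"
    and d: "d \<in> dirs" "fs + d \<notin> E" and e: "e \<in> dirs" "fs + e \<notin> E"
  shows "fs + d \<in> B \<longleftrightarrow> fs + e \<in> B"
proof -
  obtain A where A: "A \<subseteq> E" "finite A" "\<And>q. lat False q \<Longrightarrow> odd_at A q = ((q = x) \<noteq> (q = y))"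
    using chain_exists[OF V_connected[OF xy] V_lat[OF xy(1)]] by blast
  define C where "C = sym_diff A B"
  have "\<not> odd_at C q" if "lat False q" for q
    unfolding C_def odd_at_sym_diff A(3)[OF that] odd[OF that] by argo
  moreover have "finite C" unfolding C_def using A(2) B(2) by simp
  ultimately obtain D where D: "fills False C D" using fills_exists by blast
  have CE: "C \<subseteq> E \<union> {fs + d |d. d \<in> dirs}" unfolding C_def using A(1) B(1) by blast
  have "fs \<in> D \<longleftrightarrow> fs + c \<in> B" if c: "c \<in> dirs" "fs + c \<notin> E" for c
  proof -
    have "fs + c + c \<notin> D" using outside_faces[OF CE D, of "fs + c + c"] fs_side[OF c(1)] c(2) step_ne[OF c(1)] by blast
    moreover have "fs + c \<in> C \<longleftrightarrow> fs + c \<in> B" unfolding C_def using A(1) c(2) by blast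
    moreover have "lat (\<not> False) fs" using F_lat by simp
    ultimately show ?thesis using D c(1) unfolding fills_def by blast
  qed
  then show ?thesis using d e by blast
qed

lemma card_filter4:
  assumes "distinct [a, b, c, d]"
  shows "card {x \<in> {a, b, c, d}. P x} = of_bool (P a) + of_bool (P b) + of_bool (P c) + of_bool (P d)"
proof -
  have "real (card {x \<in> {a, b, c, d}. P x}) = (\<Sum>x\<in>{a, b, c, d}. of_bool (P x))"
    by (rule sum_of_bool_filter[symmetric]) simp
  also have "\<dots> = real (of_bool (P a) + of_bool (P b) + of_bool (P c) + of_bool (P d))"
    using assms by simp
  finally have "real (card {x \<in> {a, b, c, d}. P x}) = real (of_bool (P a) + of_bool (P b) + of_bool (P c) + of_bool (P d))" .
  then show ?thesis by (simp only: of_nat_eq_iff)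
qed

text \<open>Let \<open>b0\<close>, \<open>b1\<close>, \<open>b2\<close>, \<open>b3\<close> stand for
  the corners of a square in cyclic order and \<open>a0\<close>, \<open>a1\<close>,
  \<open>a2\<close>, \<open>a3\<close> for its sides, where \<open>a0\<close> joins
  \<open>b3\<close> to \<open>b0\<close> and \<open>a1\<close> joins \<open>b0\<close> to
  \<open>b1\<close>. The hypotheses say that the part which is present is connected, nonempty and
  not the whole boundary. So it is a path, with one more corner than sides.\<close>

lemma ring_count_bool:
  "(a0 \<longrightarrow> b0 \<and> b3) \<and> (a1 \<longrightarrow> b0 \<and> b1) \<and> (a2 \<longrightarrow> b1 \<and> b2) \<and> (a3 \<longrightarrow> b2 \<and> b3) \<Longrightarrow>
    (b1 \<and> b0 \<and> \<not> a1 \<longrightarrow> a0 \<and> a2 \<and> a3) \<and> (b3 \<and> b0 \<and> \<not> a0 \<longrightarrow> a1 \<and> a2 \<and> a3) \<Longrightarrow>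
    (b2 \<and> b1 \<and> \<not> a2 \<longrightarrow> a1 \<and> a0 \<and> a3) \<and> (b2 \<and> b3 \<and> \<not> a3 \<longrightarrow> a1 \<and> a2 \<and> a0) \<Longrightarrow>
    (b2 \<and> b0 \<longrightarrow> a1 \<and> a2 \<or> a0 \<and> a3) \<and> (b3 \<and> b1 \<longrightarrow> a2 \<and> a3 \<or> a0 \<and> a1) \<Longrightarrow>
   b0 \<or> b1 \<or> b2 \<or> b3 \<Longrightarrow> \<not> (a0 \<and> a1 \<and> a2 \<and> a3) \<Longrightarrow>
   of_bool b0 + of_bool b1 + of_bool b2 + of_bool b3
    = of_bool a0 + of_bool a1 + of_bool a2 + of_bool a3 + (1 :: nat)"
  by (cases a0; cases a1; cases a2; cases a3; simp only: simp_thms of_bool_eq if_True if_False; cases b0; cases b1; cases b2; cases b3; simp)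

lemma ring_count:
  assumes "a0 \<Longrightarrow> b0 \<and> b3" "a1 \<Longrightarrow> b0 \<and> b1" "a2 \<Longrightarrow> b1 \<and> b2" "a3 \<Longrightarrow> b2 \<and> b3"
    and "b1 \<Longrightarrow> b0 \<Longrightarrow> \<not> a1 \<Longrightarrow> a0 \<and> a2 \<and> a3" "b3 \<Longrightarrow> b0 \<Longrightarrow> \<not> a0 \<Longrightarrow> a1 \<and> a2 \<and> a3"
    and "b2 \<Longrightarrow> b1 \<Longrightarrow> \<not> a2 \<Longrightarrow> a1 \<and> a0 \<and> a3" "b2 \<Longrightarrow> b3 \<Longrightarrow> \<not> a3 \<Longrightarrow> a1 \<and> a2 \<and> a0"
    and "b2 \<Longrightarrow> b0 \<Longrightarrow> a1 \<and> a2 \<or> a0 \<and> a3" "b3 \<Longrightarrow> b1 \<Longrightarrow> a2 \<and> a3 \<or> a0 \<and> a1"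
    and "b0 \<or> b1 \<or> b2 \<or> b3" "\<not> (a0 \<and> a1 \<and> a2 \<and> a3)"
  shows "of_bool b0 + of_bool b1 + of_bool b2 + of_bool b3
    = of_bool a0 + of_bool a1 + of_bool a2 + of_bool a3 + (1 :: nat)"
proof -
  have *: "(a0 \<longrightarrow> b0 \<and> b3) \<and> (a1 \<longrightarrow> b0 \<and> b1) \<and> (a2 \<longrightarrow> b1 \<and> b2) \<and> (a3 \<longrightarrow> b2 \<and> b3)"
    "(b1 \<and> b0 \<and> \<not> a1 \<longrightarrow> a0 \<and> a2 \<and> a3) \<and> (b3 \<and> b0 \<and> \<not> a0 \<longrightarrow> a1 \<and> a2 \<and> a3)"
    "(b2 \<and> b1 \<and> \<not> a2 \<longrightarrow> a1 \<and> a0 \<and> a3) \<and> (b2 \<and> b3 \<and> \<not> a3 \<longrightarrow> a1 \<and> a2 \<and> a0)"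
    "(b2 \<and> b0 \<longrightarrow> a1 \<and> a2 \<or> a0 \<and> a3) \<and> (b3 \<and> b1 \<longrightarrow> a2 \<and> a3 \<or> a0 \<and> a1)"
    using assms(1-10) by blast+
  show ?thesis by (rule ring_count_bool[OF * assms(11,12)])
qed

lemma card_fs_corners:
  assumes k: "k \<in> V" "diag_adj fs k"
  shows "card {w \<in> V. diag_adj fs w} = dstar F fs + 1"
proof -
  obtain i j where ij: "fs = (i, j)" by fastforce
  have par: "odd i" "odd j" using fsW1 unfolding W1_def ij by simp_all
  \<comment> \<open>Both numberings run counterclockwise; \<open>s0\<close> is the right side and
    joins \<open>k3\<close> to \<open>k0\<close>.\<close>
  define k0 k1 k2 k3 :: pt where k: "k0 = (i + 1, j + 1)" "k1 = (i - 1, j + 1)" "k2 = (i - 1, j - 1)" "k3 = (i + 1, j - 1)"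
  define s0 s1 s2 s3 :: pt where s: "s0 = (i + 1, j)" "s1 = (i, j + 1)" "s2 = (i - 1, j)" "s3 = (i, j - 1)"
  have kl: "lat False k0" "lat False k1" "lat False k2" "lat False k3" using par by (simp_all add: k lat_def)
  have sd: "s0 = fs + (1, 0)" "s1 = fs + (0, 1)" "s2 = fs + (-1, 0)" "s3 = fs + (0, -1)" by (simp_all add: s ij)
  have diag: "diag_adj fs w \<longleftrightarrow> w \<in> {k0, k1, k2, k3}" for w
  proof -
    obtain w1 w2 where w: "w = (w1, w2)" by fastforce
    have "\<bar>i - w1\<bar> = 1 \<longleftrightarrow> w1 = i + 1 \<or> w1 = i - 1" "\<bar>j - w2\<bar> = 1 \<longleftrightarrow> w2 = j + 1 \<or> w2 = j - 1" by arith+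
    then show ?thesis unfolding diag_adj_def white_def w ij k using par by auto
  qed
  have sk: "s0 \<in> E \<Longrightarrow> k0 \<in> V \<and> k3 \<in> V" "s1 \<in> E \<Longrightarrow> k0 \<in> V \<and> k1 \<in> V"
    "s2 \<in> E \<Longrightarrow> k1 \<in> V \<and> k2 \<in> V" "s3 \<in> E \<Longrightarrow> k2 \<in> V \<and> k3 \<in> V"
    using mid_end[OF _ kl(4) axis_dirs(3)] mid_end2[OF _ kl(4) axis_dirs(3)]
      mid_end[OF _ kl(2) axis_dirs(1)] mid_end2[OF _ kl(2) axis_dirs(1)]
      mid_end[OF _ kl(3) axis_dirs(3)] mid_end2[OF _ kl(3) axis_dirs(3)]
      mid_end[OF _ kl(3) axis_dirs(1)] mid_end2[OF _ kl(3) axis_dirs(1)]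
    unfolding k s by simp_all
  have o1: "odd_at {s0} q = ((q = k3) \<noteq> (q = k0))" "odd_at {s1} q = ((q = k1) \<noteq> (q = k0))"
    "odd_at {s2} q = ((q = k2) \<noteq> (q = k1))" "odd_at {s3} q = ((q = k2) \<noteq> (q = k3))" if "lat False q" for q
    using odd_at_single[OF kl(4) axis_dirs(3) that] odd_at_single[OF kl(2) axis_dirs(1) that]
      odd_at_single[OF kl(3) axis_dirs(3) that] odd_at_single[OF kl(3) axis_dirs(1) that]
    unfolding k s by simp_all
  have ne: "distinct [s0, s1, s2, s3]" "distinct [k0, k1, k2, k3]" unfolding s k by simp_all
  have sy12: "sym_diff {s1} {s2} = {s1, s2}" "sym_diff {s2} {s3} = {s2, s3}" using ne(1) by auto
  have o2: "odd_at {s1, s2} q = ((q = k2) \<noteq> (q = k0))" "odd_at {s2, s3} q = ((q = k3) \<noteq> (q = k1))" if "lat False q" for q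
    using odd_at_sym_diff[of "{s1}" "{s2}" q] odd_at_sym_diff[of "{s2}" "{s3}" q] o1[OF that] unfolding sy12 by argo+
  have ring: "s \<in> B \<longleftrightarrow> t \<in> B" if h: "B \<subseteq> {s0, s1, s2, s3}" "x \<in> V" "y \<in> V"
    "\<And>q. lat False q \<Longrightarrow> odd_at B q = ((q = x) \<noteq> (q = y))" "s \<in> {s0, s1, s2, s3}" "t \<in> {s0, s1, s2, s3}"
    "s \<notin> E" "t \<notin> E" for B x y s t
  proof -
    have "fs + d \<in> {fs + d |d. d \<in> dirs}" if "d \<in> dirs" for d using that by blast
    then have sub: "{s0, s1, s2, s3} \<subseteq> {fs + d |d. d \<in> dirs}"
      unfolding sd by (simp only: insert_subset empty_subsetI axis_dirs simp_thms)
    obtain d where d: "d \<in> dirs" "s = fs + d" using sub h(5) by blast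
    obtain e where e: "e \<in> dirs" "t = fs + e" using sub h(6) by blast
    have "finite B" by (rule finite_subset[OF h(1)]) simp
    moreover have "B \<subseteq> {fs + d |d. d \<in> dirs}" using sub h(1) by (rule subset_trans[rotated])
    ultimately show ?thesis using ring_sides[of B x y d e] h(2-4,7,8) d e by simp
  qed
  \<comment> \<open>For \<open>B = {s}\<close> two missing sides would have to agree about
    membership in \<open>B\<close>, so \<open>s\<close> is the only missing side.\<close>
  have single: "t \<in> E" if h: "x \<in> V" "y \<in> V" "s \<notin> E" "\<And>q. lat False q \<Longrightarrow> odd_at {s} q = ((q = x) \<noteq> (q = y))"
    "s \<in> {s0, s1, s2, s3}" "t \<in> {s0, s1, s2, s3}" "t \<noteq> s" for x y s t
  proof (rule ccontr)
    assume "t \<notin> E"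
    have "{s} \<subseteq> {s0, s1, s2, s3}" using h(5) by simp
    from ring[OF this h(1,2,4,5,6,3) \<open>t \<notin> E\<close>] show False using h(7) by simp
  qed
  have mem: "s0 \<in> {s0, s1, s2, s3}" "s1 \<in> {s0, s1, s2, s3}" "s2 \<in> {s0, s1, s2, s3}" "s3 \<in> {s0, s1, s2, s3}"
    by simp_all
  have nes: "s1 \<noteq> s0" "s2 \<noteq> s0" "s3 \<noteq> s0" "s2 \<noteq> s1" "s3 \<noteq> s1" "s3 \<noteq> s2" using ne(1) by auto
  have r: "k1 \<in> V \<Longrightarrow> k0 \<in> V \<Longrightarrow> s1 \<notin> E \<Longrightarrow> s0 \<in> E \<and> s2 \<in> E \<and> s3 \<in> E"
    "k3 \<in> V \<Longrightarrow> k0 \<in> V \<Longrightarrow> s0 \<notin> E \<Longrightarrow> s1 \<in> E \<and> s2 \<in> E \<and> s3 \<in> E"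
    "k2 \<in> V \<Longrightarrow> k1 \<in> V \<Longrightarrow> s2 \<notin> E \<Longrightarrow> s1 \<in> E \<and> s0 \<in> E \<and> s3 \<in> E"
    "k2 \<in> V \<Longrightarrow> k3 \<in> V \<Longrightarrow> s3 \<notin> E \<Longrightarrow> s1 \<in> E \<and> s2 \<in> E \<and> s0 \<in> E"
    by (intro conjI; erule (2) single; (rule o1 mem nes nes[symmetric] | assumption)+)+
  have sub2: "{s1, s2} \<subseteq> {s0, s1, s2, s3}" "{s2, s3} \<subseteq> {s0, s1, s2, s3}" by simp_all
  \<comment> \<open>\<open>s1\<close> and \<open>s2\<close> form one arc from \<open>k2\<close> to
    \<open>k0\<close>. If the other arc had a missing side as well, the two missing sides would
    disagree about \<open>B\<close>.\<close>
  have r2: "k2 \<in> V \<Longrightarrow> k0 \<in> V \<Longrightarrow> s1 \<in> E \<and> s2 \<in> E \<or> s0 \<in> E \<and> s3 \<in> E"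
  proof (rule ccontr)
    assume h: "k2 \<in> V" "k0 \<in> V" "\<not> (s1 \<in> E \<and> s2 \<in> E \<or> s0 \<in> E \<and> s3 \<in> E)"
    have in12: "s1 \<in> {s1, s2}" "s2 \<in> {s1, s2}" "s0 \<notin> {s1, s2}" "s3 \<notin> {s1, s2}" using nes by auto
    show False using h(3) ring[OF sub2(1) h(1,2) o2(1)] in12 mem by metis
  qed
  have r3: "k3 \<in> V \<Longrightarrow> k1 \<in> V \<Longrightarrow> s2 \<in> E \<and> s3 \<in> E \<or> s0 \<in> E \<and> s1 \<in> E"
  proof (rule ccontr)
    assume h: "k3 \<in> V" "k1 \<in> V" "\<not> (s2 \<in> E \<and> s3 \<in> E \<or> s0 \<in> E \<and> s1 \<in> E)"
    have in23: "s2 \<in> {s2, s3}" "s3 \<in> {s2, s3}" "s0 \<notin> {s2, s3}" "s1 \<notin> {s2, s3}" using nes by auto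
    show False using h(3) ring[OF sub2(2) h(1,2) o2(2)] in23 mem by metis
  qed
  have some: "k0 \<in> V \<or> k1 \<in> V \<or> k2 \<in> V \<or> k3 \<in> V" using assms diag[of k] by (metis insert_iff empty_iff)
  have notall: "\<not> (s0 \<in> E \<and> s1 \<in> E \<and> s2 \<in> E \<and> s3 \<in> E)"
    using not_all_sides[OF FW1 sc_faces fsW1 fs_notin] fs_side unfolding sd dirs_def by blast
  have "{w \<in> V. diag_adj fs w} = {w \<in> {k0, k1, k2, k3}. w \<in> V}" using diag by blast
  then have cV: "card {w \<in> V. diag_adj fs w} = of_bool (k0 \<in> V) + of_bool (k1 \<in> V) + of_bool (k2 \<in> V) + of_bool (k3 \<in> V)"
    using card_filter4[OF ne(2)] by simp
  have ss: "fs + (1, 0) + (1, 0) = (i + 2, j)" "fs + (0, 1) + (0, 1) = (i, j + 2)"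
    "fs + (-1, 0) + (-1, 0) = (i - 2, j)" "fs + (0, -1) + (0, -1) = (i, j - 2)"
    unfolding ij by simp_all
  have es: "{u \<in> F. lat2_adj fs u} = {u \<in> {fs + (1, 0) + (1, 0), fs + (0, 1) + (0, 1), fs + (-1, 0) + (-1, 0), fs + (0, -1) + (0, -1)}. u \<in> F}"
  proof -
    have "lat2_adj fs u \<longleftrightarrow> u \<in> {fs + (1, 0) + (1, 0), fs + (0, 1) + (0, 1), fs + (-1, 0) + (-1, 0), fs + (0, -1) + (0, -1)}" for u
    proof -
      obtain u1 u2 where u: "u = (u1, u2)" by fastforce
      have "\<bar>i - u1\<bar> = 2 \<longleftrightarrow> u1 = i + 2 \<or> u1 = i - 2" "\<bar>j - u2\<bar> = 2 \<longleftrightarrow> u2 = j + 2 \<or> u2 = j - 2" by arith+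
      then show ?thesis
        unfolding ss unfolding lat2_adj_def u ij fst_conv snd_conv insert_iff empty_iff prod.inject by blast
    qed
    then show ?thesis by blast
  qed
  have ds: "distinct [fs + (1, 0) + (1, 0), fs + (0, 1) + (0, 1), fs + (-1, 0) + (-1, 0), fs + (0, -1) + (0, -1)]"
    unfolding ij by simp
  have cE: "dstar F fs = of_bool (s0 \<in> E) + of_bool (s1 \<in> E) + of_bool (s2 \<in> E) + of_bool (s3 \<in> E)"
    unfolding dstar_def es card_filter4[OF ds] sd fs_side[OF axis_dirs(1)] fs_side[OF axis_dirs(2)]
      fs_side[OF axis_dirs(3)] fs_side[OF axis_dirs(4)] by (rule refl)
  show ?thesis unfolding cV cE by (rule ring_count[OF sk r r2 r3 some notall])
qed

end

lemma (in face_region) good_conf_facts: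
  assumes v: "v \<in> insert fs F" and g: "g \<in> good_confs F fs v" and z: "z \<in> insert fs F - {v}"
  obtains d where "d \<in> dirs" "dir_step fs v g z = z + d + d" "d = g (if z = fs then v else z)" "z + d \<in> E"
proof -
  define d where "d = g (if z = fs then v else z)"
  have "(if z = fs then v else z) \<in> F" using v z by auto
  moreover have "g \<in> F \<rightarrow>\<^sub>E dirs" using g unfolding good_confs_def by blast
  ultimately have d: "d \<in> dirs" unfolding d_def by (rule PiE_mem[rotated])
  have st: "dir_step fs v g z = z + d + d" unfolding dir_step_def d_def by simp
  have "z + d \<in> E"
  proof (cases "z = fs")
    case True
    then have "v \<noteq> fs" using z by blast
    \<comment> \<open>The path from the neighbour of \<open>fs\<close> ends at \<open>v\<close> in
      \<open>F\<close>, and each of its steps starts in \<open>F\<close>. So this neighbour is a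
      face, which puts the side of \<open>fs\<close> into \<open>E\<close>.\<close>
    then have path: "conf_path F fs v g (dir_step fs v g fs) v" and vF: "v \<in> F"
      using g v unfolding good_confs_def by blast+
    from path have "dir_step fs v g fs \<in> F" unfolding conf_path_def
      by (cases rule: converse_rtranclpE) (simp_all add: vF)
    then show ?thesis using fs_side[OF d] st True by simp
  next
    case False
    then show ?thesis using face_mid[OF _ d] z by blast
  qed
  then show ?thesis using that d st d_def by blast
qed

text \<open>With \<open>fs\<close>, a closed set would contain the whole path to \<open>v\<close>,
  which is excluded. Without \<open>fs\<close>, it would contain a cycle of the
  configuration.\<close>

lemma (in face_region) good_conf_no_closed:
  assumes v: "v \<in> insert fs F" and g: "g \<in> good_confs F fs v"
    and Y: "Y \<subseteq> insert fs F - {v}" "dir_step fs v g ` Y \<subseteq> Y"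
  shows "Y = {}"
proof (rule ccontr)
  assume ne: "Y \<noteq> {}"
  have fsY: "fs \<notin> Y"
  proof
    assume fs: "fs \<in> Y"
    then have "v \<noteq> fs" using Y(1) by blast
    then have path: "conf_path F fs v g (dir_step fs v g fs) v" using g unfolding good_confs_def by blast
    have start: "dir_step fs v g fs \<in> Y" using fs Y(2) by blast
    have "y \<in> Y" if "conf_path F fs v g (dir_step fs v g fs) y" for y
      using that unfolding conf_path_def
    proof (induction rule: rtranclp_induct)
      case (step y z)
      then have "y \<in> Y" "z = dir_step fs v g y" by blast+
      then show ?case using Y(2) by blast
    qed (rule start)
    then show False using path Y(1) by blast
  qed
  have YF: "Y \<subseteq> F - {v}" using Y(1) fsY by blast
  have "finite Y" using finite_subset[OF YF] finF by simp
  from min_closed_exists[OF this ne Y(2)] obtain P where P: "P \<subseteq> Y" "min_closed (dir_step fs v g) P" by blast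
  have "acyclic_conf F fs v g" using g unfolding good_confs_def by blast
  moreover have "P \<subseteq> F - {v}" using P(1) YF by (rule subset_trans)
  ultimately have "P = {}" using min_closed_image[OF P(2)] unfolding acyclic_conf_def by blast
  then show False using P(2) unfolding min_closed_def by blast
qed

lemma card_image_not_inj:
  assumes "finite Y" "x \<in> Y" "y \<in> Y" "x \<noteq> y" "f x = f y"
  shows "card (f ` Y) < card Y"
proof -
  have "\<not> inj_on f Y" using assms(2-5) unfolding inj_on_def by blast
  then have "card (f ` Y) \<noteq> card Y" using eq_card_imp_inj_on[OF assms(1)] by blast
  then show ?thesis using card_image_le[OF assms(1), of f] by simp
qed

text \<open>The edges leaving a connected component meet every face of \<open>F\<close> an even number of times. Since they all
  belong to the configuration, they form a flow that can start only at \<open>fs\<close> and can end only at a face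
  outside \<open>F\<close>; but the path from \<open>fs\<close> ends at \<open>v\<close>.\<close>

lemma (in face_region) unused_edges_connect:
  assumes v: "v \<in> insert fs F" and w: "w \<in> V" and g: "g \<in> good_confs F fs v"
    and \<mu>: "\<And>z. z \<in> insert fs F - {v} \<Longrightarrow> \<mu> z = z + g (if z = fs then v else z)"
    and T: "T = E - \<mu> ` (insert fs F - {v})" and x: "x \<in> V"
  shows "(tconn T)\<^sup>*\<^sup>* w x"
proof (rule ccontr)
  assume nx: "\<not> (tconn T)\<^sup>*\<^sup>* w x"
  let ?S = "dir_step fs v g"
  let ?D = "insert fs F - {v}"
  define X where "X = {y. (tconn T)\<^sup>*\<^sup>* w y}"
  have XV: "y \<in> V" if "y \<in> X" for y
    using that unfolding X_def mem_Collect_eq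
  proof (induction rule: rtranclp_induct)
    case (step y z)
    then obtain d where d: "d \<in> dirs" "y + d \<in> T" "z = y + d + d" unfolding tconn_def by blast
    then have "y + d \<in> E" using T by blast
    then show ?case using mid_end2[OF _ V_lat[OF step.IH] d(1)] d(3) by simp
  qed (rule w)
  have X_lat: "lat False y" if "y \<in> X" for y using V_lat[OF XV[OF that]] .
  have step: "y + d + d \<in> X" if y: "y \<in> X" "d \<in> dirs" "y + d \<in> T" for y d
  proof -
    have "tconn T y (y + d + d)" using y unfolding tconn_def by blast
    moreover have "(tconn T)\<^sup>*\<^sup>* w y" using y unfolding X_def by blast
    ultimately have "(tconn T)\<^sup>*\<^sup>* w (y + d + d)" by (rule rtranclp.rtrancl_into_rtrancl[rotated])
    then show ?thesis unfolding X_def by blast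
  qed
  have cutT: "m \<notin> T" if m: "m \<in> cut X" for m
  proof
    assume mT: "m \<in> T"
    obtain z d where "z \<in> X" "d \<in> dirs" "m = z + d" "z + d + d \<notin> X" using m unfolding cut_def by blast
    then show False using step mT by blast
  qed
  define Y where "Y = {z \<in> ?D. \<mu> z \<in> cut X}"
  have finY: "finite Y" unfolding Y_def using finF by simp
  have owner: "\<exists>z\<in>Y. \<mu> z = m" if "m \<in> cut X" "m \<in> E" for m
    using cutT[OF that(1)] that T unfolding Y_def by blast
  have "\<exists>m. m \<in> cut X \<and> m \<in> E"
  proof (rule ccontr)
    assume no: "\<not> (\<exists>m. m \<in> cut X \<and> m \<in> E)"
    have "X = V"
    proof (rule corners_connected[OF FW1 finF simply_connected_imp_connected[OF sc_faces]])
      show "X \<subseteq> V" using XV by blast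
      show "X \<noteq> {}" unfolding X_def by blast
      fix z d assume "z \<in> X" "d \<in> dirs" "z + d \<in> E"
      then show "z + d + d \<in> X" using no unfolding cut_def by blast
    qed
    then show False using x nx unfolding X_def by blast
  qed
  then have Yne: "Y \<noteq> {}" using owner by blast
  \<comment> \<open>A face on one cut edge is on a second one, by parity. Every cut edge in
    \<open>E\<close> belongs to the configuration, so the second edge is owned by \<open>u\<close>
    itself or by an element stepping to \<open>u\<close>. This yields both predecessors and
    successors in \<open>Y\<close>.\<close>
  have flow: "\<exists>e z. e \<noteq> d \<and> z \<in> Y \<and> \<mu> z = u + e \<and> (z = u \<or> ?S z = u)"
    if u: "u \<in> F" "d \<in> dirs" "u + d \<in> cut X" for u d
  proof -
    have ul: "lat True u" using F_lat u(1) by blast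
    have "\<not> odd_at (cut X) u" by (rule cut_even[of X False]) (use X_lat ul in simp_all)
    then obtain e where e: "e \<in> dirs" "e \<noteq> d" "u + e \<in> cut X" using even_at_another u(2,3) by blast
    obtain z where z: "z \<in> Y" "\<mu> z = u + e" using owner[OF e(3) face_mid[OF u(1) e(1)]] by blast
    have zD: "z \<in> ?D" using z(1) unfolding Y_def by blast
    obtain c where c: "c \<in> dirs" "?S z = z + c + c" "c = g (if z = fs then v else z)"
      using good_conf_facts[OF v g zD] by metis
    have zl: "lat True z" using zD F_lat by blast
    have "z + c = u + e" using \<mu>[OF zD] z(2) c(3) by simp
    from black_ends[OF zl c(1) ul e(1) this] have "z = u \<or> ?S z = u" unfolding c(2) by argo
    then show ?thesis using e(2) z by blast
  qed
  have pred: "\<exists>z'\<in>Y. ?S z' = z" if z: "z \<in> Y" "z \<noteq> fs" for z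
  proof -
    have zD: "z \<in> ?D" "z \<in> F" using z unfolding Y_def by blast+
    obtain c where c: "c \<in> dirs" "c = g (if z = fs then v else z)"
      using good_conf_facts[OF v g zD(1)] by metis
    have \<mu>z: "\<mu> z = z + c" using \<mu>[OF zD(1)] c(2) by simp
    have "z + c \<in> cut X" using z(1) \<mu>z unfolding Y_def by simp
    from flow[OF zD(2) c(1) this] obtain e z' where e: "e \<noteq> c" "z' \<in> Y" "\<mu> z' = z + e" "z' = z \<or> ?S z' = z" by blast
    have "z' \<noteq> z" using e(1,3) \<mu>z by auto
    then show ?thesis using e by blast
  qed
  \<comment> \<open>If \<open>fs\<close> were not in \<open>Y\<close>, every element would have a
    predecessor, and \<open>Y\<close> would be a closed set.\<close>
  have fsY: "fs \<in> Y"
  proof (rule ccontr)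
    assume fs: "fs \<notin> Y"
    have "Y \<subseteq> ?S ` Y"
    proof
      fix z assume z: "z \<in> Y"
      then have "z \<noteq> fs" using fs by blast
      from pred[OF z this] obtain z' where "z' \<in> Y" "?S z' = z" by (rule bexE)
      then show "z \<in> ?S ` Y" by (metis imageI)
    qed
    from surj_image_eq[OF finY this] have "?S ` Y = Y" .
    then have "Y = {}" using good_conf_no_closed[OF v g, of Y] unfolding Y_def by blast
    then show False using Yne by blast
  qed
  then have vfs: "v \<noteq> fs" unfolding Y_def by blast
  \<comment> \<open>Two coinciding steps make the image smaller than \<open>Y\<close>, yet it covers
    all of \<open>Y\<close> except possibly \<open>fs\<close>. So it is exactly
    \<open>Y - {fs}\<close>.\<close>
  have not_inj: "?S ` Y = Y - {fs}" if "z \<in> Y" "z' \<in> Y" "z \<noteq> z'" "?S z = ?S z'" for z z'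
  proof -
    have sub: "Y - {fs} \<subseteq> ?S ` Y"
    proof
      fix y assume "y \<in> Y - {fs}"
      then have "y \<in> Y" "y \<noteq> fs" by simp_all
      from pred[OF this] obtain z' where "z' \<in> Y" "?S z' = y" by (rule bexE)
      then show "y \<in> ?S ` Y" by (metis imageI)
    qed
    have "card (?S ` Y) < card Y" using card_image_not_inj[OF finY] that by blast
    then have "card (?S ` Y) \<le> card (Y - {fs})" using fsY finY by simp
    then show ?thesis using card_seteq[OF finite_imageI[OF finY] sub] by simp
  qed
  \<comment> \<open>If the second cut edge at the face reached by \<open>z\<close> is not owned by
    this face, its owner steps there as \<open>z\<close> does, and \<open>not_inj\<close> places the
    face in \<open>Y\<close> after all.\<close>
  have forward: "?S z \<in> Y" if z: "z \<in> Y" "?S z \<in> F" for z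
  proof -
    have zD: "z \<in> ?D" using z unfolding Y_def by blast
    obtain c where c: "c \<in> dirs" "?S z = z + c + c" "c = g (if z = fs then v else z)"
      using good_conf_facts[OF v g zD] by metis
    have \<mu>z: "\<mu> z = ?S z + (- c)" using \<mu>[OF zD] c(2,3) by simp
    have "?S z + (- c) \<in> cut X" using z(1) \<mu>z unfolding Y_def by simp
    from flow[OF z(2) uminus_dirs[OF c(1)] this]
    obtain e z' where e: "e \<noteq> - c" "z' \<in> Y" "\<mu> z' = ?S z + e" "z' = ?S z \<or> ?S z' = ?S z" by blast
    show ?thesis
    proof (cases "z' = ?S z")
      case False
      then have "?S z = ?S z'" using e(4) by simp
      moreover have "z \<noteq> z'"
      proof
        assume "z = z'"
        then have "?S z + (- c) = ?S z + e" using e(3) \<mu>z by simp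
        then show False using e(1) by simp
      qed
      ultimately have "?S ` Y = Y - {fs}" using not_inj z(1) e(2) by blast
      then show ?thesis using z(1) by blast
    qed (use e in simp)
  qed
  have path: "conf_path F fs v g (?S fs) v" using g vfs unfolding good_confs_def by blast
  have vF: "v \<in> F" using v vfs by blast
  have start: "y \<in> F" if "conf_path F fs v g y v" for y
    using that unfolding conf_path_def by (cases rule: converse_rtranclpE) (simp_all add: vF)
  have "?S fs \<in> Y" using forward[OF fsY start[OF path]] .
  moreover have "y \<notin> Y" if "conf_path F fs v g y v" for y
    using that unfolding conf_path_def
  proof (induction rule: converse_rtranclp_induct)
    case base
    then show ?case unfolding Y_def by blast
  next
    case (step y z)
    then have z: "z = ?S y" by blast
    have "z \<in> F" using step.hyps(2) start unfolding conf_path_def by blast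
    then show ?case using forward[of y] step.IH z by blast
  qed
  ultimately show False using path by blast
qed

section \<open>Completing a configuration to a matching\<close>

text \<open>The last vertex but one on a shortest path is closer to \<open>w\<close>.\<close>

lemma rtranclp_dist_pred:
  assumes "R\<^sup>*\<^sup>* w x" "x \<noteq> w"
  shows "\<exists>y. R y x \<and> (LEAST n. (R ^^ n) w y) < (LEAST n. (R ^^ n) w x)"
proof -
  define n where "n = (LEAST n. (R ^^ n) w x)"
  have "\<exists>n. (R ^^ n) w x" using assms(1) by (simp add: rtranclp_power)
  then have n: "(R ^^ n) w x" unfolding n_def by (rule LeastI_ex)
  have "n \<noteq> 0"
  proof
    assume "n = 0"
    then show False using n assms(2) by simp
  qed
  then obtain m where m: "n = Suc m" using not0_implies_Suc by blast
  from n[unfolded m] obtain y where y: "(R ^^ m) w y" "R y x" by (rule relpowp_Suc_E)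
  have "(LEAST n. (R ^^ n) w y) \<le> m" by (rule Least_le) (rule y(1))
  then have "(LEAST n. (R ^^ n) w y) < n" using m by simp
  then show ?thesis using y(2) unfolding n_def by blast
qed

lemma (in face_region) completion:
  assumes v: "v \<in> insert fs F" and w: "w \<in> V" and g: "g \<in> good_confs F fs v"
  obtains \<mu> where "\<And>z. z \<in> insert fs F - {v} \<Longrightarrow> \<mu> z = z + g (if z = fs then v else z)"
    "\<And>x. x \<in> V - {w} \<Longrightarrow> \<exists>d\<in>dirs. \<mu> x = x + d"
    "bij_betw \<mu> ((insert fs F - {v}) \<union> (V - {w})) E"
proof -
  let ?S = "dir_step fs v g"
  let ?D = "insert fs F - {v}"
  define \<mu>0 where "\<mu>0 z = z + g (if z = fs then v else z)" for z
  define T where "T = E - \<mu>0 ` ?D"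
  define dist where "dist x = (LEAST n. (tconn T ^^ n) w x)" for x
  have conn: "(tconn T)\<^sup>*\<^sup>* w x" if "x \<in> V" for x
    by (rule unused_edges_connect[OF v w g \<mu>0_def T_def that])
  have "\<exists>d. d \<in> dirs \<and> x + d \<in> T \<and> x + d + d \<in> V \<and> dist (x + d + d) < dist x" if x: "x \<in> V - {w}" for x
  proof -
    have xV: "x \<in> V" "x \<noteq> w" using x by blast+
    from rtranclp_dist_pred[OF conn[OF xV(1)] xV(2)]
    obtain y where y: "tconn T y x" "dist y < dist x" unfolding dist_def by blast
    from tconn_sym[OF y(1)] obtain d where d: "d \<in> dirs" "x + d \<in> T" "y = x + d + d" unfolding tconn_def by blast
    have "x + d \<in> E" using d(2) unfolding T_def by blast
    then have "x + d + d \<in> V" using mid_end2[OF _ V_lat[OF xV(1)] d(1)] by blast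
    then show ?thesis using d y(2) by blast
  qed
  then obtain e where e: "\<And>x. x \<in> V - {w} \<Longrightarrow> e x \<in> dirs \<and> x + e x \<in> T \<and> x + e x + e x \<in> V \<and> dist (x + e x + e x) < dist x"
    by metis
  define \<mu> where "\<mu> x = (if x \<in> ?D then \<mu>0 x else x + e x)" for x
  have D\<mu>: "\<mu> z = \<mu>0 z" if "z \<in> ?D" for z unfolding \<mu>_def using that by (rule if_P)
  have V\<mu>: "\<mu> x = x + e x" if "x \<in> V - {w}" for x
  proof -
    have "lat False x" using V_lat that by blast
    then have "x \<notin> ?D" using F_lat[of x] lat_disj[of False x True] by blast
    then show ?thesis unfolding \<mu>_def by (rule if_not_P)
  qed
  have D_facts: "\<exists>d\<in>dirs. ?S z = z + d + d \<and> \<mu>0 z = z + d" if "z \<in> ?D" for z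
    using good_conf_facts[OF v g that] unfolding \<mu>0_def by metis
  have inj0: "inj_on \<mu>0 ?D"
  proof (rule inj_onI, rule ccontr)
    fix z z' assume z: "z \<in> ?D" "z' \<in> ?D" "\<mu>0 z = \<mu>0 z'" and ne: "z \<noteq> z'"
    obtain d where d: "d \<in> dirs" "?S z = z + d + d" "\<mu>0 z = z + d" using D_facts[OF z(1)] by blast
    obtain d' where d': "d' \<in> dirs" "?S z' = z' + d' + d'" "\<mu>0 z' = z' + d'" using D_facts[OF z(2)] by blast
    have l: "lat True z" "lat True z'" using z(1,2) F_lat by blast+
    have "z + d = z' + d'" using z(3) d(3) d'(3) by simp
    from black_ends[OF l(1) d(1) l(2) d'(1) this] ne have eq: "z' = z + d + d" "d' = - d" by metis+
    have "?S z = z'" unfolding d(2) eq(1) by (rule refl)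
    moreover have "?S z' = z" unfolding d'(2) eq(2) unfolding eq(1) by simp
    ultimately have "?S ` {z, z'} \<subseteq> {z, z'}" by simp
    then have "{z, z'} = {}" using good_conf_no_closed[OF v g, of "{z, z'}"] z(1,2) by blast
    then show False by blast
  qed
  define T' where "T' = \<mu> ` (V - {w})"
  have T'T: "T' \<subseteq> T"
  proof
    fix m assume "m \<in> T'"
    then obtain x where "x \<in> V - {w}" "m = \<mu> x" unfolding T'_def by blast
    then show "m \<in> T" using e[of x] V\<mu>[of x] by simp
  qed
  have inj1: "inj_on \<mu> (V - {w})"
  proof (rule inj_onI, rule ccontr)
    fix x x' assume x: "x \<in> V - {w}" "x' \<in> V - {w}" "\<mu> x = \<mu> x'" and ne: "x \<noteq> x'"
    have l: "lat False x" "lat False x'" using x V_lat by blast+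
    have "x + e x = x' + e x'" using x(3) V\<mu>[OF x(1)] V\<mu>[OF x(2)] by simp
    from black_ends[OF l(1) _ l(2) _ this] e[OF x(1)] e[OF x(2)] ne have eq: "x' = x + e x + e x" "e x' = - e x" by metis+
    have "x' + e x' + e x' = x" unfolding eq(2) unfolding eq(1) by simp
    then have "dist x < dist x'" using e[OF x(2)] by simp
    moreover have "dist x' < dist x" using e[OF x(1)] unfolding eq(1) by blast
    ultimately show False by simp
  qed
  have conn': "(tconn T')\<^sup>*\<^sup>* x w" if "x \<in> V" for x
    using that
  proof (induction "dist x" arbitrary: x rule: less_induct)
    case less
    show ?case
    proof (cases "x = w")
      case False
      then have x: "x \<in> V - {w}" using less.prems by blast
      have "x + e x \<in> T'" unfolding T'_def using V\<mu>[OF x] x by (metis imageI)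
      then have "tconn T' x (x + e x + e x)" unfolding tconn_def using e[OF x] by blast
      moreover have "(tconn T')\<^sup>*\<^sup>* (x + e x + e x) w" using less.hyps e[OF x] by blast
      ultimately show ?thesis by (rule converse_rtranclp_into_rtranclp)
    qed simp
  qed
  have "T \<subseteq> T'"
  proof (rule subsetI, rule ccontr)
    fix m assume m: "m \<in> T" "m \<notin> T'"
    have mE: "m \<in> E" using m(1) unfolding T_def by blast
    then obtain c d where c: "c \<in> F" "d \<in> dirs" "m = c + d" using midpoints_iff by blast
    have cl: "lat True c" using F_lat c(1) by blast
    obtain z k where z: "lat (\<not> True) z" "k \<in> dirs" "c + d = z + k"
      using edge_two_sides[OF cl c(2)] by metis
    have zl: "lat False z" using z(1) by simp
    have zE: "z + k \<in> E" using mE c(3) z(3) by simp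
    have zT': "z + k \<notin> T'" using m(2) c(3) z(3) by simp
    have zV: "z \<in> V" "z + k + k \<in> V" using mid_end[OF zE zl z(2)] mid_end2[OF zE zl z(2)] by blast+
    from cycle_through_edge[OF conn'[OF zV(1)] conn'[OF zV(2)] zl z(2) zT']
    obtain C D where C: "C \<subseteq> insert (z + k) T'" "z + k \<in> C" "fills False C D" by blast
    have zT: "z + k \<in> T" using m(1) c(3) z(3) by simp
    have CT: "C \<subseteq> T" using C(1) T'T zT by blast
    have DF: "D \<subseteq> F" by (rule fills_in_F[OF _ C(3)]) (use CT T_def in blast)
    have inv: "y \<in> D \<longleftrightarrow> ?S y \<in> D" if y: "y \<in> ?D" for y
    proof -
      obtain d where d: "d \<in> dirs" "?S y = y + d + d" "\<mu>0 y = y + d" using D_facts[OF y] by blast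
      have "\<mu>0 y \<notin> C" using CT y unfolding T_def by blast
      moreover have "lat (\<not> False) y" using F_lat y by simp
      ultimately show ?thesis using C(3) d unfolding fills_def by metis
    qed
    have ne: "D \<noteq> {}"
    proof -
      have "c + d \<in> C" using C(2) z(3) by simp
      moreover have "lat (\<not> False) c" using cl by simp
      ultimately show ?thesis using C(3) c(2) unfolding fills_def by blast
    qed
    show False
    \<comment> \<open>No step of the configuration crosses the cycle. If the region contains
      \<open>v\<close>, the path from \<open>fs\<close> cannot enter it to reach \<open>v\<close>;
      if not, the region is a closed set.\<close>
    proof (cases "v \<in> D")
      case True
      then have vF: "v \<in> F" "v \<noteq> fs" using DF fs_notin by blast+
      then have path: "conf_path F fs v g (?S fs) v" using g unfolding good_confs_def by blast
      have "fs \<notin> D" using DF fs_notin by blast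
      then have start: "?S fs \<notin> D" using inv[of fs] vF(2) by blast
      have "y \<notin> D" if "conf_path F fs v g (?S fs) y" for y
        using that unfolding conf_path_def
      proof (induction rule: rtranclp_induct)
        case (step y z)
        then have "y \<in> ?D" "z = ?S y" by blast+
        then show ?case using inv[of y] step.IH by simp
      qed (rule start)
      then show False using path True by blast
    next
      case False
      then have sub: "D \<subseteq> ?D" using DF by blast
      have "?S ` D \<subseteq> D"
      proof
        fix y assume "y \<in> ?S ` D"
        then obtain z where z: "z \<in> D" "y = ?S z" by blast
        then show "y \<in> D" using inv[of z] sub by blast
      qed
      then show False using good_conf_no_closed[OF v g sub] ne by blast
    qed
  qed
  then have TT: "T' = T" using T'T by blast
  have "bij_betw \<mu>0 ?D (\<mu>0 ` ?D)" using inj0 by (rule inj_on_imp_bij_betw)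
  then have b0: "bij_betw \<mu> ?D (\<mu>0 ` ?D)" by (rule bij_betw_cong[THEN iffD2, rotated]) (rule D\<mu>)
  have b1: "bij_betw \<mu> (V - {w}) T" using inj_on_imp_bij_betw[OF inj1] TT unfolding T'_def by simp
  have "\<mu>0 ` ?D \<inter> T = {}" unfolding T_def by blast
  from bij_betw_combine[OF b0 b1 this] have "bij_betw \<mu> (?D \<union> (V - {w})) (\<mu>0 ` ?D \<union> T)" .
  moreover have "\<mu>0 ` ?D \<subseteq> E"
  proof
    fix m assume "m \<in> \<mu>0 ` ?D"
    then obtain z where z: "z \<in> ?D" "m = \<mu>0 z" by blast
    then show "m \<in> E" using good_conf_facts[OF v g z(1)] unfolding \<mu>0_def by metis
  qed
  then have "\<mu>0 ` ?D \<union> T = E" unfolding T_def by blast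
  ultimately have "bij_betw \<mu> (?D \<union> (V - {w})) E" by simp
  moreover have "\<exists>d\<in>dirs. \<mu> x = x + d" if "x \<in> V - {w}" for x using V\<mu>[OF that] e[OF that] by blast
  moreover have "\<mu> z = z + g (if z = fs then v else z)" if "z \<in> ?D" for z
    using D\<mu>[OF that] unfolding \<mu>0_def .
  ultimately show ?thesis using that by blast
qed

text \<open>The count comes from one explicit configuration in place of Euler's formula: for
  \<open>v = fs\<close> every face may point to the right. Its completion matches all white vertices
  except \<open>fs\<close> and \<open>w\<close> with \<open>E\<close>.\<close>

lemma (in face_region) euler:
  assumes w: "w \<in> V"
  shows "card (insert fs F \<union> V) = card E + 2"
proof -
  define g where "g = (\<lambda>u\<in>F. (1, 0 :: int) :: pt)"
  have gg: "g \<in> good_confs F fs fs"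
    unfolding good_confs_def mem_Collect_eq
  proof (intro conjI impI)
    show "g \<in> F \<rightarrow>\<^sub>E dirs" unfolding g_def by simp
    show "acyclic_conf F fs fs g" unfolding acyclic_conf_def
    proof (intro allI impI)
      fix Y assume Y: "Y \<subseteq> F - {fs}" "dir_step fs fs g ` Y = Y"
      have finY: "finite Y" by (rule finite_subset[OF Y(1)]) (simp add: finF)
      have "inj_on (dir_step fs fs g) Y" using finY Y(2) by (simp add: eq_card_imp_inj_on)
      \<comment> \<open>Every step raises the first coordinate by 2, so a set permuted by the steps
        must be empty.\<close>
      from sum.reindex[OF this, of fst] have "(\<Sum>y\<in>Y. fst y) = (\<Sum>y\<in>Y. fst (dir_step fs fs g y))"
        unfolding Y(2) by (simp add: comp_def)
      also have "\<dots> = (\<Sum>y\<in>Y. fst y + 2)"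
      proof (rule sum.cong[OF refl])
        fix y assume "y \<in> Y"
        then have "y \<in> F" using Y(1) by blast
        then show "fst (dir_step fs fs g y) = fst y + 2"
          using fs_notin unfolding dir_step_def g_def by (cases "y = fs") simp_all
      qed
      finally have "card Y = 0" by (simp add: sum.distrib)
      then show "Y = {}" using finY by simp
    qed
  qed simp
  obtain \<mu> where \<mu>: "bij_betw \<mu> ((insert fs F - {fs}) \<union> (V - {w})) E"
    by (rule completion[OF insertI1 w gg]) (rule that)
  have disj: "insert fs F \<inter> V = {}" using F_lat V_lat lat_disj by blast
  define A where "A = (insert fs F - {fs}) \<union> (V - {w})"
  have "insert fs F \<union> V = insert fs (insert w A)" unfolding A_def using w by blast
  moreover have "w \<notin> A" "fs \<notin> insert w A" unfolding A_def using disj w by blast+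
  moreover have "finite A" unfolding A_def using finF finV by simp
  ultimately have "card (insert fs F \<union> V) = card A + 2" by simp
  then show ?thesis using bij_betw_same_card[OF \<mu>] unfolding A_def by simp
qed

section \<open>Dimer coverings as partner maps\<close>

definition mate :: "pt set set \<Rightarrow> pt \<Rightarrow> pt" where
  "mate M x = (THE y. {x, y} \<in> M)"

lemma covering_mate:
  assumes M: "M \<in> dimer_coverings S" and x: "x \<in> S"
  shows "{x, mate M x} \<in> M" "mate M x \<in> S" "gamma_adj x (mate M x)" "\<And>y. {x, y} \<in> M \<Longrightarrow> mate M x = y"
proof -
  have sub: "M \<subseteq> induced_edges S" and ex: "\<exists>!e. e \<in> M \<and> x \<in> e"
    using M x unfolding dimer_coverings_def by blast+
  obtain e where e: "e \<in> M" "x \<in> e" using ex by blast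
  obtain a b where ab: "e = {a, b}" "a \<in> S" "b \<in> S" "gamma_adj a b"
    using e(1) sub unfolding induced_edges_def by blast
  have "\<exists>y. {x, y} \<in> M \<and> y \<in> S \<and> gamma_adj x y"
  proof (cases "x = a")
    case True
    then show ?thesis using ab e(1) by blast
  next
    case False
    then have "x = b" "{x, a} = e" using e(2) ab(1) by blast+
    then show ?thesis using ab e(1) gamma_adj_sym[OF ab(4)] by blast
  qed
  then obtain y where y: "{x, y} \<in> M" "y \<in> S" "gamma_adj x y" by blast
  have uniq: "z = y" if z: "{x, z} \<in> M" for z
  proof -
    have "{x, z} = {x, y}" using ex z y(1) by blast
    then show ?thesis by (metis doubleton_eq_iff)
  qed
  have "mate M x = y" unfolding mate_def
  proof (rule the_equality)
    fix z assume "{x, z} \<in> M"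
    then show "z = y" by (rule uniq)
  qed (rule y(1))
  then show "{x, mate M x} \<in> M" "mate M x \<in> S" "gamma_adj x (mate M x)" "\<And>y. {x, y} \<in> M \<Longrightarrow> mate M x = y"
    using y uniq by metis+
qed

lemma mate_mate:
  assumes "M \<in> dimer_coverings S" "x \<in> S"
  shows "mate M (mate M x) = x"
proof -
  have "{mate M x, x} \<in> M" using covering_mate(1)[OF assms] by (metis insert_commute)
  then show ?thesis using covering_mate(4)[OF assms(1) covering_mate(2)[OF assms]] by blast
qed

lemma covering_image:
  assumes "M \<in> dimer_coverings S"
  shows "M = (\<lambda>x. {x, mate M x}) ` S"
proof
  show "(\<lambda>x. {x, mate M x}) ` S \<subseteq> M" using covering_mate(1)[OF assms] by blast
  show "M \<subseteq> (\<lambda>x. {x, mate M x}) ` S"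
  proof
    fix e assume e: "e \<in> M"
    then obtain a b where ab: "e = {a, b}" "a \<in> S" using assms unfolding dimer_coverings_def induced_edges_def by blast
    then have "mate M a = b" using covering_mate(4)[OF assms ab(2)] e by blast
    then show "e \<in> (\<lambda>x. {x, mate M x}) ` S" using ab by blast
  qed
qed

lemma black_flip: "d \<in> dirs \<Longrightarrow> black (z + d) \<longleftrightarrow> \<not> black z"
  by (elim dirs_cases) (simp_all add: black_def)

lemma gamma_adj_white:
  assumes "gamma_adj x y" "\<not> black x" "\<not> black y"
  shows "diag_adj x y"
proof (rule ccontr)
  assume "\<not> diag_adj x y"
  then have "\<bar>fst x - fst y\<bar> + \<bar>snd x - snd y\<bar> = 1" using assms(1) unfolding gamma_adj_def by blast
  moreover have "even (fst x + snd x)" "even (fst y + snd y)" using assms(2,3) unfolding black_def by simp_all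
  ultimately show False by presburger
qed

lemma diag_adj_lat:
  assumes "diag_adj x y" "lat a x"
  shows "lat (\<not> a) y" "near x y"
proof -
  have d: "\<bar>fst x - fst y\<bar> = 1" "\<bar>snd x - snd y\<bar> = 1" using assms(1) unfolding diag_adj_def by blast+
  then show "near x y" unfolding near_def by simp
  have "odd i \<noteq> odd j" if "\<bar>i - j\<bar> = 1" for i j :: int using that by presburger
  from this[OF d(1)] this[OF d(2)] show "lat (\<not> a) y" using assms(2) unfolding lat_def by blast
qed

context face_region
begin

lemma E_G: "m \<in> E \<Longrightarrow> m \<in> G" and V_G: "m \<in> V \<Longrightarrow> m \<in> G" and F_G: "m \<in> insert fs F \<Longrightarrow> m \<in> G"
  by blast+

lemma white_not_E: "z \<in> insert fs F \<union> V \<Longrightarrow> z \<notin> E"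
  using F_lat V_lat lat_not_black E_black by blast

lemma white_not_black: "z \<in> insert fs F \<union> V \<Longrightarrow> \<not> black z"
  using F_lat V_lat lat_not_black by blast

lemma black_mate:
  assumes M: "M \<in> dimer_coverings G" and m: "m \<in> E"
  shows "mate M m \<in> insert fs F \<union> V" "\<exists>d\<in>dirs. m = mate M m + d"
proof -
  have "gamma_adj m (mate M m)" "mate M m \<in> G" using covering_mate(2,3)[OF M E_G[OF m]] by blast+
  then obtain d where d: "d \<in> dirs" "mate M m = m + d" using gamma_adj_black E_black[OF m] by metis
  have "\<not> black (mate M m)" unfolding d(2) black_flip[OF d(1)] using E_black[OF m] by simp
  then show "mate M m \<in> insert fs F \<union> V" using E_black \<open>mate M m \<in> G\<close> by blast
  have "m = mate M m + (- d)" unfolding d(2) by simp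
  then show "\<exists>d\<in>dirs. m = mate M m + d" using uminus_dirs[OF d(1)] by blast
qed

text \<open>The partners of the black vertices are distinct white vertices, and by
  \<open>euler\<close> this leaves two.\<close>

lemma card_unmatched:
  assumes M: "M \<in> dimer_coverings G" and w: "V \<noteq> {}"
  shows "card ((insert fs F \<union> V) - mate M ` E) = 2"
proof -
  have inj: "inj_on (mate M) E"
  proof (rule inj_onI)
    fix x y assume "x \<in> E" "y \<in> E" "mate M x = mate M y"
    then show "x = y" using mate_mate[OF M E_G] by metis
  qed
  have sub: "mate M ` E \<subseteq> insert fs F \<union> V" using black_mate(1)[OF M] by blast
  have "card ((insert fs F \<union> V) - mate M ` E) = card (insert fs F \<union> V) - card (mate M ` E)"
    by (rule card_Diff_subset[OF finite_imageI[OF finE] sub])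
  then show ?thesis using euler w card_image[OF inj] by fastforce
qed

text \<open>A white vertex that is not the partner of a black one has a white partner, and white
  vertices on different sublattices are joined by the diagonal edges.\<close>

lemma covering_impurity:
  assumes M: "M \<in> dimer_coverings G" and V: "V \<noteq> {}"
  shows "\<exists>v w. v \<in> insert fs F \<and> w \<in> V \<and> diag_adj v w \<and> {v, w} \<in> M"
proof -
  obtain x y where xy: "(insert fs F \<union> V) - mate M ` E = {x, y}"
    using card_unmatched[OF M V] card_2_iff by metis
  then have x: "x \<in> insert fs F \<union> V" "x \<notin> mate M ` E" by blast+
  then have xG: "x \<in> G" by blast
  note cm = covering_mate[OF M xG]
  have "mate M x \<notin> E"
  proof
    assume "mate M x \<in> E"
    then have "mate M (mate M x) \<in> mate M ` E" by (rule imageI)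
    then show False using mate_mate[OF M xG] x(2) by simp
  qed
  then have my: "mate M x \<in> insert fs F \<union> V" using cm(2) by blast
  have adj: "diag_adj x (mate M x)"
    by (rule gamma_adj_white[OF cm(3) white_not_black[OF x(1)] white_not_black[OF my]])
  show ?thesis
  proof (cases "x \<in> V")
    case True
    have "lat True (mate M x)" using diag_adj_lat(1)[OF adj V_lat[OF True]] by simp
    then have "mate M x \<in> insert fs F" using G_True[OF cm(2)] by blast
    moreover have "diag_adj (mate M x) x" using adj unfolding diag_adj_def by (simp add: abs_minus_commute)
    moreover have "{mate M x, x} \<in> M" using cm(1) by (metis insert_commute)
    ultimately show ?thesis using True by blast
  next
    case False
    then have xF: "x \<in> insert fs F" using x(1) by blast
    have "lat False (mate M x)" using diag_adj_lat(1)[OF adj F_lat[OF xF]] by simp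
    then have "mate M x \<in> V" using G_False[OF cm(2)] by blast
    then show ?thesis using xF adj cm(1) by blast
  qed
qed

text \<open>The ends of one impurity use up both white vertices left by
  \<open>card_unmatched\<close>, so there is no room for a second impurity.\<close>

lemma unmatched_eq:
  assumes M: "M \<in> dimer_coverings G" and v: "v \<in> insert fs F" and w: "w \<in> V" and e: "{v, w} \<in> M"
  shows "(insert fs F \<union> V) - mate M ` E = {v, w}" "mate M v = w" "mate M w = v"
proof -
  show mv: "mate M v = w" using covering_mate(4)[OF M F_G[OF v] e] .
  have "{w, v} \<in> M" using e by (metis insert_commute)
  from covering_mate(4)[OF M V_G[OF w] this] show mw: "mate M w = v" .
  have "v \<notin> mate M ` E"
  proof
    assume "v \<in> mate M ` E"
    then obtain m where "m \<in> E" "v = mate M m" by blast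
    then have "w \<in> E" using mate_mate[OF M E_G] mv by metis
    then show False using white_not_E w by blast
  qed
  moreover have "w \<notin> mate M ` E"
  proof
    assume "w \<in> mate M ` E"
    then obtain m where "m \<in> E" "w = mate M m" by blast
    then have "v \<in> E" using mate_mate[OF M E_G] mw by metis
    then show False using white_not_E v by blast
  qed
  ultimately have sub: "{v, w} \<subseteq> (insert fs F \<union> V) - mate M ` E" using v w by blast
  have "v \<noteq> w" using F_lat[OF v] V_lat[OF w] lat_disj by blast
  then have "card {v, w} = 2" by simp
  moreover have "finite ((insert fs F \<union> V) - mate M ` E)" using finF finV by simp
  ultimately show "(insert fs F \<union> V) - mate M ` E = {v, w}"
    using card_subset_eq[OF _ sub] card_unmatched[OF M] w by (metis empty_iff)
qed

lemma white_mate: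
  assumes M: "M \<in> dimer_coverings G" and v: "v \<in> insert fs F" and w: "w \<in> V" and e: "{v, w} \<in> M"
    and z: "z \<in> insert fs F \<union> V" "z \<noteq> v" "z \<noteq> w"
  shows "mate M z \<in> E" "\<exists>d\<in>dirs. mate M z = z + d"
proof -
  have "z \<in> mate M ` E" using unmatched_eq(1)[OF M v w e] z by blast
  then obtain m where m: "m \<in> E" "z = mate M m" by blast
  then have mz: "mate M z = m" using mate_mate[OF M E_G] by simp
  then show "mate M z \<in> E" "\<exists>d\<in>dirs. mate M z = z + d" using black_mate(2)[OF M m(1)] m by simp_all
qed

lemma impurity_matching_mate:
  assumes M: "M \<in> dimer_coverings G" and v: "v \<in> insert fs F" and w: "w \<in> V" and e: "{v, w} \<in> M"
    and adj: "diag_adj v w"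
  shows "impurity_matching G (mate M) (\<lambda>a. if a then v else w)"
proof
  show "finite G" by (rule finG)
  show "connected_on gamma_adj (- G)" by (rule connG)
  show "lat a (if a then v else w)" for a using F_lat[OF v] V_lat[OF w] by (cases a) simp_all
  show "near (if True then v else w) (if False then v else w)"
    using diag_adj_lat(2)[OF adj F_lat[OF v]] by simp
  have wh: "z \<in> insert fs F \<union> V \<and> z \<noteq> v \<and> z \<noteq> w" if "z \<in> G" "lat a z" "z \<noteq> (if a then v else w)" for z a
  proof (cases a)
    case True
    then have "lat True z" using that(2) by simp
    then have "z \<in> insert fs F" "z \<noteq> w" using G_True[OF that(1)] V_lat[OF w] lat_disj by blast+
    then show ?thesis using that(3) True by auto
  next
    case False
    then have "lat False z" using that(2) by simp
    then have "z \<in> V" "z \<noteq> v" using G_False[OF that(1)] F_lat[OF v] lat_disj by blast+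
    then show ?thesis using that(3) False by auto
  qed
  note wm = white_mate[OF M v w e]
  show "mate M z - z \<in> dirs" if h: "z \<in> G" "lat a z" "z \<noteq> (if a then v else w)" for z a
  proof -
    obtain d where "d \<in> dirs" "mate M z = z + d" using wm(2) wh[OF h] by blast
    then show ?thesis by simp
  qed
  show "mate M z \<in> G" if "z \<in> G" "lat a z" "z \<noteq> (if a then v else w)" for z a
    using wm(1) wh[OF that] by blast
  show "z = z'" if "z \<in> G" "z' \<in> G" "mate M z = mate M z'" for z z'
    using mate_mate[OF M that(1)] mate_mate[OF M that(2)] that(3) by metis
  show "\<exists>z a. z \<in> G \<and> lat a z \<and> z \<noteq> (if a then v else w) \<and> mate M z = m" if h: "m \<in> G" "black m" for m
  proof -
    have m: "m \<in> E" by (rule G_black[OF h])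
    have z: "mate M m \<in> insert fs F \<union> V" by (rule black_mate(1)[OF M m])
    have "mate M m \<in> mate M ` E" using m by (rule imageI)
    then have ne: "mate M m \<noteq> v" "mate M m \<noteq> w" using unmatched_eq(1)[OF M v w e] by blast+
    have "\<exists>a. lat a (mate M m)" using z F_lat V_lat by blast
    then obtain a where "lat a (mate M m)" by blast
    moreover have "mate M m \<noteq> (if a then v else w)" using ne by simp
    moreover have "mate M m \<in> G" using z by blast
    ultimately show ?thesis using mate_mate[OF M h(1)] by blast
  qed
qed

end

section \<open>The configuration of a covering\<close>

definition covering_conf :: "pt set \<Rightarrow> pt \<Rightarrow> pt \<Rightarrow> pt set set \<Rightarrow> pt \<Rightarrow> pt" where
  "covering_conf F fs v M = (\<lambda>u\<in>F. mate M (if u = v then fs else u) - (if u = v then fs else u))"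

locale impurity_covering = face_region +
  fixes M :: "pt set set" and v w :: pt
  assumes M: "M \<in> dimer_coverings G" and v: "v \<in> insert fs F" and w: "w \<in> V" and e: "{v, w} \<in> M"
    and adj: "diag_adj v w"

sublocale impurity_covering \<subseteq> impurity_matching "corners F \<union> insert fs F \<union> midpoints F" "mate M" "\<lambda>a. if a then v else w"
  by (rule impurity_matching_mate[OF M v w e adj])

context impurity_covering
begin

abbreviation "gM \<equiv> covering_conf F fs v M"

lemma D_wh: "z \<in> insert fs F - {v} \<Longrightarrow> z \<in> wh True"
  unfolding wh_def using F_lat by fastforce

lemma V_wh: "z \<in> V - {w} \<Longrightarrow> z \<in> wh False"
  unfolding wh_def using V_lat by fastforce

lemma V_mate_E: "z \<in> V - {w} \<Longrightarrow> mate M z \<in> E"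
proof -
  assume z: "z \<in> V - {w}"
  have "z \<noteq> v" using F_lat[OF v] V_lat[of z] z lat_disj by blast
  moreover have "z \<in> insert fs F \<union> V" "z \<noteq> w" using z by blast+
  ultimately show ?thesis by (intro white_mate(1)[OF M v w e])
qed

lemma D_mate_E: "z \<in> insert fs F - {v} \<Longrightarrow> mate M z \<in> E"
proof -
  assume z: "z \<in> insert fs F - {v}"
  have "z \<noteq> w" using F_lat[of z] V_lat[OF w] z lat_disj by blast
  moreover have "z \<in> insert fs F \<union> V" "z \<noteq> v" using z by blast+
  ultimately show ?thesis by (intro white_mate(1)[OF M v w e])
qed

lemma conf_at: "z \<in> insert fs F - {v} \<Longrightarrow> z + gM (if z = fs then v else z) = mate M z"
proof -
  assume z: "z \<in> insert fs F - {v}"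
  show ?thesis
  proof (cases "z = fs")
    case True
    then have "v \<in> F" using v z by blast
    then show ?thesis using True unfolding covering_conf_def by simp
  next
    case False
    then have "z \<in> F" "z \<noteq> v" using z by blast+
    then show ?thesis using False unfolding covering_conf_def by simp
  qed
qed

lemma step_nxt: "z \<in> insert fs F - {v} \<Longrightarrow> dir_step fs v gM z = nxt z"
proof -
  assume z: "z \<in> insert fs F - {v}"
  have "gM (if z = fs then v else z) = mate M z - z" using conf_at[OF z] by (metis add_diff_cancel_left')
  then show ?thesis unfolding dir_step_def nxt_def by simp
qed

lemma conf_PiE: "gM \<in> F \<rightarrow>\<^sub>E dirs"
  unfolding covering_conf_def
proof (rule restrict_PiE_iff[THEN iffD2], rule ballI)
  fix u assume u: "u \<in> F"
  have "(if u = v then fs else u) \<in> insert fs F - {v}" using u fs_notin by auto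
  from wh_dir[OF D_wh[OF this]] obtain d where "d \<in> dirs"
    "mate M (if u = v then fs else u) = (if u = v then fs else u) + d" by metis
  then show "mate M (if u = v then fs else u) - (if u = v then fs else u) \<in> dirs" by simp
qed

text \<open>Corners not joined to \<open>w\<close> by edges matched with corners would be closed
  under \<open>nxt\<close>.\<close>

lemma primal_connected: "x \<in> V \<Longrightarrow> (tconn {m \<in> E. mate M m \<in> V})\<^sup>*\<^sup>* x w"
proof (rule ccontr)
  let ?T = "{m \<in> E. mate M m \<in> V}"
  assume x: "x \<in> V" "\<not> (tconn ?T)\<^sup>*\<^sup>* x w"
  define Y where "Y = {x \<in> V. \<not> (tconn ?T)\<^sup>*\<^sup>* x w}"
  have sub: "Y \<subseteq> V - {w}" unfolding Y_def by blast
  have "nxt ` Y \<subseteq> Y"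
  proof
    fix y assume "y \<in> nxt ` Y"
    then obtain z where z: "z \<in> Y" "y = nxt z" by blast
    have zV: "z \<in> V - {w}" "z \<in> V" using z(1) sub by blast+
    obtain d where d: "d \<in> dirs" "mate M z = z + d" "nxt z = z + d + d" by (rule wh_dir[OF V_wh[OF zV(1)]])
    have dE: "z + d \<in> E" using V_mate_E[OF zV(1)] unfolding d(2) .
    have "mate M (z + d) = z" using mate_mate[OF M V_G[OF zV(2)]] d(2) by simp
    then have "z + d \<in> ?T" using dE zV(2) by simp
    then have "tconn ?T z y" unfolding tconn_def z(2) d(3) using d(1) by blast
    then have "\<not> (tconn ?T)\<^sup>*\<^sup>* y w" using z(1) converse_rtranclp_into_rtranclp[of "tconn ?T" z y w]
      unfolding Y_def by blast
    moreover have "y \<in> V" unfolding z(2) d(3) by (rule mid_end2[OF dE V_lat[OF zV(2)] d(1)])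
    ultimately show "y \<in> Y" unfolding Y_def by blast
  qed
  moreover have "Y \<subseteq> wh False" using sub V_wh by blast
  ultimately have "Y = {}" using no_closed_orbit by blast
  then show False using x unfolding Y_def by blast
qed

text \<open>A dual path from \<open>fs\<close> that leaves through an outer edge would be closed up by the primal tree.\<close>

lemma conf_reaches:
  assumes vfs: "v \<noteq> fs"
  shows "conf_path F fs v gM (dir_step fs v gM fs) v"
proof (rule ccontr)
  assume no: "\<not> conf_path F fs v gM (dir_step fs v gM fs) v"
  let ?T = "{m \<in> E. mate M m \<in> V}"
  let ?D = "insert fs F - {v}"
  let ?S = "dir_step fs v gM"
  define Z where "Z = insert fs {z. conf_path F fs v gM (?S fs) z}"
  have Z_step: "?S z \<in> Z" if "z \<in> Z" "z \<in> ?D" for z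
  proof (cases "z = fs")
    case True
    then show ?thesis unfolding Z_def conf_path_def by simp
  next
    case False
    then have "conf_path F fs v gM (?S fs) z" "z \<in> F - {v}" using that unfolding Z_def by blast+
    then have "conf_path F fs v gM (?S fs) (?S z)" unfolding conf_path_def
      by (simp add: rtranclp.rtrancl_into_rtrancl)
    then show ?thesis unfolding Z_def by blast
  qed
  \<comment> \<open>If the path neither reached \<open>v\<close> nor left the dual vertices, its
    vertices would form a closed set. So some \<open>u\<close> on it steps out.\<close>
  have "\<exists>u. u \<in> Z \<and> u \<in> ?D \<and> ?S u \<notin> insert fs F"
  proof (rule ccontr)
    assume all: "\<not> (\<exists>u. u \<in> Z \<and> u \<in> ?D \<and> ?S u \<notin> insert fs F)"
    have vZ: "v \<notin> Z" using no vfs unfolding Z_def by blast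
    define Y where "Y = Z \<inter> ?D"
    have "nxt ` Y \<subseteq> Y"
    proof
      fix y assume "y \<in> nxt ` Y"
      then obtain z where z: "z \<in> Z" "z \<in> ?D" "y = nxt z" unfolding Y_def by blast
      have y: "y = ?S z" using step_nxt[OF z(2)] z(3) by simp
      then have "y \<in> Z" "y \<in> insert fs F" using Z_step z(1,2) all by blast+
      then show "y \<in> Y" using vZ unfolding Y_def by blast
    qed
    moreover have "Y \<subseteq> wh True" unfolding Y_def using D_wh by blast
    ultimately have "Y = {}" using no_closed_orbit by blast
    moreover have "fs \<in> Y" unfolding Y_def Z_def using vfs by blast
    ultimately show False by blast
  qed
  then obtain u where u: "u \<in> Z" "u \<in> ?D" "?S u \<notin> insert fs F" by blast
  have D_facts: "\<exists>d\<in>dirs. ?S z = z + d + d \<and> mate M z = z + d" if z: "z \<in> ?D" for z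
  proof -
    obtain d where "d \<in> dirs" "mate M z = z + d" "nxt z = z + d + d" by (rule wh_dir[OF D_wh[OF z]])
    then show ?thesis using step_nxt[OF z] by metis
  qed
  obtain d where d: "d \<in> dirs" "?S u = u + d + d" "mate M u = u + d" using D_facts[OF u(2)] by blast
  have ul: "lat True u" using u(2) F_lat by blast
  obtain z k where z: "lat (\<not> True) z" "k \<in> dirs" "u + d = z + k"
    using edge_two_sides[OF ul d(1)] by metis
  have zl: "lat False z" using z(1) by simp
  have mnT: "mate M y \<notin> ?T" if y: "y \<in> ?D" for y
  proof -
    have "mate M (mate M y) = y" using mate_mate[OF M] y by blast
    moreover have "y \<notin> V" using y F_lat[of y] V_lat[of y] lat_disj by blast
    ultimately show ?thesis by simp
  qed
  have zE: "z + k \<in> E"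
  proof -
    have "mate M u \<in> E" by (rule D_mate_E[OF u(2)])
    then show ?thesis using d(3) z(3) by simp
  qed
  have zT: "z + k \<notin> ?T" using mnT[OF u(2)] d(3) z(3) by simp
  have zV: "z \<in> V" "z + k + k \<in> V" using mid_end[OF zE zl z(2)] mid_end2[OF zE zl z(2)] by blast+
  from cycle_through_edge[OF primal_connected[OF zV(1)] primal_connected[OF zV(2)] zl z(2) zT]
  obtain C D where C: "C \<subseteq> insert (z + k) ?T" "z + k \<in> C" "fills False C D" by blast
  have "C \<subseteq> E" using C(1) zE by blast
  from fills_in_F[OF this C(3)] have DF: "D \<subseteq> F" .
  have flip: "(y \<in> D) \<noteq> (y + c + c \<in> D) \<longleftrightarrow> y + c \<in> C" if "y \<in> insert fs F" "c \<in> dirs" for y c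
  proof -
    have "lat (\<not> False) y" using F_lat that(1) by simp
    then show ?thesis using C(3) that(2) unfolding fills_def by blast
  qed
  have "u + d \<in> C" using C(2) z(3) by simp
  then have "(u \<in> D) \<noteq> (?S u \<in> D)" using flip[of u d] u(2) d by simp
  then have uD: "u \<in> D" using u(3) DF by blast
  \<comment> \<open>The cycle consists of edges matched with corners and the exit edge of
    \<open>u\<close>. As \<open>u\<close> is enclosed and partners are distinct, no step from
    outside crosses the cycle; hence the path from \<open>fs\<close> could not have come to
    \<open>u\<close>.\<close>
  have inv: "?S y \<notin> D" if y: "y \<in> ?D" "y \<notin> D" for y
  proof -
    obtain c where c: "c \<in> dirs" "?S y = y + c + c" "mate M y = y + c" using D_facts[OF y(1)] by blast
    have "mate M y \<noteq> z + k"
    proof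
      assume "mate M y = z + k"
      then have "mate M y = mate M u" using d(3) z(3) by simp
      then have "y = u" using wh_inj[OF D_wh[OF y(1)] D_wh[OF u(2)]] by blast
      then show False using uD y(2) by simp
    qed
    then have "mate M y \<notin> C" using C(1) mnT[OF y(1)] by blast
    then have "y + c \<notin> C" unfolding c(3) .
    then show ?thesis using flip[of y c] y c by simp
  qed
  have fsD: "fs \<notin> D" using DF fs_notin by blast
  have "y \<notin> D" if "conf_path F fs v gM (?S fs) y" for y
    using that unfolding conf_path_def
  proof (induction rule: rtranclp_induct)
    case base
    show ?case using inv[of fs] fsD vfs by blast
  next
    case (step y z)
    then have "y \<in> ?D" "z = ?S y" by blast+
    then show ?case using inv[of y] step.IH by simp
  qed
  then show False using u(1) uD fsD unfolding Z_def by blast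
qed

lemma conf_good: "gM \<in> good_confs F fs v"
  unfolding good_confs_def mem_Collect_eq
proof (intro conjI impI conf_PiE conf_reaches)
  show "acyclic_conf F fs v gM" unfolding acyclic_conf_def
  proof (intro allI impI)
    fix Y assume Y: "Y \<subseteq> F - {v}" "dir_step fs v gM ` Y = Y"
    have sub: "Y \<subseteq> insert fs F - {v}" using Y(1) by blast
    have "nxt ` Y \<subseteq> Y"
    proof
      fix y assume "y \<in> nxt ` Y"
      then obtain z where z: "z \<in> Y" "y = nxt z" by blast
      have "z \<in> insert fs F - {v}" using sub z(1) by (rule subsetD)
      from step_nxt[OF this] have "y = dir_step fs v gM z" using z(2) by simp
      then show "y \<in> Y" using Y(2) z(1) by blast
    qed
    moreover have "Y \<subseteq> wh True" using sub D_wh by blast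
    ultimately show "Y = {}" using no_closed_orbit by blast
  qed
qed

text \<open>Suppose that the coverings differ at a corner \<open>x\<close>. In \<open>N\<close> the
  \<open>M\<close>-edge of \<open>x\<close> is matched neither with \<open>x\<close> nor with a
  face, where the coverings agree; so it is matched with \<open>nxt x\<close>, whose partner in
  \<open>M\<close> is another one. Thus the corners of disagreement form a closed set.\<close>

lemma conf_inj:
  assumes N: "N \<in> dimer_coverings G" "{v, w} \<in> N" and eq: "covering_conf F fs v N = gM"
  shows "N = M"
proof -
  interpret n: impurity_covering F fs N v w
    by unfold_locales (use N v w adj in auto)
  have D: "mate N z = mate M z" if "z \<in> insert fs F - {v}" for z
    using conf_at[OF that] n.conf_at[OF that] unfolding eq by simp
  define Y where "Y = {x \<in> V - {w}. mate N x \<noteq> mate M x}"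
  have "nxt ` Y \<subseteq> Y"
  proof
    fix y assume "y \<in> nxt ` Y"
    then obtain x where x: "x \<in> V - {w}" "x \<in> V" "mate N x \<noteq> mate M x" "y = nxt x" unfolding Y_def by blast
    obtain d where d: "d \<in> dirs" "mate M x = x + d" "nxt x = x + d + d" by (rule wh_dir[OF V_wh[OF x(1)]])
    have xl: "lat False x" using V_lat x(2) by blast
    have dE: "x + d \<in> E" using V_mate_E[OF x(1)] unfolding d(2) .
    have mx: "mate M (x + d) = x" using mate_mate[OF M V_G[OF x(2)]] d(2) by simp
    define z where "z = mate N (x + d)"
    have zm: "mate N z = x + d" unfolding z_def by (rule mate_mate[OF N(1) E_G[OF dE]])
    have zW: "z \<in> insert fs F \<union> V" unfolding z_def by (rule black_mate(1)[OF N(1) dE])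
    have zE: "mate N z \<in> E" using zm dE by simp
    have "v \<notin> E" "w \<notin> E" using white_not_E v w by blast+
    then have "z \<noteq> v" using zE unmatched_eq(2)[OF N(1) v w N(2)] by metis
    moreover have "z \<noteq> w" using zE unmatched_eq(3)[OF N(1) v w N(2)] \<open>v \<notin> E\<close> by metis
    moreover have "z \<notin> insert fs F - {v}"
    proof
      assume zD: "z \<in> insert fs F - {v}"
      then have "mate M z = x + d" using D zm by simp
      then have "x = z" using mx mate_mate[OF M F_G, of z] zD by auto
      then show False using zD F_lat[of z] xl lat_disj by blast
    qed
    ultimately have zV: "z \<in> V - {w}" using zW by blast
    then have zl: "lat False z" using V_lat by blast
    obtain c where c: "c \<in> dirs" "mate N z = z + c" "n.nxt z = z + c + c" by (rule n.wh_dir[OF n.V_wh[OF zV]])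
    have ne: "z \<noteq> x" using zm x(3) d(2) by auto
    have "x + d = z + c" using zm c(2) by simp
    from black_ends[OF xl d(1) zl c(1) this] ne have "z = nxt x" unfolding d(3) by argo
    then have zy: "z = y" using x(4) by simp
    have "mate M z \<noteq> x + d"
    proof
      assume "mate M z = x + d"
      moreover have "z \<in> V" using zV by blast
      ultimately have "z = x" using mx mate_mate[OF M V_G, of z] by simp
      then show False using ne by simp
    qed
    then show "y \<in> Y" using zV zm unfolding Y_def zy by simp
  qed
  moreover have "Y \<subseteq> wh False" using V_wh unfolding Y_def by blast
  ultimately have "Y = {}" using no_closed_orbit by blast
  then have V: "mate N x = mate M x" if "x \<in> V - {w}" for x using that unfolding Y_def by blast
  have W: "mate N x = mate M x" if "x \<in> insert fs F \<union> V" for x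
    using that D V unmatched_eq(2,3)[OF N(1) v w N(2)] unmatched_eq(2,3)[OF M v w e] by (metis DiffI Un_iff singletonD)
  have "mate N m = mate M m" if "m \<in> E" for m
  proof -
    have "mate M m \<in> insert fs F \<union> V" by (rule black_mate(1)[OF M that])
    from W[OF this] have "mate N (mate M m) = m" using mate_mate[OF M E_G[OF that]] by simp
    moreover have "mate M m \<in> G" using covering_mate(2)[OF M E_G[OF that]] .
    ultimately show ?thesis using mate_mate[OF N(1), of "mate M m"] by simp
  qed
  then have "mate N x = mate M x" if "x \<in> G" for x using W that by blast
  then have "(\<lambda>x. {x, mate N x}) ` G = (\<lambda>x. {x, mate M x}) ` G" by (intro image_cong) simp_all
  then show ?thesis using covering_image[OF N(1)] covering_image[OF M] by metis
qed

end

text \<open>The bijection from \<open>completion\<close> omits just the white vertices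
  \<open>v\<close> and \<open>w\<close>, and these are covered by the impurity.\<close>

lemma (in face_region) conf_surj:
  assumes v: "v \<in> insert fs F" and w: "w \<in> V" and adj: "diag_adj v w" and g: "g \<in> good_confs F fs v"
  shows "\<exists>M\<in>dimer_coverings G. {v, w} \<in> M \<and> covering_conf F fs v M = g"
proof -
  let ?D = "insert fs F - {v}"
  obtain \<mu> where \<mu>: "\<And>z. z \<in> ?D \<Longrightarrow> \<mu> z = z + g (if z = fs then v else z)"
    "\<And>x. x \<in> V - {w} \<Longrightarrow> \<exists>d\<in>dirs. \<mu> x = x + d" "bij_betw \<mu> (?D \<union> (V - {w})) E"
    by (rule completion[OF v w g]) (rule that)
  define W where "W = ?D \<union> (V - {w})"
  define M where "M = insert {v, w} ((\<lambda>z. {z, \<mu> z}) ` W)"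
  have disj: "insert fs F \<inter> V = {}" using F_lat V_lat lat_disj by blast
  have vW: "v \<notin> W" "w \<notin> W" using v w disj unfolding W_def by blast+
  have WW: "W \<subseteq> insert fs F \<union> V" unfolding W_def by blast
  have \<mu>E: "\<mu> z \<in> E" if "z \<in> W" for z using \<mu>(3) that unfolding W_def by (rule bij_betwE[THEN bspec])
  have inj: "inj_on \<mu> W" using \<mu>(3) unfolding W_def by (rule bij_betw_imp_inj_on)
  have \<mu>dir: "\<exists>d\<in>dirs. \<mu> z = z + d" if "z \<in> W" for z
  proof (cases "z \<in> ?D")
    case True
    then show ?thesis using good_conf_facts[OF v g True] \<mu>(1)[OF True] by metis
  next
    case False
    then show ?thesis using \<mu>(2) that unfolding W_def by blast
  qed
  have zE: "z \<notin> E" if "z \<in> insert fs F \<union> V" for z using white_not_E that .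
  have vE: "v \<notin> E" "w \<notin> E" using zE v w by blast+
  have mem: "e = {v, w} \<or> (\<exists>z\<in>W. e = {z, \<mu> z})" if "e \<in> M" for e using that unfolding M_def by blast
  have Mdc: "M \<in> dimer_coverings G"
    unfolding dimer_coverings_def mem_Collect_eq
  proof (intro conjI ballI)
    have "{v, w} \<in> induced_edges G"
      unfolding induced_edges_def mem_Collect_eq
      using adj F_G[OF v] V_G[OF w] by (intro exI[of _ v] exI[of _ w]) (simp add: gamma_adj_def)
    moreover have "{z, \<mu> z} \<in> induced_edges G" if z: "z \<in> W" for z
    proof -
      obtain d where d: "d \<in> dirs" "\<mu> z = z + d" using \<mu>dir[OF z] by blast
      have "gamma_adj z (\<mu> z)" unfolding d(2) by (rule gamma_adj_step[OF d(1)])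
      moreover have "z \<in> G" "\<mu> z \<in> G" using WW z \<mu>E[OF z] by blast+
      ultimately show ?thesis unfolding induced_edges_def by blast
    qed
    ultimately show "M \<subseteq> induced_edges G" unfolding M_def by blast
    fix x assume x: "x \<in> G"
    consider "x \<in> E" | "x = v \<or> x = w" | "x \<in> W" using x unfolding W_def by blast
    then show "\<exists>!e. e \<in> M \<and> x \<in> e"
    proof cases
      case 1
      then have "x \<in> \<mu> ` W" using \<mu>(3) unfolding W_def bij_betw_def by blast
      then obtain z where z: "z \<in> W" "x = \<mu> z" by blast
      show ?thesis
      proof (rule ex1I[of _ "{z, \<mu> z}"])
        show "{z, \<mu> z} \<in> M \<and> x \<in> {z, \<mu> z}" using z unfolding M_def by blast
        fix e assume e: "e \<in> M \<and> x \<in> e"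
        then consider "e = {v, w}" | y where "y \<in> W" "e = {y, \<mu> y}" using mem by blast
        then show "e = {z, \<mu> z}"
        proof cases
          case 1
          then have "x = v \<or> x = w" using e by simp
          then show ?thesis using vE \<open>x \<in> E\<close> by metis
        next
          case (2 y)
          then have "x = y \<or> x = \<mu> y" using e by simp
          moreover have "x \<noteq> y" using zE[of y] WW 2(1) \<open>x \<in> E\<close> by blast
          ultimately have "\<mu> z = \<mu> y" using z(2) by simp
          then have "z = y" using inj z(1) 2(1) unfolding inj_on_def by blast
          then show ?thesis using 2(2) by simp
        qed
      qed
    next
      case 2
      show ?thesis
      proof (rule ex1I[of _ "{v, w}"])
        show "{v, w} \<in> M \<and> x \<in> {v, w}" using 2 unfolding M_def by blast
        fix e assume e: "e \<in> M \<and> x \<in> e"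
        then consider "e = {v, w}" | y where "y \<in> W" "e = {y, \<mu> y}" using mem by blast
        then show "e = {v, w}"
        proof cases
          case (2 y)
          then have "x = y \<or> x = \<mu> y" using e by simp
          moreover have "x \<noteq> y" using vW 2(1) \<open>x = v \<or> x = w\<close> by blast
          ultimately have "x \<in> E" using \<mu>E[OF 2(1)] by simp
          then show ?thesis using vE \<open>x = v \<or> x = w\<close> by metis
        qed
      qed
    next
      case 3
      show ?thesis
      proof (rule ex1I[of _ "{x, \<mu> x}"])
        show "{x, \<mu> x} \<in> M \<and> x \<in> {x, \<mu> x}" using 3 unfolding M_def by blast
        fix e assume e: "e \<in> M \<and> x \<in> e"
        then consider "e = {v, w}" | y where "y \<in> W" "e = {y, \<mu> y}" using mem by blast
        then show "e = {x, \<mu> x}"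
        proof cases
          case 1
          then have "x = v \<or> x = w" using e by simp
          then show ?thesis using vW 3 by metis
        next
          case (2 y)
          then have "x = y \<or> x = \<mu> y" using e by simp
          moreover have "x \<notin> E" using zE WW 3 by blast
          ultimately have "x = y" using \<mu>E[OF 2(1)] by metis
          then show ?thesis using 2(2) by simp
        qed
      qed
    qed
  qed
  have vwM: "{v, w} \<in> M" unfolding M_def by blast
  interpret c: impurity_covering F fs M v w
    by unfold_locales (use Mdc v w vwM adj in auto)
  have "covering_conf F fs v M = g"
  proof (rule PiE_ext[OF c.conf_PiE])
    show "g \<in> F \<rightarrow>\<^sub>E dirs" using g unfolding good_confs_def by blast
    fix u assume u: "u \<in> F"
    have ufs: "u \<noteq> fs" using u fs_notin by blast
    define z where "z = (if u = v then fs else u)"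
    have z: "z \<in> ?D" unfolding z_def using u ufs fs_notin by auto
    have s: "(if z = fs then v else z) = u" unfolding z_def using ufs by auto
    have zM: "{z, \<mu> z} \<in> M" using z unfolding M_def W_def by blast
    have "z \<in> G" using z by blast
    from covering_mate(4)[OF Mdc this zM] have "mate M z = z + g u" using \<mu>(1)[OF z] s by simp
    then show "covering_conf F fs v M u = g u" unfolding covering_conf_def z_def using u by simp
  qed
  then show ?thesis using Mdc vwM by blast
qed

section \<open>Counting the coverings\<close>

lemma (in face_region) card_impurity_coverings:
  assumes v: "v \<in> insert fs F" and w: "w \<in> V" and adj: "diag_adj v w"
  shows "card {M \<in> dimer_coverings G. {v, w} \<in> M} = card (good_confs F fs v)"
proof (rule bij_betw_same_card[of "covering_conf F fs v"], rule bij_betw_imageI)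
  have loc: "impurity_covering F fs M v w" if "M \<in> dimer_coverings G" "{v, w} \<in> M" for M
    by unfold_locales (use that v w adj in auto)
  show "inj_on (covering_conf F fs v) {M \<in> dimer_coverings G. {v, w} \<in> M}"
  proof (rule inj_onI)
    fix M N assume "M \<in> {M \<in> dimer_coverings G. {v, w} \<in> M}" "N \<in> {M \<in> dimer_coverings G. {v, w} \<in> M}"
      and eq: "covering_conf F fs v M = covering_conf F fs v N"
    then have MN: "M \<in> dimer_coverings G" "{v, w} \<in> M" "N \<in> dimer_coverings G" "{v, w} \<in> N" by blast+
    show "M = N" by (rule impurity_covering.conf_inj[OF loc[OF MN(3,4)] MN(1,2) eq])
  qed
  show "covering_conf F fs v ` {M \<in> dimer_coverings G. {v, w} \<in> M} = good_confs F fs v"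
  proof
    show "covering_conf F fs v ` {M \<in> dimer_coverings G. {v, w} \<in> M} \<subseteq> good_confs F fs v"
      using impurity_covering.conf_good[OF loc] by blast
    show "good_confs F fs v \<subseteq> covering_conf F fs v ` {M \<in> dimer_coverings G. {v, w} \<in> M}"
      using conf_surj[OF v w adj] by blast
  qed
qed

lemma (in face_region) card_face_corners:
  assumes v: "v \<in> F"
  shows "card {w \<in> V. diag_adj v w} = 4"
proof -
  obtain i j where ij: "v = (i, j)" by fastforce
  have lv: "lat True v" using F_lat v by blast
  have odd: "odd i" "odd j" using lv unfolding lat_def ij by simp_all
  have "{w \<in> V. diag_adj v w} = {v + (1, 1), v + (1, -1), v + (-1, 1), v + (-1, -1)}"
  proof
    show "{w \<in> V. diag_adj v w} \<subseteq> {v + (1, 1), v + (1, -1), v + (-1, 1), v + (-1, -1)}"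
    proof
      fix w assume "w \<in> {w \<in> V. diag_adj v w}"
      then have "diag_adj v w" by blast
      from near_lat_diff[OF diag_adj_lat(2)[OF this lv] lv diag_adj_lat(1)[OF this lv]]
      show "w \<in> {v + (1, 1), v + (1, -1), v + (-1, 1), v + (-1, -1)}" .
    qed
    have "v + (1, 1) \<in> V" "v + (1, -1) \<in> V" "v + (-1, 1) \<in> V" "v + (-1, -1) \<in> V"
      using v corners_iff by blast+
    moreover have "diag_adj v (v + (1, 1))" "diag_adj v (v + (1, -1))" "diag_adj v (v + (-1, 1))" "diag_adj v (v + (-1, -1))"
      using odd unfolding ij diag_adj_def white_def by simp_all
    ultimately show "{v + (1, 1), v + (1, -1), v + (-1, 1), v + (-1, -1)} \<subseteq> {w \<in> V. diag_adj v w}" by blast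
  qed
  moreover have "card {v + (1, 1), v + (1, -1), v + (-1, 1), v + (-1, -1)} = 4" unfolding ij by simp
  ultimately show ?thesis by simp
qed

text \<open>Each covering contains exactly one impurity. As its ends lie on different sublattices,
  listing the one in \<open>insert fs F\<close> first counts every diagonal edge once.\<close>

lemma (in face_region) card_coverings:
  assumes V: "V \<noteq> {}"
  shows "card (dimer_coverings G)
    = (\<Sum>v\<in>insert fs F. \<Sum>w\<in>{w \<in> V. diag_adj v w}. card {M \<in> dimer_coverings G. {v, w} \<in> M})"
proof -
  define B where "B q = {M \<in> dimer_coverings G. {fst q, snd q} \<in> M}" for q :: "pt \<times> pt"
  define P where "P = (SIGMA v:insert fs F. {w \<in> V. diag_adj v w})"
  have "induced_edges G \<subseteq> (\<lambda>q. {fst q, snd q}) ` (G \<times> G)"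
  proof
    fix e assume "e \<in> induced_edges G"
    then obtain a b where ab: "e = {a, b}" "a \<in> G" "b \<in> G" unfolding induced_edges_def by blast
    have "(a, b) \<in> G \<times> G" using ab(2,3) by (rule SigmaI)
    moreover have "e = {fst (a, b), snd (a, b)}" unfolding ab(1) by simp
    ultimately show "e \<in> (\<lambda>q. {fst q, snd q}) ` (G \<times> G)" by blast
  qed
  then have "finite (induced_edges G)" using finG finite_subset by blast
  moreover have "dimer_coverings G \<subseteq> Pow (induced_edges G)" unfolding dimer_coverings_def by blast
  ultimately have fin: "finite (dimer_coverings G)" using finite_subset by blast
  have finP: "finite P" unfolding P_def using finF finV by (intro finite_SigmaI) simp_all
  have Pq: "fst q \<in> insert fs F \<and> snd q \<in> V" if "q \<in> P" for q using that unfolding P_def by auto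
  have disj: "B q \<inter> B q' = {}" if q: "q \<in> P" "q' \<in> P" "q \<noteq> q'" for q q'
  proof (rule ccontr)
    assume "B q \<inter> B q' \<noteq> {}"
    then obtain M where M: "M \<in> dimer_coverings G" "{fst q, snd q} \<in> M" "{fst q', snd q'} \<in> M" unfolding B_def by blast
    have "{fst q, snd q} = {fst q', snd q'}"
      using unmatched_eq(1)[OF M(1) _ _ M(2)] unmatched_eq(1)[OF M(1) _ _ M(3)] Pq[OF q(1)] Pq[OF q(2)] by simp
    moreover have "fst q \<noteq> snd q'"
      using F_lat[of "fst q"] V_lat[of "snd q'"] Pq[OF q(1)] Pq[OF q(2)] lat_disj by metis
    ultimately have "fst q = fst q'" "snd q = snd q'" by (metis doubleton_eq_iff)+
    then show False using q(3) by (simp add: prod_eq_iff)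
  qed
  have "dimer_coverings G = (\<Union>q\<in>P. B q)"
  proof
    show "dimer_coverings G \<subseteq> (\<Union>q\<in>P. B q)"
    proof
      fix M assume M: "M \<in> dimer_coverings G"
      obtain v w where vw: "v \<in> insert fs F" "w \<in> V" "diag_adj v w" "{v, w} \<in> M"
        using covering_impurity[OF M V] by blast
      have "(v, w) \<in> P" unfolding P_def using vw by blast
      moreover have "M \<in> B (v, w)" unfolding B_def using M vw by simp
      ultimately show "M \<in> (\<Union>q\<in>P. B q)" by blast
    qed
  qed (use B_def in blast)
  then have "card (dimer_coverings G) = card (\<Union>q\<in>P. B q)" by simp
  also have "\<dots> = (\<Sum>q\<in>P. card (B q))"
  proof (rule card_UN_disjoint[OF finP])
    show "\<forall>i\<in>P. finite (B i)" unfolding B_def using fin by simp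
    show "\<forall>i\<in>P. \<forall>j\<in>P. i \<noteq> j \<longrightarrow> B i \<inter> B j = {}" using disj by blast
  qed
  also have "\<dots> = (\<Sum>v\<in>insert fs F. \<Sum>w\<in>{w \<in> V. diag_adj v w}. card (B (v, w)))"
    unfolding P_def using finF finV by (subst sum.Sigma) (simp_all add: split_def)
  finally show ?thesis unfolding B_def by simp
qed

theorem mainTheorem9:
  fixes F :: "pt set" and fstar :: pt and p :: "pt \<Rightarrow> real"
  assumes finF: "finite F" and neF: "F \<noteq> {}" and FW1: "F \<subseteq> W1"
    and sc_faces: "simply_connected (\<Union>c\<in>F. face_square c)"
    and fstarW1: "fstar \<in> W1" and fstar_notin: "fstar \<notin> F"
    and sc_perp: "simply_connected (perp_complex (insert fstar F))"
    and vstar: "\<exists>vs. vs \<in> corners F \<and> diag_adj vs fstar \<and>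
                    to_plane vs \<in> frontier (\<Union>c\<in>F. face_square c)"
    and G_normal: "normal (corners F \<union> insert fstar F \<union> midpoints F)"
    and p_sol: "\<forall>u\<in>F. (\<Sum>u'\<in>F. Amat u u' * p u') = bvec fstar u"
    and p_fstar: "p fstar = 1"
  shows "(\<forall>v w. v \<in> insert fstar F \<longrightarrow> w \<in> corners F \<union> insert fstar F \<union> midpoints F
             \<longrightarrow> diag_adj v w \<longrightarrow>
           real (card {M \<in> dimer_coverings (corners F \<union> insert fstar F \<union> midpoints F). {v, w} \<in> M})
             = \<bar>det_on F Amat\<bar> * p v)
    \<and> real (card (dimer_coverings (corners F \<union> insert fstar F \<union> midpoints F)))
        = \<bar>det_on F Amat\<bar> * (4 * (\<Sum>v\<in>insert fstar F. p v) + real (dstar F fstar) - 3)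
    \<and> real (card (dimer_coverings (corners F \<union> insert fstar F \<union> midpoints F)))
        = \<bar>det_on F Amat\<bar> * (4 * (\<Sum>u\<in>F. p u) + real (dstar F fstar) + 1)"
proof -
  interpret face_region F fstar
    by unfold_locales (fact finF FW1 sc_faces fstarW1 fstar_notin G_normal)+
  have conf: "real (card (good_confs F fstar v)) = det_on F Amat * p v" if "v \<in> insert fstar F" for v
    by (rule card_good_confs[where p = p, OF finF fstar_notin that _ p_fstar]) (use p_sol in blast)
  \<comment> \<open>The determinant itself counts the configurations for \<open>v = fstar\<close>,
    so it is not negative and equals its absolute value.\<close>
  have "real (card (good_confs F fstar fstar)) = det_on F Amat" using conf[OF insertI1] p_fstar by simp
  then have abs: "\<bar>det_on F Amat\<bar> = det_on F Amat" by (metis abs_of_nat)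
  have one: "real (card {M \<in> dimer_coverings G. {v, w} \<in> M}) = det_on F Amat * p v"
    if "v \<in> insert fstar F" "w \<in> V" "diag_adj v w" for v w
    unfolding card_impurity_coverings[OF that] by (rule conf[OF that(1)])
  have part1: "real (card {M \<in> dimer_coverings G. {v, w} \<in> M}) = \<bar>det_on F Amat\<bar> * p v"
    if "v \<in> insert fstar F" "w \<in> G" "diag_adj v w" for v w
  proof -
    have "lat False w" using diag_adj_lat(1)[OF that(3) F_lat[OF that(1)]] by simp
    then have "w \<in> V" by (rule G_False[OF that(2)])
    then show ?thesis unfolding abs using one that by blast
  qed
  obtain vs where vs: "vs \<in> V" "diag_adj vs fstar" using vstar by blast
  have vs': "diag_adj fstar vs" using vs(2) unfolding diag_adj_def by (simp add: abs_minus_commute)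
  have V: "V \<noteq> {}" using vs by blast
  have "real (card (dimer_coverings G))
    = (\<Sum>v\<in>insert fstar F. \<Sum>w\<in>{w \<in> V. diag_adj v w}. real (card {M \<in> dimer_coverings G. {v, w} \<in> M}))"
    unfolding card_coverings[OF V] by simp
  also have "\<dots> = (\<Sum>v\<in>insert fstar F. \<Sum>w\<in>{w \<in> V. diag_adj v w}. det_on F Amat * p v)"
    by (intro sum.cong refl one) blast+
  also have "\<dots> = (\<Sum>v\<in>insert fstar F. real (card {w \<in> V. diag_adj v w}) * (det_on F Amat * p v))" by simp
  \<comment> \<open>All four corners of a face belong to \<open>H\<close>, but only
    \<open>dstar F fstar + 1\<close> of those around \<open>fstar\<close> do.\<close>
  also have "\<dots> = real (dstar F fstar + 1) * (det_on F Amat * p fstar)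
      + (\<Sum>v\<in>F. real (card {w \<in> V. diag_adj v w}) * (det_on F Amat * p v))"
    using finF fstar_notin card_fs_corners[OF vs(1) vs'] by simp
  also have "(\<Sum>v\<in>F. real (card {w \<in> V. diag_adj v w}) * (det_on F Amat * p v)) = (\<Sum>v\<in>F. 4 * (det_on F Amat * p v))"
    by (intro sum.cong refl) (simp add: card_face_corners)
  also have "\<dots> = 4 * det_on F Amat * (\<Sum>v\<in>F. p v)"
    by (simp add: sum_distrib_left[symmetric] mult.assoc)
  finally have total: "real (card (dimer_coverings G))
      = det_on F Amat * (4 * (\<Sum>u\<in>F. p u) + real (dstar F fstar) + 1)"
    using p_fstar by (simp add: algebra_simps)
  have sum: "(\<Sum>v\<in>insert fstar F. p v) = 1 + (\<Sum>u\<in>F. p u)"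
    using finF fstar_notin p_fstar by simp
  \<comment> \<open>Including \<open>fstar\<close> in the sum adds \<open>4 * p fstar = 4\<close>,
    which turns the constant 1 into -3.\<close>
  have "real (card (dimer_coverings G))
      = det_on F Amat * (4 * (\<Sum>v\<in>insert fstar F. p v) + real (dstar F fstar) - 3)"
    unfolding total sum by (simp add: algebra_simps)
  then show ?thesis using part1 total unfolding abs by blast
qed

end
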